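(* Let $\mathbf X=(\Omega,\mathscr F,\mathscr F_{r,t},\mathbf X(t),\mathbf P_{r,\mathbf x})$ be a TCBVE-process started from time $r\ge 0$ (so $\mathbf P_{r,\mathbf x}\{\mathbf X(r)=\mathbf x\}=1$). For $i=1,2$, let $\zeta_i$ be a $\sigma$-finite measure on $\mathbb R_+$ with $\zeta_i(B)<\infty$ for every bounded Borel set $B\subset\mathbb R_+$. Then for all $t\ge r$ and $\mathbf x\in\mathbb R_+^2$, \[ \mathbf P_{r,\mathbf x}\exp\Big\{-\sum_{i=1}^2\int_{[r,t]}X_i(s)\,\zeta_i(\mathrm ds)\Big\}=\exp\{-\langle\mathbf x,\mathbf w_{r,t}\rangle\}, \] where $r\mapsto\mathbf w_{r,t}=(w_{1,r,t},w_{2,r,t})$ is the unique positive solution on $[0,t]$ of \[ w_{i,r,t}=\int_{[r,t]}\zeta_i(\mathrm ds)-\int_r^t w_{i,s,t}\,b_{ii}(\mathrm ds)+\int_r^t w_{j,s,t}\,b_{ij}(\mathrm ds)-\int_r^t w_{i,s,t}^2\,c_i(\mathrm ds)-\int_r^t\int_{\mathbb R_+^2\setminus\{\mathbf 0\}}K_i(\mathbf w_{s,t},\mathbf z)\,m_i(\mathrm ds,\mathrm d\mathbf z), \] for $r\in[0,t]$, $i,j=1,2$, $j\neq i$.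
   Context: Conventions: $\mathbb R_+=[0,\infty)$; $\langle\cdot,\cdot\rangle$, $\|\cdot\|$ Euclidean inner product and norm on $\mathbb R^2$; for $t\ge r$, $\int_r^t$ means $\int_{(r,t]}$; $\mathbf P_{r,\mathbf x}F$ denotes the expectation of $F$ under $\mathbf P_{r,\mathbf x}$. Parameters: for $i=1,2$ and $j\ne i$: $c_i$ is increasing continuous on $[0,\infty)$ with $c_i(0)=0$; $b_{ii}$ is càdlàg on $[0,\infty)$ with $b_{ii}(0)=0$ and locally bounded variation; $m_i$ is a $\sigma$-finite measure on $(0,\infty)\times(\mathbb R_+^2\setminus\{\mathbf 0\})$ with $\int_0^t\int(z_i^2\mathbf 1_{\{\|\mathbf z\|\le1\}}+z_i\mathbf 1_{\{\|\mathbf z\|>1\}}+z_j)\,m_i(\mathrm ds,\mathrm d\mathbf z)<\infty$ for all $t\ge0$ and $b_{ii}(t)-b_{ii}(t-)+\int z_i\,m_i(\{t\},\mathrm d\mathbf z)\le1$ for all $t$; $b_{ij}$ is increasing càdlàg on $[0,\infty)$ with $b_{ij}(0)=0$. $K_i(\boldsymbol\lambda,\mathbf z)=e^{-\langle\boldsymbol\lambda,\mathbf z\rangle}-1+\lambda_iz_i$. It is known that for each $\boldsymbol\lambda\in\mathbb R_+^2$, $t\ge0$ there is a unique bounded solution $r\mapsto\mathbf v_{r,t}(\boldsymbol\lambda)$ on $[0,t]$ of $v_{i,r,t}(\boldsymbol\lambda)=\lambda_i+\int_r^t v_{j,s,t}(\boldsymbol\lambda)b_{ij}(\mathrm ds)-\int_r^t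 v_{i,s,t}(\boldsymbol\lambda)b_{ii}(\mathrm ds)-\int_r^t v_{i,s,t}(\boldsymbol\lambda)^2c_i(\mathrm ds)-\int_r^t\int K_i(\mathbf v_{s,t}(\boldsymbol\lambda),\mathbf z)m_i(\mathrm ds,\mathrm d\mathbf z)$, and a transition semigroup $(Q_{r,t})_{t\ge r\ge0}$ on $\mathbb R_+^2$ with $\int e^{-\langle\boldsymbol\lambda,\mathbf y\rangle}Q_{r,t}(\mathbf x,\mathrm d\mathbf y)=e^{-\langle\mathbf x,\mathbf v_{r,t}(\boldsymbol\lambda)\rangle}$. A TCBVE-process is a (càdlàg) Markov process in $\mathbb R_+^2$ with transition semigroup $(Q_{r,t})$. *)

theory Defs
  imports "HOL-Probability.Probability"
begin

type_synonym pt = "real \<times> real"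

definition comp :: "nat \<Rightarrow> pt \<Rightarrow> real" where
  "comp i p = (if i = 1 then fst p else snd p)"

definition Rplus2 :: "pt set" where
  "Rplus2 = {0..} \<times> {0..}"

definition Edom :: "(real \<times> pt) set" where
  "Edom = {0<..} \<times> (Rplus2 - {(0, 0)})"

definition Kfun :: "nat \<Rightarrow> pt \<Rightarrow> pt \<Rightarrow> real" where
  "Kfun i l z = exp (- (l \<bullet> z)) - 1 + comp i l * comp i z"

text \<open>Lebesgue-Stieltjes measure of a function F that is increasing and right-continuous on
  [0,oo); F is extended by the constant F 0 to the negative half-line.\<close>
definition LS :: "(real \<Rightarrow> real) \<Rightarrow> real measure" where
  "LS F = interval_measure (\<lambda>x. F (max 0 x))"

definition var_sums :: "(real \<Rightarrow> real) \<Rightarrow> real \<Rightarrow> real \<Rightarrow> real set" where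
  "var_sums f a c = {(\<Sum>k<n. \<bar>f (p (Suc k)) - f (p k)\<bar>) | p n.
      p 0 = a \<and> p n = c \<and> (\<forall>k<n. p k \<le> p (Suc k))}"

definition tvar :: "(real \<Rightarrow> real) \<Rightarrow> real \<Rightarrow> real \<Rightarrow> real" where
  "tvar f a c = Sup (var_sums f a c)"

definition locally_bv :: "(real \<Rightarrow> real) \<Rightarrow> bool" where
  "locally_bv f \<longleftrightarrow> (\<forall>c\<ge>0. bdd_above (var_sums f 0 c))"

text \<open>Jordan decomposition f = bpos f - bneg f on [0,oo).\<close>
definition bpos :: "(real \<Rightarrow> real) \<Rightarrow> real \<Rightarrow> real" where
  "bpos f x = (tvar f 0 x + f x) / 2"

definition bneg :: "(real \<Rightarrow> real) \<Rightarrow> real \<Rightarrow> real" where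
  "bneg f x = (tvar f 0 x - f x) / 2"

definition BVint :: "(real \<Rightarrow> real) \<Rightarrow> real set \<Rightarrow> (real \<Rightarrow> real) \<Rightarrow> real" where
  "BVint f A g = set_lebesgue_integral (LS (bpos f)) A g - set_lebesgue_integral (LS (bneg f)) A g"

definition BVintegrable :: "(real \<Rightarrow> real) \<Rightarrow> real set \<Rightarrow> (real \<Rightarrow> real) \<Rightarrow> bool" where
  "BVintegrable f A g \<longleftrightarrow> set_integrable (LS (bpos f)) A g \<and> set_integrable (LS (bneg f)) A g"

definition cadlag_on0 :: "(real \<Rightarrow> real) \<Rightarrow> bool" where
  "cadlag_on0 f \<longleftrightarrow> (\<forall>x\<ge>0. continuous (at_right x) f \<and> (x > 0 \<longrightarrow> (\<exists>l. (f \<longlongrightarrow> l) (at_left x))))"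

definition moment_fn :: "nat \<Rightarrow> pt \<Rightarrow> real" where
  "moment_fn i z = (if norm z \<le> 1 then (comp i z)\<^sup>2 else comp i z) + comp (3 - i) z"

definition tcbve_params ::
  "(nat \<Rightarrow> real \<Rightarrow> real) \<Rightarrow> (nat \<Rightarrow> nat \<Rightarrow> real \<Rightarrow> real) \<Rightarrow> (nat \<Rightarrow> (real \<times> pt) measure) \<Rightarrow> bool" where
  "tcbve_params c b m \<longleftrightarrow> (\<forall>i\<in>{1::nat,2}.
     mono_on {0..} (c i) \<and> continuous_on {0..} (c i) \<and> c i 0 = 0 \<and>
     cadlag_on0 (b i i) \<and> b i i 0 = 0 \<and> locally_bv (b i i) \<and>
     mono_on {0..} (b i (3 - i)) \<and> cadlag_on0 (b i (3 - i)) \<and> b i (3 - i) 0 = 0 \<and>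
     sets (m i) = sets (restrict_space borel Edom) \<and> sigma_finite_measure (m i) \<and>
     (\<forall>t\<ge>0. set_nn_integral (m i) ({0<..t} \<times> UNIV) (\<lambda>p. ennreal (moment_fn i (snd p))) < \<infinity>) \<and>
     (\<forall>t>0. ereal (b i i t - Lim (at_left t) (b i i))
              + enn2ereal (set_nn_integral (m i) ({t} \<times> UNIV) (\<lambda>p. ennreal (comp i (snd p)))) \<le> 1))"

definition cbve_sol ::
  "(nat \<Rightarrow> real \<Rightarrow> real) \<Rightarrow> (nat \<Rightarrow> nat \<Rightarrow> real \<Rightarrow> real) \<Rightarrow> (nat \<Rightarrow> (real \<times> pt) measure)
    \<Rightarrow> (nat \<Rightarrow> real \<Rightarrow> real) \<Rightarrow> real \<Rightarrow> (real \<Rightarrow> pt) \<Rightarrow> bool" where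
  "cbve_sol c b m a t u \<longleftrightarrow> (\<forall>i\<in>{1::nat,2}. \<forall>r\<in>{0..t}.
     set_integrable (LS (b i (3 - i))) {r<..t} (\<lambda>s. comp (3 - i) (u s)) \<and>
     BVintegrable (b i i) {r<..t} (\<lambda>s. comp i (u s)) \<and>
     set_integrable (LS (c i)) {r<..t} (\<lambda>s. (comp i (u s))\<^sup>2) \<and>
     set_integrable (m i) ({r<..t} \<times> UNIV) (\<lambda>p. Kfun i (u (fst p)) (snd p)) \<and>
     comp i (u r) = a i r
        + set_lebesgue_integral (LS (b i (3 - i))) {r<..t} (\<lambda>s. comp (3 - i) (u s))
        - BVint (b i i) {r<..t} (\<lambda>s. comp i (u s))
        - set_lebesgue_integral (LS (c i)) {r<..t} (\<lambda>s. (comp i (u s))\<^sup>2)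
        - set_lebesgue_integral (m i) ({r<..t} \<times> UNIV) (\<lambda>p. Kfun i (u (fst p)) (snd p)))"

text \<open>v_{r,t}(lambda): the (known unique) bounded solution on [0,t] with source lambda.\<close>
definition vfun ::
  "(nat \<Rightarrow> real \<Rightarrow> real) \<Rightarrow> (nat \<Rightarrow> nat \<Rightarrow> real \<Rightarrow> real) \<Rightarrow> (nat \<Rightarrow> (real \<times> pt) measure)
    \<Rightarrow> real \<Rightarrow> real \<Rightarrow> pt \<Rightarrow> pt" where
  "vfun c b m r t l = (SOME u. cbve_sol c b m (\<lambda>i s. comp i l) t u \<and> bounded (u ` {0..t})) r"

definition tcbve_semigroup ::
  "(nat \<Rightarrow> real \<Rightarrow> real) \<Rightarrow> (nat \<Rightarrow> nat \<Rightarrow> real \<Rightarrow> real) \<Rightarrow> (nat \<Rightarrow> (real \<times> pt) measure)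
    \<Rightarrow> (real \<Rightarrow> real \<Rightarrow> pt \<Rightarrow> pt measure) \<Rightarrow> bool" where
  "tcbve_semigroup c b m Q \<longleftrightarrow> (\<forall>s t y. 0 \<le> s \<and> s \<le> t \<and> y \<in> Rplus2 \<longrightarrow>
     prob_space (Q s t y) \<and> sets (Q s t y) = sets borel \<and> emeasure (Q s t y) (- Rplus2) = 0 \<and>
     (\<forall>l\<in>Rplus2. (\<integral>z. exp (- (l \<bullet> z)) \<partial>Q s t y) = exp (- (y \<bullet> vfun c b m s t l))))"

text \<open>(Omega, F, F_{r,t}, X(t), P_{r,x}) is a cadlag TCBVE-process started from time r:
  P x = P_{r,x}, Fl t = F_{r,t} (t >= r).\<close>
definition tcbve_process ::
  "(nat \<Rightarrow> real \<Rightarrow> real) \<Rightarrow> (nat \<Rightarrow> nat \<Rightarrow> real \<Rightarrow> real) \<Rightarrow> (nat \<Rightarrow> (real \<times> pt) measure)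
    \<Rightarrow> real \<Rightarrow> (pt \<Rightarrow> 'a measure) \<Rightarrow> (real \<Rightarrow> 'a measure) \<Rightarrow> (real \<Rightarrow> 'a \<Rightarrow> pt) \<Rightarrow> bool" where
  "tcbve_process c b m r P Fl X \<longleftrightarrow> (\<exists>Q. tcbve_semigroup c b m Q \<and>
     (\<forall>x\<in>Rplus2. \<forall>x'\<in>Rplus2. sets (P x) = sets (P x')) \<and>
     (\<forall>x\<in>Rplus2.
        prob_space (P x) \<and>
        (\<forall>t\<ge>r. subalgebra (P x) (Fl t) \<and> X t \<in> borel_measurable (Fl t)) \<and>
        (\<forall>s t. r \<le> s \<and> s \<le> t \<longrightarrow> sets (Fl s) \<subseteq> sets (Fl t)) \<and>
        (\<forall>\<omega>\<in>space (P x). (\<forall>t\<ge>r. X t \<omega> \<in> Rplus2) \<and>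
           (\<forall>s\<ge>r. continuous (at_right s) (\<lambda>t. X t \<omega>) \<and>
                   (s > r \<longrightarrow> (\<exists>l. ((\<lambda>t. X t \<omega>) \<longlongrightarrow> l) (at_left s))))) \<and>
        (AE \<omega> in P x. X r \<omega> = x) \<and>
        (\<forall>s t (f :: pt \<Rightarrow> real). r \<le> s \<and> s \<le> t \<and> f \<in> borel_measurable borel \<and> bounded (range f) \<longrightarrow>
           (AE \<omega> in P x. real_cond_exp (P x) (Fl s) (\<lambda>\<omega>'. f (X t \<omega>')) \<omega>
                           = (\<integral>y. f y \<partial>Q s t (X s \<omega>))))))"

end

theory Submission
  imports Defs
begin

text \<open>Both equations read \<open>w r = a r + drift w {r<..t}\<close> with a decreasing nonnegative source \<open>a\<close>. On
  bounded nonnegative functions the drift is Lipschitz with respect to one finite measure \<open>\<mu>\<close> on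
  \<open>{0<..t}\<close>, so a weight function that absorbs the atoms of \<open>\<mu>\<close> yields Gronwall bounds, uniqueness,
  and, after truncation to \<open>[0, M]\<close>, existence by Picard iteration. The truncation is harmless: the
  solution stays nonnegative because the jump condition limits the downward jumps, and it obeys a
  linear bound that does not depend on \<open>M\<close>. If the measures \<open>\<zeta> i\<close> have finite support, the
  Laplace formula follows from the Markov property along the support, since the solution jumps by
  the weights and is a flow in between. A general \<open>\<zeta> i\<close> is moved to the right endpoints of the
  cells of a grid; right-continuity of the paths and continuity of the solution in the source
  give the limit.\<close>

section \<open>Linear Volterra inequalities for a finite measure with atoms\<close>

text \<open>Integrating over \<open>(r, t]\<close> makes the equation explicit at atoms: the value
  at \<open>r\<close> involves only later values, so an atom of any mass can be crossed. It is for
  the sign that the size of an atom counts, through \<open>drift_atom\<close>. The Lipschitz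
  constant of the drift grows with \<open>M\<close>, but the upper estimate keeps only the terms
  that can raise a nonnegative solution, and these are linear with a fixed constant; so
  \<open>M\<close> depends on the size of the source alone and all grid approximations live in one
  square.

  Moving mass along a grid does not give uniform convergence of the sources when there are atoms.
  They converge pointwise, so stability comes from Gronwall applied to the integrated error,
  together with dominated convergence with respect to \<mu>.

  A solution in the sense of \<open>cbve_sol\<close> is only required to make the integrals exist,
  so uniqueness starts by showing that a nonnegative solution is bounded and Borel on
  \<open>(0, t]\<close>. The same step is applied to \<open>vfun\<close>, which is an arbitrary
  choice among bounded solutions.\<close>

lemma finite_measure_open_interval_small:
  fixes M :: "real measure"
  assumes "finite_measure M" and [simp]: "sets M = sets borel" and e: "0 < (e::real)"
  shows "\<exists>d>0. measure M {s<..<s + d} < e \<and> measure M {s - d<..<s} < e"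
proof -
  interpret finite_measure M by fact
  \<comment> \<open>Deleting the centre makes these sets decrease to the empty set, whatever mass
    sits at \<open>s\<close>.\<close>
  define A where "A n = {s - 1 / real (Suc n)<..<s + 1 / real (Suc n)} - {s}" for n
  have A: "range A \<subseteq> sets M" by (auto simp: A_def)
  have "decseq A"
  proof (rule decseq_SucI, rule subsetI)
    fix n x assume "x \<in> A (Suc n)"
    moreover have "1 / real (Suc (Suc n)) \<le> 1 / real (Suc n)" by (simp add: frac_le)
    ultimately show "x \<in> A n" by (auto simp: A_def)
  qed
  with A have "(\<lambda>n. measure M (A n)) \<longlonglongrightarrow> measure M (\<Inter>n. A n)" by (rule finite_Lim_measure_decseq)
  moreover have "(\<Inter>n. A n) = {}"
  proof (rule ccontr)
    assume "\<not> ?thesis"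
    then obtain x where x: "\<forall>n. x \<in> A n" by blast
    have "0 < \<bar>x - s\<bar>" using spec[OF x, of 0] by (simp add: A_def)
    then obtain n where "1 / real (Suc n) < \<bar>x - s\<bar>" by (rule nat_approx_posE)
    with spec[OF x, of n] show False by (auto simp: A_def)
  qed
  ultimately have "\<forall>\<^sub>F n in sequentially. measure M (A n) < e"
    using order_tendstoD(2)[of "\<lambda>n. measure M (A n)" 0 sequentially e] e by simp
  then obtain n where n: "measure M (A n) < e" by (auto simp: eventually_sequentially)
  define d where "d = 1 / real (Suc n)"
  have d: "0 < d" "A n = {s - d<..<s + d} - {s}" by (simp_all add: d_def A_def)
  have less: "measure M B < e" if "B \<subseteq> A n" for B
  proof -
    have "A n \<in> sets M" using A by blast
    from finite_measure_mono[OF that this] n show ?thesis by simp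
  qed
  have "{s<..<s + d} \<subseteq> A n" "{s - d<..<s} \<subseteq> A n" unfolding d(2) using d(1) by auto
  then show ?thesis using d(1) less by (intro exI[of _ d]) simp
qed

lemma (in finite_measure) set_integrable_bounded:
  fixes h :: "'a \<Rightarrow> real"
  assumes "h \<in> borel_measurable M" "\<And>x. \<bar>h x\<bar> \<le> B" "A \<in> sets M"
  shows "set_integrable M A h"
  unfolding set_integrable_def
  by (rule integrable_const_bound[where B="max 0 B"])
     (use assms in \<open>auto split: split_indicator intro!: max.coboundedI2\<close>)

text \<open>\<open>g\<close> plays the role of the exponential of \<open>L\<close> times the mass of
  \<open>(r, t]\<close>. It is extended from right to left: across an open gap on which
  \<open>L\<close> times the mass is at most 1/2 a constant suffices, and an atom at the right end
  of the gap is charged to the part already built. Every point has such gaps on both sides, so the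
  infimum of the times reached is attained and equals 0.\<close>

lemma volterra_weight:
  fixes M :: "real measure"
  assumes fin: "finite_measure M" and sM[simp]: "sets M = sets borel" and t: "0 \<le> t" and L: "0 \<le> (L::real)"
  shows "\<exists>g G. g \<in> borel_measurable borel \<and> (\<forall>r. 1 \<le> g r \<and> g r \<le> G) \<and>
           (\<forall>r\<in>{0..t}. 1 + L * (LINT s:{r<..t}|M. g s) \<le> g r)"
proof -
  interpret finite_measure M by fact
  have [measurable_cong]: "sets M = sets borel" by simp
  define S where "S = {s\<in>{0..t}. \<exists>g G. g \<in> borel_measurable borel \<and> (\<forall>r. 1 \<le> g r \<and> g r \<le> G) \<and>
           (\<forall>r\<in>{s..t}. 1 + L * (LINT s:{r<..t}|M. g s) \<le> g r)}"
  have ext: "s \<in> S" if s': "s' \<in> S" and s: "0 \<le> s" "s < s'" and small: "L * measure M {s<..<s'} \<le> 1/2" for s s'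
  proof -
    from s' have s't: "s' \<le> t" by (auto simp: S_def)
    from s' obtain g G where g[measurable]: "g \<in> borel_measurable borel" and "\<forall>r. 1 \<le> g r \<and> g r \<le> G"
      and "\<forall>r\<in>{s'..t}. 1 + L * (LINT s:{r<..t}|M. g s) \<le> g r"
      unfolding S_def by blast
    then have gG: "\<And>r. 1 \<le> g r" "\<And>r. g r \<le> G"
      and gr: "\<And>r. r \<in> {s'..t} \<Longrightarrow> 1 + L * (LINT s:{r<..t}|M. g s) \<le> g r"
      by blast+
    define I where "I = (LINT s:{s'..t}|M. g s)"
    have I0: "0 \<le> I" unfolding I_def set_lebesgue_integral_def
      by (rule integral_nonneg_AE, rule AE_I2)
        (auto split: split_indicator intro: order_trans[OF zero_le_one gG(1)])
    \<comment> \<open>\<open>B\<close> solves \<open>B = 1 + B / 2 + L * I\<close>: one half of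
      \<open>B\<close> pays for the open gap, and \<open>I\<close> includes the atom at
      \<open>s'\<close>.\<close>
    define B where "B = 2 * (1 + L * I)"
    define g' where "g' = (\<lambda>r. if r < s' then B else g r)"
    have B1: "1 \<le> B" unfolding B_def using L I0 by (simp add: mult_nonneg_nonneg)
    have g'm[measurable]: "g' \<in> borel_measurable borel" unfolding g'_def by measurable
    have "1 + L * (LINT s:{r<..t}|M. g' s) \<le> g' r" if r: "r \<in> {s..t}" for r
    proof (cases "r < s'")
      case False
      then have "(LINT s:{r<..t}|M. g' s) = (LINT s:{r<..t}|M. g s)"
        by (intro set_lebesgue_integral_cong) (auto simp: g'_def)
      then show ?thesis using gr[of r] r False by (auto simp: g'_def)
    next
      case True
      have g'b: "\<bar>g' r\<bar> \<le> max B G" for r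
        using gG[of r] B1 by (auto simp: g'_def)
      have "(LINT s:{r<..t}|M. g' s) = (LINT s:{r<..<s'} \<union> {s'..t}|M. g' s)"
        using True s't by (intro arg_cong[where f="\<lambda>A. set_lebesgue_integral M A g'"]) auto
      also have "\<dots> = (LINT s:{r<..<s'}|M. g' s) + (LINT s:{s'..t}|M. g' s)"
        by (rule set_integral_Un) (auto intro!: set_integrable_bounded g'b simp: measurable_cong_sets[OF sM refl])
      also have "(LINT s:{r<..<s'}|M. g' s) = (LINT s:{r<..<s'}|M. B)"
        by (intro set_lebesgue_integral_cong) (auto simp: g'_def)
      also have "\<dots> = B * measure M {r<..<s'}"
        by (simp add: set_lebesgue_integral_def)
      also have "(LINT s:{s'..t}|M. g' s) = I"
        unfolding I_def by (intro set_lebesgue_integral_cong) (auto simp: g'_def)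
      finally have "L * (LINT s:{r<..t}|M. g' s) = B * (L * measure M {r<..<s'}) + L * I"
        by (simp add: algebra_simps)
      also have "\<dots> \<le> B * (1/2) + L * I"
      proof (intro add_right_mono mult_left_mono)
        have "measure M {r<..<s'} \<le> measure M {s<..<s'}"
          by (rule finite_measure_mono) (use r in auto)
        then show "L * measure M {r<..<s'} \<le> 1/2" using small L by (meson mult_left_mono order_trans)
      qed (use B1 in auto)
      also have "B * (1/2) = 1 + L * I" by (simp add: B_def)
      finally show ?thesis using True by (simp add: g'_def B_def mult.commute)
    qed
    moreover have "1 \<le> g' r \<and> g' r \<le> max B G" for r
      using gG[of r] B1 by (auto simp: g'_def)
    ultimately have "g' \<in> borel_measurable borel \<and> (\<forall>r. 1 \<le> g' r \<and> g' r \<le> max B G) \<and>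
        (\<forall>r\<in>{s..t}. 1 + L * (LINT s:{r<..t}|M. g' s) \<le> g' r)"
      using g'm by blast
    moreover have "s \<in> {0..t}" using s s't by simp
    ultimately show ?thesis unfolding S_def by blast
  qed
  have tS: "t \<in> S" using t unfolding S_def by (auto intro!: exI[of _ "\<lambda>_. 1"] exI[of _ 1] simp: set_lebesgue_integral_def)
  have bdd: "bdd_below S" by (rule bdd_belowI[of _ 0]) (simp add: S_def)
  define i where "i = Inf S"
  have i0: "0 \<le> i" unfolding i_def
  proof (rule cInf_greatest)
    show "S \<noteq> {}" using tS by blast
  qed (simp add: S_def)
  have e0: "0 < 1 / (2 * (L + 1))" using L by simp
  have small: "L * x \<le> 1/2" if "x < 1 / (2 * (L + 1))" for x
  proof -
    have "L * x \<le> L * (1 / (2 * (L + 1)))" using that L by (intro mult_left_mono) auto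
    also have "\<dots> \<le> 1/2" using L by (simp add: field_simps)
    finally show ?thesis .
  qed
  obtain d where d: "d > 0" "measure M {i<..<i + d} < 1 / (2 * (L + 1))" "measure M {i - d<..<i} < 1 / (2 * (L + 1))"
    using finite_measure_open_interval_small[OF fin sM e0] by blast
  \<comment> \<open>Otherwise times of \<open>S\<close> accumulate at \<open>i\<close> from the
    right, and the open gap between \<open>i\<close> and such a time has small mass.\<close>
  have iS: "i \<in> S"
  proof (rule ccontr)
    assume n: "i \<notin> S"
    obtain s' where s': "s' \<in> S" "s' < i + d"
      using cInf_lessD[of S "i + d"] tS d(1) by (auto simp: i_def)
    have "i \<le> s'" using s' bdd by (auto simp: i_def intro: cInf_lower)
    with n s' have "i < s'" by (cases "i = s'") auto
    have "measure M {i<..<s'} \<le> measure M {i<..<i + d}"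
      by (rule finite_measure_mono) (use s' in auto)
    with d have "i \<in> S" by (intro ext[OF s'(1) i0 \<open>i < s'\<close>] small) auto
    with n show False ..
  qed
  \<comment> \<open>A positive infimum could be lowered by one more gap on its left.\<close>
  have "i = 0"
  proof (rule ccontr)
    assume "i \<noteq> 0"
    with i0 have i: "0 < i" by simp
    define s where "s = max 0 (i - d)"
    have "measure M {s<..<i} \<le> measure M {i - d<..<i}"
      by (rule finite_measure_mono) (auto simp: s_def)
    with d i have "s \<in> S" by (intro ext[OF iS] small) (auto simp: s_def)
    then have "i \<le> s" using bdd by (auto simp: i_def intro: cInf_lower)
    with i d(1) show False by (auto simp: s_def)
  qed
  with iS show ?thesis unfolding S_def by blast
qed

text \<open>Comparing \<open>h\<close> with the weight for \<open>2 * L\<close> halves the integral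
  term: the supremum \<open>K\<close> of \<open>h / g\<close> satisfies
  \<open>K \<le> A + K / 2\<close>. The bound \<open>B\<close> makes \<open>K\<close> finite and
  \<open>h\<close> integrable. Since \<open>C\<close> is chosen before \<open>A\<close>,
  \<open>h\<close> and \<open>B\<close>, the a priori bound derived from it does not depend on the
  truncation level.\<close>

lemma volterra_gronwall:
  fixes M :: "real measure"
  assumes fin: "finite_measure M" and sM[simp]: "sets M = sets borel" and t: "0 \<le> t" and L: "0 \<le> (L::real)"
  shows "\<exists>C\<ge>0. \<forall>A\<ge>0. \<forall>h B. h \<in> borel_measurable borel \<longrightarrow> (\<forall>r. 0 \<le> h r \<and> h r \<le> B) \<longrightarrow>
           (\<forall>r\<in>{0..t}. h r \<le> A + L * (LINT s:{r<..t}|M. h s)) \<longrightarrow> (\<forall>r\<in>{0..t}. h r \<le> A * C)"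
proof -
  interpret finite_measure M by fact
  have [measurable_cong]: "sets M = sets borel" by simp
  have "0 \<le> 2 * L" using L by simp
  from volterra_weight[OF fin sM t this]
  obtain g G where g[measurable]: "g \<in> borel_measurable borel" and "\<forall>r. 1 \<le> g r \<and> g r \<le> G"
      and "\<forall>r\<in>{0..t}. 1 + (2 * L) * (LINT s:{r<..t}|M. g s) \<le> g r"
    by blast
  then have gG: "\<And>r. 1 \<le> g r" "\<And>r. g r \<le> G"
      and gr: "\<And>r. r \<in> {0..t} \<Longrightarrow> 1 + (2 * L) * (LINT s:{r<..t}|M. g s) \<le> g r"
    by blast+
  have G1: "1 \<le> G" using gG[of 0] by simp
  show ?thesis
  proof (intro exI[of _ "2 * G"] conjI allI impI ballI)
    fix A B and h r0 assume A: "0 \<le> A" and h[measurable]: "h \<in> borel_measurable borel"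
      and hB: "\<forall>r. 0 \<le> h r \<and> h r \<le> (B::real)" and h': "\<forall>r\<in>{0..t}. h r \<le> A + L * (LINT s:{r<..t}|M. h s)"
      and r0: "r0 \<in> {0..t}"
    define K where "K = (SUP r\<in>{0..t}. h r / g r)"
    have B0: "0 \<le> B" using hB order_trans by blast
    have bdd: "bdd_above ((\<lambda>r. h r / g r) ` {0..t})"
    proof (rule bdd_aboveI2)
      fix r show "h r / g r \<le> B"
        using gG[of r] hB[rule_format, of r] B0
        by (smt (verit, best) divide_le_eq mult_left_mono mult_cancel_left1 zero_less_one)
    qed
    have hK: "h r \<le> K * g r" if "r \<in> {0..t}" for r
      using cSUP_upper[OF that bdd] gG[of r] by (simp add: K_def divide_le_eq)
    have K0: "0 \<le> K" 
      using hK[OF r0] hB gG[of r0] by (smt (verit) mult_neg_pos)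
    have "K \<le> A + K / 2" unfolding K_def
    proof (rule cSUP_least)
      show "{0..t} \<noteq> {}" using t by auto
      fix r assume r: "r \<in> {0..t}"
      have "(LINT s:{r<..t}|M. h s) \<le> (LINT s:{r<..t}|M. K * g s)"
      proof (rule set_integral_mono)
        show "set_integrable M {r<..t} h"
          by (rule set_integrable_bounded[where B=B]) (use hB in \<open>auto simp: measurable_cong_sets[OF sM refl]\<close>)
        show "set_integrable M {r<..t} (\<lambda>s. K * g s)"
          by (rule set_integrable_mult_right, rule set_integrable_bounded[where B=G])
            (use gG order_trans[OF zero_le_one gG(1)] in \<open>auto simp: measurable_cong_sets[OF sM refl]\<close>)
      qed (use r hK in auto)
      also have "\<dots> = K * (LINT s:{r<..t}|M. g s)" by simp
      finally have "L * (LINT s:{r<..t}|M. h s) \<le> K * (L * (LINT s:{r<..t}|M. g s))"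
        using L by (metis mult.left_commute mult_left_mono)
      also have "\<dots> \<le> K * (g r / 2)" using gr[OF r] K0 by (intro mult_left_mono) auto
      finally have "h r \<le> A + K * g r / 2" using h' r by fastforce
      also have "A \<le> A * g r" using A gG[of r] by (simp add: mult_le_cancel_left1)
      finally have "h r \<le> (A + K / 2) * g r" by (simp add: algebra_simps)
      then show "h r / g r \<le> A + (SUP r\<in>{0..t}. h r / g r) / 2"
        using gG[of r] by (simp add: divide_le_eq K_def)
    qed
    then have "K \<le> 2 * A" by simp
    then have "K * g r0 \<le> (2 * A) * G"
      using gG[of r0] A by (intro mult_mono) auto
    with hK[OF r0] show "h r0 \<le> A * (2 * G)" by (simp add: algebra_simps)
  qed (use G1 in auto)
qed

text \<open>In the supremum norm weighted by \<open>1 / g\<close>, with \<open>g\<close> the weight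
  for \<open>2 * L\<close>, the map \<open>T\<close> contracts by the factor 1/2 on
  \<open>[0, t]\<close>. The Lipschitz hypothesis concerns bounded differences, for which the
  Bochner integral on its right side cannot fall back to the default value 0.\<close>

lemma volterra_fixed_point:
  fixes M :: "real measure" and T :: "(real \<Rightarrow> 'b::euclidean_space) \<Rightarrow> real \<Rightarrow> 'b"
  assumes fin: "finite_measure M" and sM[simp]: "sets M = sets borel" and t: "0 \<le> t" and L: "0 \<le> (L::real)"
    and Tm: "\<And>u. u \<in> borel_measurable borel \<Longrightarrow> T u \<in> borel_measurable borel"
    and Tb: "\<And>u r. u \<in> borel_measurable borel \<Longrightarrow> norm (T u r) \<le> R"
    and TL: "\<And>u v r B. u \<in> borel_measurable borel \<Longrightarrow> v \<in> borel_measurable borel \<Longrightarrow> r \<in> {0..t} \<Longrightarrow>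
        (\<And>s. norm (u s - v s) \<le> B) \<Longrightarrow>
        norm (T u r - T v r) \<le> L * (LINT s:{r<..t}|M. norm (u s - v s))"
  shows "\<exists>u. u \<in> borel_measurable borel \<and> (\<forall>r. norm (u r) \<le> R) \<and> (\<forall>r\<in>{0..t}. u r = T u r)"
proof -
  interpret finite_measure M by fact
  have [measurable_cong]: "sets M = sets borel" by simp
  have "0 \<le> 2 * L" using L by simp
  from volterra_weight[OF fin sM t this]
  obtain g G where g[measurable]: "g \<in> borel_measurable borel" and "\<forall>r. 1 \<le> g r \<and> g r \<le> G"
      and "\<forall>r\<in>{0..t}. 1 + (2 * L) * (LINT s:{r<..t}|M. g s) \<le> g r"
    by blast
  then have gG: "\<And>r. 1 \<le> g r" "\<And>r. g r \<le> G"
      and gr: "\<And>r. r \<in> {0..t} \<Longrightarrow> 1 + (2 * L) * (LINT s:{r<..t}|M. g s) \<le> g r"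
    by blast+
  have R0: "0 \<le> R" using Tb[of "\<lambda>_. 0" 0] by (auto intro: order_trans[OF norm_ge_zero])
  have contr: "norm (T u r - T v r) \<le> K / 2 * g r"
    if [measurable]: "u \<in> borel_measurable borel" "v \<in> borel_measurable borel" and r: "r \<in> {0..t}"
      and B: "\<And>s. norm (u s - v s) \<le> B" and K: "\<And>s. s \<in> {0..t} \<Longrightarrow> norm (u s - v s) \<le> K * g s"
    for u v r B K
  proof -
    have K0: "0 \<le> K" using order_trans[OF norm_ge_zero K[OF r]] gG[of r]
      by (smt (verit) mult_neg_pos)
    have "norm (T u r - T v r) \<le> L * (LINT s:{r<..t}|M. norm (u s - v s))"
      by (rule TL) (use that in auto)
    also have "\<dots> \<le> L * (LINT s:{r<..t}|M. K * g s)"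
    proof (intro mult_left_mono set_integral_mono)
      show "set_integrable M {r<..t} (\<lambda>s. norm (u s - v s))"
        by (rule set_integrable_bounded[where B=B]) (use B in \<open>auto simp: measurable_cong_sets[OF sM refl]\<close>)
      show "set_integrable M {r<..t} (\<lambda>s. K * g s)"
        by (rule set_integrable_mult_right, rule set_integrable_bounded[where B=G])
            (use gG order_trans[OF zero_le_one gG(1)] in \<open>auto simp: measurable_cong_sets[OF sM refl]\<close>)
    qed (use r K L in auto)
    also have "\<dots> = K * (L * (LINT s:{r<..t}|M. g s))" by simp
    also have "\<dots> \<le> K * (g r / 2)" using gr[OF r] K0 by (intro mult_left_mono) auto
    finally show ?thesis by simp
  qed
  define U where "U = rec_nat (\<lambda>_::real. 0::'b) (\<lambda>_. T)"
  have U0: "U 0 = (\<lambda>_. 0)" and US: "U (Suc n) = T (U n)" for n by (simp_all add: U_def)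
  have Um[measurable]: "U n \<in> borel_measurable borel" for n
    by (induction n) (auto simp: U0 US intro: Tm)
  have Ub: "norm (U n r) \<le> R" for n r
    by (cases n) (auto simp: U0 US R0 Tb)
  have Ub2: "norm (U n r - U k r) \<le> R + R" for n k r
    using Ub[of n r] Ub[of k r] norm_triangle_ineq4[of "U n r" "U k r"] by linarith
  have step: "\<forall>r\<in>{0..t}. norm (U (Suc n) r - U n r) \<le> R / 2 ^ n * g r" for n
  proof (induction n)
    case 0
    have "R \<le> R * g r" for r using R0 gG[of r] by (simp add: mult_le_cancel_left1)
    then show ?case using Ub[of "Suc 0"] by (auto simp: U0 intro: order_trans)
  next
    case (Suc n)
    show ?case
      using contr[of "U (Suc n)" "U n" _ "R + R" "R / 2 ^ n"] Ub2 Suc Um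
      by (auto simp: US[of "Suc n"] US[of n, symmetric] divide_simps mult.commute)
  qed
  \<comment> \<open>Geometric series: the steps from \<open>n\<close> onwards add up to at most
    twice the first.\<close>
  have far: "norm (U (n + k) r - U n r) \<le> 2 * R / 2 ^ n * (1 - 1 / 2 ^ k) * g r" if r: "r \<in> {0..t}" for n k r
  proof (induction k)
    case (Suc k)
    have "norm (U (n + Suc k) r - U n r) \<le> norm (U (Suc (n + k)) r - U (n + k) r) + norm (U (n + k) r - U n r)"
      using norm_triangle_ineq[of "U (Suc (n + k)) r - U (n + k) r" "U (n + k) r - U n r"] by simp
    also have "\<dots> \<le> R / 2 ^ (n + k) * g r + 2 * R / 2 ^ n * (1 - 1 / 2 ^ k) * g r"
      using step[of "n + k"] r Suc by (intro add_mono) auto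
    also have "\<dots> = 2 * R / 2 ^ n * (1 - 1 / 2 ^ Suc k) * g r"
      by (simp add: field_simps power_add)
    finally show ?case .
  qed simp
  have far': "norm (U (n + k) r - U n r) \<le> 2 * R / 2 ^ n * g r" if r: "r \<in> {0..t}" for n k r
  proof -
    have "2 * R / 2 ^ n * (1 - 1 / 2 ^ k) * g r \<le> 2 * R / 2 ^ n * 1 * g r"
      using R0 gG[of r] by (intro mult_right_mono mult_left_mono) auto
    with far[OF r, of n k] show ?thesis by simp
  qed
  have lim0: "(\<lambda>n. c / 2 ^ n) \<longlonglongrightarrow> 0" for c :: real
    using LIMSEQ_divide_realpow_zero[of 2 c] by simp
  have conv: "convergent (\<lambda>n. U n r)" if r: "r \<in> {0..t}" for r
  proof (rule Cauchy_convergent, rule metric_CauchyI)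
    fix e :: real assume e: "0 < e"
    have "(\<lambda>n. (2 * R * g r) / 2 ^ n) \<longlonglongrightarrow> 0" by (rule lim0)
    then obtain N where N: "(2 * R * g r) / 2 ^ N < e / 2"
      using order_tendstoD(2)[of "\<lambda>n. (2 * R * g r) / 2 ^ n" 0 sequentially "e / 2"] e
      by (auto simp only: eventually_sequentially half_gt_zero)
    have "dist (U n r) (U N r) < e / 2" if "N \<le> n" for n
      using far'[OF r, of N "n - N"] N that by (simp add: dist_norm)
    then show "\<exists>N. \<forall>m\<ge>N. \<forall>n\<ge>N. dist (U m r) (U n r) < e"
      by (metis dist_triangle_half_l dist_commute)
  qed
  \<comment> \<open>The iterates are known to converge on \<open>[0, t]\<close>; the value 0
    elsewhere makes \<open>u\<close> a pointwise limit of Borel functions on the whole line.\<close>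
  define u where "u = (\<lambda>r. lim (\<lambda>n. if r \<in> {0..t} then U n r else 0))"
  have lim: "(\<lambda>n. if r \<in> {0..t} then U n r else 0) \<longlonglongrightarrow> u r" for r
    using conv[of r] by (cases "r \<in> {0..t}") (auto simp: u_def convergent_LIMSEQ_iff)
  have um[measurable]: "u \<in> borel_measurable borel"
    by (rule borel_measurable_LIMSEQ_metric[OF _ lim]) measurable
  have ub: "norm (u r) \<le> R" for r
    by (rule LIMSEQ_le_const2[OF tendsto_norm[OF lim]]) (auto simp: Ub R0)
  have lim': "(\<lambda>n. U n r) \<longlonglongrightarrow> u r" if "r \<in> {0..t}" for r
    using lim[of r] that by simp
  have near: "norm (u r - U n r) \<le> (2 * R / 2 ^ n) * g r" if r: "r \<in> {0..t}" for n r
  proof (rule LIMSEQ_le_const2)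
    show "(\<lambda>k. norm (U (k + n) r - U n r)) \<longlonglongrightarrow> norm (u r - U n r)"
      by (intro tendsto_intros LIMSEQ_ignore_initial_segment lim' r)
    show "\<exists>N. \<forall>k\<ge>N. norm (U (k + n) r - U n r) \<le> 2 * R / 2 ^ n * g r"
      using far'[OF r, of n] by (auto simp: add.commute)
  qed
  have "u r = T u r" if r: "r \<in> {0..t}" for r
  proof (rule LIMSEQ_unique)
    show "(\<lambda>n. U (Suc n) r) \<longlonglongrightarrow> u r"
      using lim'[OF r] by (rule LIMSEQ_Suc)
    have ub2: "norm (u s - U n s) \<le> R + R" for n s
      using ub[of s] Ub[of n s] norm_triangle_ineq4[of "u s" "U n s"] by linarith
    have le: "norm (T (U n) r - T u r) \<le> (R * g r) / 2 ^ n" for n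
      using contr[of u "U n" r "R + R" "2 * R / 2 ^ n"] near ub2 r
      by (simp add: norm_minus_commute)
    have "(\<lambda>n. T (U n) r - T u r) \<longlonglongrightarrow> 0"
      by (rule Lim_null_comparison[OF _ lim0[of "R * g r"]]) (use le in auto)
    then show "(\<lambda>n. U (Suc n) r) \<longlonglongrightarrow> T u r"
      unfolding US by (simp add: LIM_zero_iff)
  qed
  with um ub show ?thesis by blast
qed

section \<open>Lebesgue-Stieltjes measures and functions of bounded variation\<close>

lemma var_sums_step: "a \<le> c \<Longrightarrow> \<bar>f c - f a\<bar> \<in> var_sums f a c"
  unfolding var_sums_def
  by (rule CollectI, rule exI[of _ "\<lambda>k. if k = 0 then a else c"], rule exI[of _ 1]) auto

lemma var_sums_snoc:
  assumes "S \<in> var_sums f a x" "x \<le> y"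
  shows "S + \<bar>f y - f x\<bar> \<in> var_sums f a y"
proof -
  obtain p n where p: "p 0 = a" "p n = x" "\<forall>k<n. p k \<le> p (Suc k)"
    and S: "S = (\<Sum>k<n. \<bar>f (p (Suc k)) - f (p k)\<bar>)"
    using assms(1) by (auto simp: var_sums_def)
  define q where "q = (\<lambda>k. if k \<le> n then p k else y)"
  have "S + \<bar>f y - f x\<bar> = (\<Sum>k<Suc n. \<bar>f (q (Suc k)) - f (q k)\<bar>)"
    using p by (simp add: S q_def)
  moreover have "q 0 = a" "q (Suc n) = y" "\<forall>k<Suc n. q k \<le> q (Suc k)"
    using p assms(2) by (auto simp: q_def less_Suc_eq)
  ultimately show ?thesis unfolding var_sums_def by blast
qed

lemma var_sums_append:
  assumes "S \<in> var_sums f a x" "S' \<in> var_sums f x c"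
  shows "S + S' \<in> var_sums f a c"
proof -
  have "S + (\<Sum>k<n. \<bar>f (p (Suc k)) - f (p k)\<bar>) \<in> var_sums f a (p n)"
    if "p 0 = x" "\<forall>k<n. p k \<le> p (Suc k)" for p n
    using that
  proof (induction n)
    case 0 then show ?case using assms(1) by simp
  next
    case (Suc n)
    then have "S + (\<Sum>k<n. \<bar>f (p (Suc k)) - f (p k)\<bar>) \<in> var_sums f a (p n)" by simp
    from var_sums_snoc[OF this, of "p (Suc n)"] Suc.prems show ?case by (simp add: add.assoc)
  qed
  then show ?thesis using assms(2) by (auto simp: var_sums_def)
qed

lemma var_sums_split_aux:
  fixes f :: "real \<Rightarrow> real"
  assumes "u \<le> v"
  shows "\<bar>f v - f u\<bar> \<le> \<bar>f (min v x) - f (min u x)\<bar> + \<bar>f (max v x) - f (max u x)\<bar>"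
  using assms by (cases "v \<le> x"; cases "u \<le> x") (auto simp: min_def max_def)

text \<open>Clamping a partition at \<open>x\<close> from below and from above refines it at
  \<open>x\<close> without locating \<open>x\<close> among its points; the repeated points that
  arise contribute 0, and \<open>var_sums\<close> admits them.\<close>

lemma var_sums_split:
  assumes "p 0 = a" "p n = c" "\<forall>k<n. p k \<le> p (Suc k)" "a \<le> x" "x \<le> c"
  shows "(\<Sum>k<n. \<bar>f (min (p (Suc k)) x) - f (min (p k) x)\<bar>) \<in> var_sums f a x"
    and "(\<Sum>k<n. \<bar>f (max (p (Suc k)) x) - f (max (p k) x)\<bar>) \<in> var_sums f x c"
    and "(\<Sum>k<n. \<bar>f (p (Suc k)) - f (p k)\<bar>) \<le>
      (\<Sum>k<n. \<bar>f (min (p (Suc k)) x) - f (min (p k) x)\<bar>) + (\<Sum>k<n. \<bar>f (max (p (Suc k)) x) - f (max (p k) x)\<bar>)"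
proof -
  show "(\<Sum>k<n. \<bar>f (min (p (Suc k)) x) - f (min (p k) x)\<bar>) \<in> var_sums f a x"
    unfolding var_sums_def
    by (rule CollectI, rule exI[of _ "\<lambda>k. min (p k) x"], rule exI[of _ n]) (use assms in auto, (fastforce simp: min_def)?)
  show "(\<Sum>k<n. \<bar>f (max (p (Suc k)) x) - f (max (p k) x)\<bar>) \<in> var_sums f x c"
    unfolding var_sums_def
    by (rule CollectI, rule exI[of _ "\<lambda>k. max (p k) x"], rule exI[of _ n]) (use assms in auto, (fastforce simp: max_def)?)
  show "(\<Sum>k<n. \<bar>f (p (Suc k)) - f (p k)\<bar>) \<le>
      (\<Sum>k<n. \<bar>f (min (p (Suc k)) x) - f (min (p k) x)\<bar>) + (\<Sum>k<n. \<bar>f (max (p (Suc k)) x) - f (max (p k) x)\<bar>)"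
    unfolding sum.distrib[symmetric]
    by (intro sum_mono var_sums_split_aux) (use assms in auto)
qed

lemma var_sums_bdd:
  assumes "locally_bv f" "0 \<le> a" "a \<le> c"
  shows "bdd_above (var_sums f a c)"
proof -
  obtain K where K: "\<And>S. S \<in> var_sums f 0 c \<Longrightarrow> S \<le> K"
    using assms unfolding locally_bv_def bdd_above_def by (meson order_trans)
  have "S \<le> K" if "S \<in> var_sums f a c" for S
    using K[OF var_sums_append[OF var_sums_step[OF assms(2)] that]] by linarith
  then show ?thesis by (rule bdd_aboveI)
qed

lemma tvar_upper: "locally_bv f \<Longrightarrow> 0 \<le> a \<Longrightarrow> a \<le> c \<Longrightarrow> S \<in> var_sums f a c \<Longrightarrow> S \<le> tvar f a c"
  unfolding tvar_def by (rule cSup_upper) (auto intro: var_sums_bdd)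

lemma tvar_least:
  assumes "a \<le> c" "\<And>S. S \<in> var_sums f a c \<Longrightarrow> S \<le> K" shows "tvar f a c \<le> K"
  unfolding tvar_def by (rule cSup_least) (use var_sums_step[OF assms(1), of f] assms in auto)

text \<open>Read with either sign of \<open>f y - f x\<close>, this single inequality makes both
  Jordan parts increasing.\<close>

lemma tvar_increment:
  assumes "locally_bv f" "0 \<le> x" "x \<le> y"
  shows "tvar f 0 x + \<bar>f y - f x\<bar> \<le> tvar f 0 y"
proof -
  have "tvar f 0 x \<le> tvar f 0 y - \<bar>f y - f x\<bar>"
  proof (rule tvar_least)
    fix S assume "S \<in> var_sums f 0 x"
    from tvar_upper[OF assms(1) _ _ var_sums_snoc[OF this assms(3)]] assms
    show "S \<le> tvar f 0 y - \<bar>f y - f x\<bar>" by linarith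
  qed (use assms in auto)
  then show ?thesis by simp
qed

lemma bpos_mono: "locally_bv f \<Longrightarrow> mono_on {0..} (bpos f)"
  and bneg_mono: "locally_bv f \<Longrightarrow> mono_on {0..} (bneg f)"
  using tvar_increment[of f] unfolding mono_on_def bpos_def bneg_def by (fastforce simp: divide_simps)+

text \<open>Take a partition of \<open>[x, x + 1]\<close> within \<open>e\<close> of the total
  variation. If \<open>y\<close> lies before its first point beyond \<open>x\<close>, the partition
  spends only \<open>\<bar>f y - f x\<bar>\<close> on \<open>[x, y]\<close>. A partition of
  \<open>[x, y]\<close> with variation above \<open>\<bar>f y - f x\<bar> + e\<close>, continued by
  the rest of the first one, would exceed the total variation on \<open>[x, x + 1]\<close>.\<close>

lemma tvar_small_increment:
  assumes bv: "locally_bv f" and x: "0 \<le> x" and e: "0 < e"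
  shows "\<exists>y0>x. \<forall>y. x < y \<and> y < y0 \<longrightarrow> tvar f 0 y \<le> tvar f 0 x + \<bar>f y - f x\<bar> + e"
proof -
  define c where "c = x + 1"
  have xc: "x \<le> c" by (simp add: c_def)
  obtain S where "S \<in> var_sums f x c" and Se: "tvar f x c - e < S"
    using less_cSup_iff[OF _ var_sums_bdd[OF bv x xc], of "tvar f x c - e"] e var_sums_step[OF xc, of f]
    unfolding tvar_def by (auto simp: tvar_def)
  then obtain p n where p: "p 0 = x" "p n = c" "\<forall>k<n. p k \<le> p (Suc k)"
    and S: "S = (\<Sum>k<n. \<bar>f (p (Suc k)) - f (p k)\<bar>)"
    by (auto simp: var_sums_def)
  define y0 where "y0 = Min (insert c (p ` {k. k \<le> n \<and> x < p k}))"
  have fin: "finite (insert c (p ` {k. k \<le> n \<and> x < p k}))" by simp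
  have y0x: "x < y0" unfolding y0_def by (subst Min_gr_iff) (auto simp: c_def)
  have y0c: "y0 \<le> c" and y0p: "\<And>k. k \<le> n \<Longrightarrow> x < p k \<Longrightarrow> y0 \<le> p k"
    unfolding y0_def by (auto intro!: Min_le)
  have xp: "x \<le> p k" if "k \<le> n" for k
    using that by (induction k) (use p in \<open>auto intro: order_trans\<close>)
  have "tvar f 0 y \<le> tvar f 0 x + \<bar>f y - f x\<bar> + e" if y: "x < y" "y < y0" for y
  proof (rule tvar_least)
    show "0 \<le> y" using x y by simp
    have yc: "y \<le> c" using y y0c by simp
    have two: "min (p k) y = x \<or> min (p k) y = y" if "k \<le> n" for k
      using y0p[OF that] xp[OF that] y by (cases "x < p k") auto
    \<comment> \<open>The clamped points take only the values \<open>x\<close> and \<open>y\<close>,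
      so every increment is one common slope times a length and the sum telescopes; the index of the
      single jump need not be found.\<close>
    have incr: "\<bar>f (min (p (Suc k)) y) - f (min (p k) y)\<bar> =
       (\<bar>f y - f x\<bar> / (y - x)) * (min (p (Suc k)) y - min (p k) y)" if "k < n" for k
    proof -
      have "min (p k) y \<le> min (p (Suc k)) y" using p that by (auto simp: min_def)
      then show ?thesis using two[of k] two[of "Suc k"] that y by auto
    qed
    have "(\<Sum>k<n. \<bar>f (min (p (Suc k)) y) - f (min (p k) y)\<bar>) =
        (\<Sum>k<n. (\<bar>f y - f x\<bar> / (y - x)) * (min (p (Suc k)) y - min (p k) y))"
      by (rule sum.cong) (auto simp: incr)
    also have "\<dots> = (\<bar>f y - f x\<bar> / (y - x)) * (min (p n) y - min (p 0) y)"
      unfolding sum_distrib_left[symmetric] by (subst sum_lessThan_telescope) simp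
    also have "\<dots> = \<bar>f y - f x\<bar>" using p y yc by simp
    finally have eq: "(\<Sum>k<n. \<bar>f (min (p (Suc k)) y) - f (min (p k) y)\<bar>) = \<bar>f y - f x\<bar>" .
    define S' where "S' = (\<Sum>k<n. \<bar>f (max (p (Suc k)) y) - f (max (p k) y)\<bar>)"
    have S': "S' \<in> var_sums f y c" "S \<le> \<bar>f y - f x\<bar> + S'"
      using var_sums_split(2,3)[OF p, of y f] y yc eq by (auto simp: S S'_def)
    fix T assume "T \<in> var_sums f 0 y"
    then obtain q k where q: "q 0 = 0" "q k = y" "\<forall>j<k. q j \<le> q (Suc j)"
      and T: "T = (\<Sum>j<k. \<bar>f (q (Suc j)) - f (q j)\<bar>)"
      by (auto simp: var_sums_def)
    note sp = var_sums_split[OF q, of x f]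
    define T2 where "T2 = (\<Sum>j<k. \<bar>f (max (q (Suc j)) x) - f (max (q j) x)\<bar>)"
    have T1: "T \<le> tvar f 0 x + T2"
      using sp(3) tvar_upper[OF bv _ x sp(1)] x y unfolding T T2_def by linarith
    have "T2 + S' \<in> var_sums f x c" unfolding T2_def
      using var_sums_append[OF sp(2) S'(1)] x y by simp
    from tvar_upper[OF bv x xc this] Se S'(2) T1
    show "T \<le> tvar f 0 x + \<bar>f y - f x\<bar> + e" by linarith
  qed
  with y0x show ?thesis by blast
qed

lemma tvar_right_cont:
  assumes bv: "locally_bv f" and x: "0 \<le> x" and rc: "continuous (at_right x) f"
  shows "continuous (at_right x) (tvar f 0)"
  unfolding continuous_within
proof (rule tendstoI)
  fix e :: real assume e: "0 < e"
  then have e2: "0 < e / 2" by simp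
  obtain y0 where y0: "x < y0" "\<And>y. x < y \<Longrightarrow> y < y0 \<Longrightarrow> tvar f 0 y \<le> tvar f 0 x + \<bar>f y - f x\<bar> + e / 2"
    using tvar_small_increment[OF bv x e2] by blast
  have "\<forall>\<^sub>F y in at_right x. dist (f y) (f x) < e / 2"
    using rc e2 unfolding continuous_within by (rule tendstoD)
  moreover have "\<forall>\<^sub>F y in at_right x. x < y \<and> y < y0"
    using y0(1) by (auto simp: eventually_at_right)
  ultimately show "\<forall>\<^sub>F y in at_right x. dist (tvar f 0 y) (tvar f 0 x) < e"
  proof eventually_elim
    case (elim y)
    then show ?case using y0(2)[of y] tvar_increment[OF bv x, of y] by (auto simp: dist_real_def)
  qed
qed

lemma bpos_right_cont: "locally_bv f \<Longrightarrow> 0 \<le> x \<Longrightarrow> continuous (at_right x) f \<Longrightarrow> continuous (at_right x) (bpos f)"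
  and bneg_right_cont: "locally_bv f \<Longrightarrow> 0 \<le> x \<Longrightarrow> continuous (at_right x) f \<Longrightarrow> continuous (at_right x) (bneg f)"
  unfolding bpos_def[abs_def] bneg_def[abs_def]
  by (auto intro!: continuous_intros tvar_right_cont)

section \<open>Stieltjes measures on the half-line and their atoms\<close>

locale stieltjes =
  fixes F :: "real \<Rightarrow> real"
  assumes mono: "mono_on {0..} F" and rc: "\<And>x. 0 \<le> x \<Longrightarrow> continuous (at_right x) F"
begin

lemma ext_mono: "x \<le> y \<Longrightarrow> F (max 0 x) \<le> F (max 0 y)"
  using mono by (auto intro!: mono_onD[OF mono])

lemma ext_rc: "continuous (at_right a) (\<lambda>x. F (max 0 x))"
proof (cases "0 \<le> a")
  case True
  have "\<forall>\<^sub>F x in at_right a. F x = F (max 0 x)"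
    using True by (auto simp: eventually_at_filter)
  with rc[OF True] True show ?thesis
    unfolding continuous_within by (auto elim: Lim_transform_eventually)
next
  case False
  then have "\<forall>\<^sub>F x in at_right a. F (max 0 x) = F 0"
    unfolding eventually_at_right_field by (intro exI[of _ 0]) auto
  with False show ?thesis
    unfolding continuous_within by (auto intro: tendsto_eventually)
qed

lemma sets_LS [simp, measurable_cong]: "sets (LS F) = sets borel" by (simp add: LS_def)
lemma space_LS [simp]: "space (LS F) = UNIV" by (simp add: LS_def)

lemma emeasure_LS_Ioc: "0 \<le> a \<Longrightarrow> a \<le> b \<Longrightarrow> emeasure (LS F) {a<..b} = ennreal (F b - F a)"
  unfolding LS_def by (subst emeasure_interval_measure_Ioc) (auto intro: ext_mono ext_rc)

lemma measure_LS_Ioc: "0 \<le> a \<Longrightarrow> a \<le> b \<Longrightarrow> measure (LS F) {a<..b} = F b - F a"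
  using mono_onD[OF mono, of a b] by (simp add: measure_def emeasure_LS_Ioc)

lemma sigma_finite_LS: "sigma_finite_measure (LS F)"
  unfolding LS_def by (rule sigma_finite_interval_measure) (auto intro: ext_mono ext_rc)

text \<open>The atom is described along one explicit sequence that stays in \<open>[0, s)\<close>.
  The same sequence can be used for both Jordan parts, whose left limits then never have to be
  identified separately.\<close>

lemma LS_singleton:
  assumes s: "0 < s"
  shows "(\<lambda>n. F s - F (s - s / real (Suc n))) \<longlonglongrightarrow> measure (LS F) {s}"
proof -
  define x where "x n = s - s / real (Suc n)" for n
  have x: "0 \<le> x n" "x n < s" for n using s by (auto simp: x_def field_simps)
  have "(\<lambda>n. measure (LS F) {x n<..s}) \<longlonglongrightarrow> measure (LS F) (\<Inter>n. {x n<..s})"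
  proof (rule Lim_measure_decseq)
    show "decseq (\<lambda>n. {x n<..s})"
    proof (rule decseq_SucI, rule subsetI)
      fix n y assume "y \<in> {x (Suc n)<..s}"
      moreover have "s / real (Suc (Suc n)) \<le> s / real (Suc n)" using s by (intro divide_left_mono) auto
      ultimately show "y \<in> {x n<..s}" by (auto simp: x_def)
    qed
    show "emeasure (LS F) {x n<..s} \<noteq> \<infinity>" for n using x[of n] by (simp add: emeasure_LS_Ioc)
  qed auto
  moreover have "(\<Inter>n. {x n<..s}) = {s}"
  proof (intro equalityI subsetI)
    fix y assume y: "y \<in> (\<Inter>n. {x n<..s})"
    show "y \<in> {s}"
    proof (rule ccontr)
      assume "y \<notin> {s}"
      moreover have "y \<in> {x 0<..s}" using y by blast
      ultimately have "0 < (s - y) / s" using s by auto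
      then obtain n where "1 / real (Suc n) < (s - y) / s" by (rule nat_approx_posE)
      then have "s / real (Suc n) < s - y" using s by (simp add: field_simps)
      moreover have "y \<in> {x n<..s}" using y by blast
      ultimately show False by (simp add: x_def)
    qed
  qed (use x in auto)
  moreover have "measure (LS F) {x n<..s} = F s - F (x n)" for n
    using x[of n] by (intro measure_LS_Ioc) auto
  ultimately show ?thesis by (simp add: x_def)
qed

end

lemma stieltjes_bpos: "locally_bv f \<Longrightarrow> cadlag_on0 f \<Longrightarrow> stieltjes (bpos f)"
  and stieltjes_bneg: "locally_bv f \<Longrightarrow> cadlag_on0 f \<Longrightarrow> stieltjes (bneg f)"
  by (auto simp: stieltjes_def cadlag_on0_def intro: bpos_mono bneg_mono bpos_right_cont bneg_right_cont)

lemma left_approach: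
  fixes s :: real
  assumes "0 < s" shows "filterlim (\<lambda>n. s - s / real (Suc n)) (at_left s) sequentially"
proof -
  have "(\<lambda>n. s - s / real (Suc n)) \<longlonglongrightarrow> s - 0"
    by (intro tendsto_intros LIMSEQ_Suc[OF lim_const_over_n])
  then show ?thesis using assms by (auto simp: filterlim_at intro!: always_eventually)
qed

text \<open>The total variation cancels in the difference of the two atoms, leaving the jump of
  \<open>f\<close> in exactly the form in which the jump condition on the parameters is
  stated.\<close>

lemma LS_bv_jump:
  assumes bv: "locally_bv f" and cf: "cadlag_on0 f" and s: "0 < s"
  shows "measure (LS (bpos f)) {s} - measure (LS (bneg f)) {s} = f s - Lim (at_left s) f"
proof -
  interpret p: stieltjes "bpos f" by (rule stieltjes_bpos) fact+
  interpret n: stieltjes "bneg f" by (rule stieltjes_bneg) fact+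
  obtain l where l: "(f \<longlongrightarrow> l) (at_left s)"
    using cf s unfolding cadlag_on0_def by (meson less_imp_le)
  then have L: "Lim (at_left s) f = l" by (intro tendsto_Lim) auto
  have "(\<lambda>n. f s - f (s - s / real (Suc n))) \<longlonglongrightarrow> f s - l"
    by (intro tendsto_intros filterlim_compose[OF l left_approach] s)
  moreover have "(\<lambda>n. f s - f (s - s / real (Suc n))) \<longlonglongrightarrow> measure (LS (bpos f)) {s} - measure (LS (bneg f)) {s}"
    using tendsto_diff[OF p.LS_singleton[OF s] n.LS_singleton[OF s]]
    by (rule Lim_transform_eventually) (auto simp: bpos_def bneg_def field_simps intro!: always_eventually)
  ultimately show ?thesis unfolding L by (intro LIMSEQ_unique)
qed

text \<open>It removes the quadratic term from the balance at a single time in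
  \<open>drift_atom\<close>.\<close>

lemma LS_continuous_singleton:
  assumes "mono_on {0..} f" "continuous_on {0..} f" and s: "0 < s"
  shows "measure (LS f) {s} = 0"
proof -
  interpret stieltjes f
  proof
    fix x :: real assume "0 \<le> x"
    then show "continuous (at_right x) f"
      using assms(2) by (auto simp: continuous_on_eq_continuous_within intro: continuous_within_subset)
  qed fact
  have "continuous (at_left s) f"
    using assms(2) s continuous_on_interior[of "{0..}" f s] by (auto intro: continuous_at_imp_continuous_at_within)
  then have "(f \<longlongrightarrow> f s) (at_left s)" by (simp add: continuous_within)
  then have "(\<lambda>n. f s - f (s - s / real (Suc n))) \<longlonglongrightarrow> f s - f s"
    by (intro tendsto_intros filterlim_compose[OF _ left_approach] s)
  then show ?thesis using LIMSEQ_unique[OF LS_singleton[OF s]] by simp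
qed

section \<open>Domination by a finite measure on the time axis\<close>

definition sum_measure :: "'k set \<Rightarrow> ('k \<Rightarrow> real measure) \<Rightarrow> real measure" where
  "sum_measure I F = measure_of UNIV (sets borel) (\<lambda>A. \<Sum>k\<in>I. emeasure (F k) A)"

lemma sets_sum_measure [simp, measurable_cong]: "sets (sum_measure I F) = sets borel"
  unfolding sum_measure_def using sets.sets_measure_of_eq[of borel] by simp

lemma emeasure_sum_measure:
  assumes F: "\<And>k. k \<in> I \<Longrightarrow> sets (F k) = sets borel" and A: "A \<in> sets borel"
  shows "emeasure (sum_measure I F) A = (\<Sum>k\<in>I. emeasure (F k) A)"
  unfolding sum_measure_def
proof (rule emeasure_measure_of_sigma)
  show "sigma_algebra UNIV (sets borel)"
    using sets.sigma_algebra_axioms[of borel] by simp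
  show "countably_additive (sets borel) (\<lambda>A. \<Sum>k\<in>I. emeasure (F k) A)"
  proof (rule countably_additiveI)
    fix A :: "nat \<Rightarrow> real set" assume "range A \<subseteq> sets borel" "disjoint_family A"
    then have "(\<Sum>n. emeasure (F k) (A n)) = emeasure (F k) (\<Union>n. A n)" if "k \<in> I" for k
      using F[OF that] by (intro suminf_emeasure) auto
    then show "(\<Sum>n. \<Sum>k\<in>I. emeasure (F k) (A n)) = (\<Sum>k\<in>I. emeasure (F k) (\<Union>n. A n))"
      by (subst suminf_sum) auto
  qed
qed (use A in \<open>auto simp: positive_def\<close>)

text \<open>\<open>N\<close> may live on any space with a time coordinate \<open>\<tau>\<close>.
  With \<open>\<tau>\<close> the identity and \<open>\<rho> = 1\<close> this covers the Stieltjes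
  measures, and with \<open>\<tau> = fst\<close> and \<open>\<rho>\<close> the moment function it
  covers the jump measures, whose total mass may be infinite.\<close>

definition dominates :: "real measure \<Rightarrow> real \<Rightarrow> 'x measure \<Rightarrow> ('x \<Rightarrow> real) \<Rightarrow> ('x \<Rightarrow> real) \<Rightarrow> bool" where
  "dominates \<mu> t N \<tau> \<rho> \<longleftrightarrow> (\<forall>A\<in>sets borel. (\<integral>\<^sup>+p. ennreal (\<rho> p) * indicator (A \<inter> {0<..t}) (\<tau> p) \<partial>N) \<le> emeasure \<mu> A)"

definition time_image :: "real \<Rightarrow> 'x measure \<Rightarrow> ('x \<Rightarrow> real) \<Rightarrow> ('x \<Rightarrow> real) \<Rightarrow> real measure" where
  "time_image t N \<tau> \<rho> = distr (density N (\<lambda>p. ennreal (\<rho> p) * indicator {0<..t} (\<tau> p))) borel \<tau>"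

lemma sets_time_image [simp, measurable_cong]: "sets (time_image t N \<tau> \<rho>) = sets borel"
  by (simp add: time_image_def)

lemma emeasure_time_image:
  assumes [measurable]: "\<tau> \<in> borel_measurable N" "\<rho> \<in> borel_measurable N" "A \<in> sets borel"
  shows "emeasure (time_image t N \<tau> \<rho>) A = (\<integral>\<^sup>+p. ennreal (\<rho> p) * indicator (A \<inter> {0<..t}) (\<tau> p) \<partial>N)"
  unfolding time_image_def
  by (subst emeasure_distr, simp_all, subst emeasure_density, simp_all)
     (auto intro!: nn_integral_cong split: split_indicator)

lemma nn_integral_time_image:
  assumes [measurable]: "\<tau> \<in> borel_measurable N" "\<rho> \<in> borel_measurable N" "h \<in> borel_measurable borel"
  shows "(\<integral>\<^sup>+s. h s \<partial>time_image t N \<tau> \<rho>) = (\<integral>\<^sup>+p. ennreal (\<rho> p) * indicator {0<..t} (\<tau> p) * h (\<tau> p) \<partial>N)"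
  unfolding time_image_def
  by (subst nn_integral_distr, simp_all, subst nn_integral_density, simp_all)

text \<open>A bound of the integrand by a function of time times \<open>\<rho>\<close> lets the
  integral be pushed forward to the time axis, where \<open>\<mu>\<close> takes over. All five kinds
  of integrals in the equation are thereby estimated by integrals over one finite measure.\<close>

lemma dominates_integral:
  fixes f :: "'x \<Rightarrow> real" and h :: "real \<Rightarrow> real"
  assumes dom: "dominates \<mu> t N \<tau> \<rho>" and fin: "finite_measure \<mu>" and s\<mu>: "sets \<mu> = sets borel"
    and [measurable]: "\<tau> \<in> borel_measurable N" "\<rho> \<in> borel_measurable N" "f \<in> borel_measurable N"
      "h \<in> borel_measurable borel" "A \<in> sets borel"
    and \<rho>: "\<And>p. p \<in> space N \<Longrightarrow> 0 \<le> \<rho> p" and h: "\<And>s. 0 \<le> h s" "\<And>s. h s \<le> B"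
    and A: "A \<subseteq> {0<..t}"
    and f: "\<And>p. p \<in> space N \<Longrightarrow> \<tau> p \<in> A \<Longrightarrow> \<bar>f p\<bar> \<le> h (\<tau> p) * \<rho> p"
  shows "integrable N (\<lambda>p. indicator A (\<tau> p) *\<^sub>R f p)"
    and "\<bar>\<integral>p. indicator A (\<tau> p) *\<^sub>R f p \<partial>N\<bar> \<le> (LINT s:A|\<mu>. h s)"
proof -
  interpret finite_measure \<mu> by fact
  have [measurable_cong]: "sets \<mu> = sets borel" by fact
  have int: "set_integrable \<mu> A h"
    using h by (intro set_integrable_bounded[where B=B]) (auto simp: measurable_cong_sets[OF s\<mu> refl] s\<mu>)
  have pos: "0 \<le> (LINT s:A|\<mu>. h s)"
    unfolding set_lebesgue_integral_def by (rule integral_nonneg_AE) (use h in auto)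
  have "(\<integral>\<^sup>+p. ennreal (norm (indicator A (\<tau> p) *\<^sub>R f p)) \<partial>N) \<le>
      (\<integral>\<^sup>+p. ennreal (\<rho> p) * indicator {0<..t} (\<tau> p) * ennreal (indicator A (\<tau> p) * h (\<tau> p)) \<partial>N)"
  proof (rule nn_integral_mono)
    fix p assume p: "p \<in> space N"
    show "ennreal (norm (indicator A (\<tau> p) *\<^sub>R f p)) \<le> ennreal (\<rho> p) * indicator {0<..t} (\<tau> p) * ennreal (indicator A (\<tau> p) * h (\<tau> p))"
    proof (cases "\<tau> p \<in> A")
      case True
      then have "\<tau> p \<in> {0<..t}" using A by auto
      with True f[OF p True] \<rho>[OF p] h(1)[of "\<tau> p"] show ?thesis
        by (simp add: ennreal_mult[symmetric] ennreal_leI mult.commute)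
    qed simp
  qed
  also have "\<dots> = (\<integral>\<^sup>+s. ennreal (indicator A s * h s) \<partial>time_image t N \<tau> \<rho>)"
    by (subst nn_integral_time_image) auto
  also have "\<dots> \<le> (\<integral>\<^sup>+s. ennreal (indicator A s * h s) \<partial>\<mu>)"
  proof (rule nn_integral_mono_measure)
    have "emeasure (time_image t N \<tau> \<rho>) X \<le> emeasure \<mu> X" for X
    proof (cases "X \<in> sets borel")
      case True
      with dom show ?thesis by (simp add: emeasure_time_image dominates_def)
    next
      case False
      then show ?thesis by (simp add: emeasure_notin_sets)
    qed
    moreover have "space (time_image t N \<tau> \<rho>) = space \<mu>"
      using sets_eq_imp_space_eq[OF s\<mu>] by (simp add: time_image_def)
    ultimately show "time_image t N \<tau> \<rho> \<le> \<mu>"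
      unfolding le_measure_iff using s\<mu> by (simp add: le_fun_def)
  qed (simp add: s\<mu>)
  also have "\<dots> = ennreal (LINT s:A|\<mu>. h s)"
    using int h unfolding set_lebesgue_integral_def set_integrable_def
    by (subst nn_integral_eq_integral) auto
  finally have le: "(\<integral>\<^sup>+p. ennreal (norm (indicator A (\<tau> p) *\<^sub>R f p)) \<partial>N) \<le> ennreal (LINT s:A|\<mu>. h s)" .
  show i: "integrable N (\<lambda>p. indicator A (\<tau> p) *\<^sub>R f p)"
    by (rule integrableI_bounded) (use le in \<open>auto simp: order_le_less_trans\<close>)
  have "ennreal (norm (\<integral>p. indicator A (\<tau> p) *\<^sub>R f p \<partial>N)) \<le> ennreal (LINT s:A|\<mu>. h s)"
    using integral_norm_bound_ennreal[OF i] le by (rule order_trans)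
  then show "\<bar>\<integral>p. indicator A (\<tau> p) *\<^sub>R f p \<partial>N\<bar> \<le> (LINT s:A|\<mu>. h s)"
    using pos by simp
qed

lemma dominating_measure:
  assumes I: "finite I" and F: "\<And>k. k \<in> I \<Longrightarrow> sets (F k) = sets borel" "\<And>k. k \<in> I \<Longrightarrow> emeasure (F k) UNIV < \<infinity>"
  shows "finite_measure (sum_measure I F)"
    and "\<And>k A. k \<in> I \<Longrightarrow> A \<in> sets borel \<Longrightarrow> emeasure (F k) A \<le> emeasure (sum_measure I F) A"
proof -
  have "space (sum_measure I F) = UNIV"
    using sets_eq_imp_space_eq[OF sets_sum_measure] by auto
  then show "finite_measure (sum_measure I F)"
    using I F by (intro finite_measureI) (auto simp: emeasure_sum_measure less_top[symmetric])
  show "\<And>k A. k \<in> I \<Longrightarrow> A \<in> sets borel \<Longrightarrow> emeasure (F k) A \<le> emeasure (sum_measure I F) A"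
    using I by (auto simp: emeasure_sum_measure F intro: member_le_sum)
qed

section \<open>Pointwise estimates for the branching kernel\<close>

definition square :: "real \<Rightarrow> pt set" where
  "square M = {p. 0 \<le> fst p \<and> fst p \<le> M \<and> 0 \<le> snd p \<and> snd p \<le> M}"

definition l1_dist :: "pt \<Rightarrow> pt \<Rightarrow> real" where
  "l1_dist p q = \<bar>fst p - fst q\<bar> + \<bar>snd p - snd q\<bar>"

lemma l1_dist_nonneg [simp]: "0 \<le> l1_dist p q" by (simp add: l1_dist_def)

lemma comp_l1_dist: "\<bar>comp i p - comp i q\<bar> \<le> l1_dist p q" by (simp add: comp_def l1_dist_def)

lemma comp_measurable [measurable]: "comp i \<in> borel_measurable borel"
proof -
  have "comp i = (if i = 1 then fst else snd)" by (auto simp: comp_def fun_eq_iff)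
  then show ?thesis by (auto intro!: borel_measurable_continuous_onI continuous_intros)
qed

lemma l1_dist_measurable [measurable (raw)]:
  assumes [measurable]: "u \<in> borel_measurable N" "v \<in> borel_measurable N"
  shows "(\<lambda>s. l1_dist (u s) (v s)) \<in> borel_measurable N"
proof -
  have "(\<lambda>s. l1_dist (u s) (v s)) = (\<lambda>s. \<bar>comp 1 (u s) - comp 1 (v s)\<bar> + \<bar>comp 2 (u s) - comp 2 (v s)\<bar>)"
    by (auto simp: l1_dist_def comp_def)
  then show ?thesis by simp
qed

lemma Kfun_measurable [measurable (raw)]:
  assumes [measurable]: "u \<in> borel_measurable N" "z \<in> borel_measurable N"
  shows "(\<lambda>s. Kfun i (u s) (z s)) \<in> borel_measurable N"
  unfolding Kfun_def by measurable

lemma moment_fn_measurable [measurable]: "moment_fn i \<in> borel_measurable borel"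
  unfolding moment_fn_def[abs_def] by measurable

lemma inner_pt: "p \<bullet> q = fst p * fst q + snd p * snd q" for p q :: pt
  by (simp add: inner_prod_def)

lemma inner_comp: "i \<in> {1,2} \<Longrightarrow> p \<bullet> q = comp i p * comp i q + comp (3 - i) p * comp (3 - i) q"
  by (auto simp: inner_pt comp_def)

lemma l1_dist_comp: "i \<in> {1,2} \<Longrightarrow> l1_dist p q = \<bar>comp i p - comp i q\<bar> + \<bar>comp (3 - i) p - comp (3 - i) q\<bar>"
  by (auto simp: l1_dist_def comp_def)

lemma comp_square: "p \<in> square M \<Longrightarrow> 0 \<le> comp i p \<and> comp i p \<le> M"
  by (auto simp: comp_def square_def)

lemma square_iff: "p \<in> square M \<longleftrightarrow> (\<forall>i\<in>{1,2}. 0 \<le> comp i p \<and> comp i p \<le> M)"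
  by (auto simp: comp_def square_def)

lemma comp_Rplus2: "p \<in> Rplus2 \<Longrightarrow> 0 \<le> comp i p"
  by (auto simp: comp_def Rplus2_def)

lemma Rplus2_iff: "p \<in> Rplus2 \<longleftrightarrow> (\<forall>i\<in>{1,2}. 0 \<le> comp i p)"
  by (cases p) (auto simp: comp_def Rplus2_def)

lemma pt_eqI: "(\<And>i. i \<in> {1,2} \<Longrightarrow> comp i p = comp i q) \<Longrightarrow> p = q"
  by (cases p, cases q) (force simp: comp_def)

lemma moment_fn_nonneg: "z \<in> Rplus2 \<Longrightarrow> 0 \<le> moment_fn i z"
  using comp_Rplus2 by (auto simp: moment_fn_def)

text \<open>\<open>exp (- x) + x\<close> has derivative \<open>1 - exp (- x) \<in> [0, min 1 x]\<close>.\<close>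
lemma exp_plus_lip:
  fixes x y :: real
  assumes "0 \<le> x" "0 \<le> y" "x \<le> B" "y \<le> B"
  shows "\<bar>(exp (- x) + x) - (exp (- y) + y)\<bar> \<le> min 1 B * \<bar>x - y\<bar>"
proof -
  have *: "\<bar>(exp (- x) + x) - (exp (- y) + y)\<bar> \<le> min 1 B * \<bar>x - y\<bar>" if "x < y" "0 \<le> x" "y \<le> B" for x y
  proof -
    have "\<exists>z>x. z < y \<and> (exp (- y) + y) - (exp (- x) + x) = (y - x) * (1 - exp (- z))"
      by (rule MVT2[OF that(1)]) (auto intro!: derivative_eq_intros)
    then obtain z where z: "x < z" "z < y" and eq: "(exp (- y) + y) - (exp (- x) + x) = (y - x) * (1 - exp (- z))"
      by blast
    have "0 \<le> 1 - exp (- z)" "1 - exp (- z) \<le> min 1 B"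
      using z that exp_ge_add_one_self[of "- z"] by auto
    then have "\<bar>1 - exp (- z)\<bar> \<le> min 1 B" by linarith
    then have "\<bar>(y - x) * (1 - exp (- z))\<bar> \<le> \<bar>y - x\<bar> * min 1 B"
      unfolding abs_mult by (intro mult_left_mono) auto
    with eq show ?thesis by (simp add: abs_minus_commute mult.commute)
  qed
  consider "x < y" | "x = y" | "y < x" by linarith
  then show ?thesis
    by cases (use *[of x y] *[of y x] assms in \<open>auto simp: abs_minus_commute\<close>)
qed

text \<open>Up to the constant 1, \<open>Kfun i u z\<close> equals \<open>exp (- x) + x\<close> at
  \<open>x = u \<bullet> z\<close>, minus the linear term of the other component. The derivative
  factor \<open>min 1 (M * (zi + zj))\<close> is used differently on the two parts of
  \<open>x - y\<close>: for small \<open>z\<close> its second entry turns the part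
  \<open>di * zi\<close> into one controlled by \<open>zi\<^sup>2 + zj\<close>, while 1 is enough
  for \<open>dj * zj\<close>. That last term also occurs in the linear part, which explains the 2 in
  \<open>M + 2\<close>.\<close>

lemma Kfun_lip:
  assumes i: "i \<in> {1,2}" and u: "u \<in> square M" and v: "v \<in> square M" and z: "z \<in> Rplus2"
  shows "\<bar>Kfun i u z - Kfun i v z\<bar> \<le> (M + 2) * l1_dist u v * moment_fn i z"
proof -
  define j where "j = 3 - i"
  define zi zj where "zi = comp i z" and "zj = comp j z"
  have zz: "0 \<le> zi" "0 \<le> zj" using comp_Rplus2[OF z] by (auto simp: zi_def zj_def)
  define di dj where "di = \<bar>comp i u - comp i v\<bar>" and "dj = \<bar>comp j u - comp j v\<bar>"
  have d: "l1_dist u v = di + dj" "0 \<le> di" "0 \<le> dj" using l1_dist_comp[OF i, of u v] by (auto simp: di_def dj_def j_def)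
  have M: "0 \<le> M" using u by (auto simp: square_def)
  define x y where "x = u \<bullet> z" and "y = v \<bullet> z"
  have xy: "x = comp i u * zi + comp j u * zj" "y = comp i v * zi + comp j v * zj"
    using inner_comp[OF i] by (auto simp: x_def y_def zi_def zj_def j_def)
  have b: "0 \<le> x" "0 \<le> y" "x \<le> M * (zi + zj)" "y \<le> M * (zi + zj)"
    using comp_square[OF u, of i] comp_square[OF u, of j] comp_square[OF v, of i] comp_square[OF v, of j] zz
    unfolding xy distrib_left by (simp_all add: add_mono mult_right_mono)
  have xyd: "\<bar>x - y\<bar> \<le> di * zi + dj * zj"
  proof -
    have "x - y = (comp i u - comp i v) * zi + (comp j u - comp j v) * zj" by (simp add: xy algebra_simps)
    also have "\<bar>\<dots>\<bar> \<le> \<bar>(comp i u - comp i v) * zi\<bar> + \<bar>(comp j u - comp j v) * zj\<bar>" by (rule abs_triangle_ineq)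
    also have "\<dots> = di * zi + dj * zj" using zz by (simp add: abs_mult di_def dj_def)
    finally show ?thesis .
  qed
  have "Kfun i u z - Kfun i v z = ((exp (- x) + x) - (exp (- y) + y)) - (comp j u - comp j v) * zj"
    by (simp add: Kfun_def x_def[symmetric] y_def[symmetric] xy zi_def[symmetric] algebra_simps)
  then have "\<bar>Kfun i u z - Kfun i v z\<bar> \<le> \<bar>(exp (- x) + x) - (exp (- y) + y)\<bar> + \<bar>(comp j u - comp j v) * zj\<bar>"
    by linarith
  also have "\<dots> \<le> min 1 (M * (zi + zj)) * (di * zi + dj * zj) + dj * zj"
  proof (rule add_mono)
    have "\<bar>(exp (- x) + x) - (exp (- y) + y)\<bar> \<le> min 1 (M * (zi + zj)) * \<bar>x - y\<bar>"
      by (rule exp_plus_lip) (use b in auto)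
    also have "\<dots> \<le> min 1 (M * (zi + zj)) * (di * zi + dj * zj)"
      by (rule mult_left_mono[OF xyd]) (use M zz in auto)
    finally show "\<bar>(exp (- x) + x) - (exp (- y) + y)\<bar> \<le> min 1 (M * (zi + zj)) * (di * zi + dj * zj)" .
  qed (use zz in \<open>simp add: abs_mult dj_def\<close>)
  finally have main: "\<bar>Kfun i u z - Kfun i v z\<bar> \<le> min 1 (M * (zi + zj)) * (di * zi + dj * zj) + dj * zj" .
  show ?thesis
  proof (cases "norm z \<le> 1")
    case True
    have "zi \<le> norm z"
      unfolding zi_def comp_def using norm_fst_le[of "fst z" "snd z"] norm_snd_le[of "snd z" "fst z"] by auto
    then have zi1: "zi \<le> 1" using True by simp
    have m: "moment_fn i z = zi\<^sup>2 + zj" using True by (simp add: moment_fn_def zi_def zj_def j_def)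
    have "min 1 (M * (zi + zj)) * (di * zi + dj * zj) \<le> M * (zi + zj) * (di * zi) + 1 * (dj * zj)"
      unfolding distrib_left[of "min 1 (M * (zi + zj))"] using d zz
      by (intro add_mono[OF mult_right_mono mult_right_mono]) simp_all
    also have "M * (zi + zj) * (di * zi) = M * di * (zi\<^sup>2 + zi * zj)"
      by (simp add: algebra_simps power2_eq_square)
    also have "\<dots> \<le> M * di * (zi\<^sup>2 + zj)"
      using M d zz zi1 by (intro mult_left_mono add_left_mono) (auto simp: mult_left_le_one_le)
    finally have "\<bar>Kfun i u z - Kfun i v z\<bar> \<le> M * di * (zi\<^sup>2 + zj) + 2 * dj * zj" using main by simp
    also have "\<dots> \<le> M * (di + dj) * (zi\<^sup>2 + zj) + 2 * (di + dj) * (zi\<^sup>2 + zj)"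
    proof -
      have "0 \<le> M * dj * (zi\<^sup>2 + zj)" "0 \<le> di * (zi\<^sup>2 + zj)" "0 \<le> dj * zi\<^sup>2" using M d zz by simp_all
      then show ?thesis by (simp add: algebra_simps)
    qed
    finally show ?thesis unfolding m d by (simp add: algebra_simps)
  next
    case False
    then have m: "moment_fn i z = zi + zj" by (simp add: moment_fn_def zi_def zj_def j_def)
    have "min 1 (M * (zi + zj)) * (di * zi + dj * zj) \<le> 1 * (di * zi + dj * zj)"
      using d zz by (intro mult_right_mono) auto
    from add_right_mono[OF this, of "dj * zj"]
    have "\<bar>Kfun i u z - Kfun i v z\<bar> \<le> di * zi + 2 * (dj * zj)" using main by simp
    also have "\<dots> \<le> 2 * (di + dj) * (zi + zj)"
      using d zz by (simp add: algebra_simps)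
    also have "\<dots> \<le> (M + 2) * (di + dj) * (zi + zj)"
      using M d zz by (intro mult_right_mono) auto
    finally show ?thesis unfolding m d .
  qed
qed

text \<open>Unlike the Lipschitz estimate, these one-sided bounds are linear in \<open>u\<close>
  with constants free of \<open>M\<close>. The lower one controls the growth of solutions; the upper
  one controls their sign, since it vanishes with \<open>comp i u\<close> and matches the first
  moment in the jump condition.\<close>

lemma Kfun_ge:
  assumes i: "i \<in> {1,2}" and u: "u \<in> Rplus2" and z: "z \<in> Rplus2"
  shows "- (comp (3 - i) u * comp (3 - i) z) \<le> Kfun i u z" "Kfun i u z \<le> comp i u * comp i z"
proof -
  show "- (comp (3 - i) u * comp (3 - i) z) \<le> Kfun i u z"
    using exp_ge_add_one_self[of "- (u \<bullet> z)"] inner_comp[OF i, of u z] unfolding Kfun_def by linarith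
  have "0 \<le> u \<bullet> z" using u z by (auto simp: inner_pt Rplus2_def)
  then show "Kfun i u z \<le> comp i u * comp i z" by (simp add: Kfun_def)
qed

section \<open>The drift functional\<close>

text \<open>The time set \<open>A\<close> is arbitrary so that the drift can be split into half-open
  intervals, open intervals and single times.\<close>

definition drift :: "(nat \<Rightarrow> real \<Rightarrow> real) \<Rightarrow> (nat \<Rightarrow> nat \<Rightarrow> real \<Rightarrow> real) \<Rightarrow> (nat \<Rightarrow> (real \<times> pt) measure)
    \<Rightarrow> nat \<Rightarrow> (real \<Rightarrow> pt) \<Rightarrow> real set \<Rightarrow> real" where
  "drift c b m i u A = (LINT s:A|LS (b i (3 - i)). comp (3 - i) (u s)) - BVint (b i i) A (\<lambda>s. comp i (u s))
     - (LINT s:A|LS (c i). (comp i (u s))\<^sup>2) - (LINT p:A \<times> UNIV|m i. Kfun i (u (fst p)) (snd p))"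

definition drift_integrable :: "(nat \<Rightarrow> real \<Rightarrow> real) \<Rightarrow> (nat \<Rightarrow> nat \<Rightarrow> real \<Rightarrow> real) \<Rightarrow> (nat \<Rightarrow> (real \<times> pt) measure)
    \<Rightarrow> nat \<Rightarrow> (real \<Rightarrow> pt) \<Rightarrow> real set \<Rightarrow> bool" where
  "drift_integrable c b m i u A \<longleftrightarrow> set_integrable (LS (b i (3 - i))) A (\<lambda>s. comp (3 - i) (u s)) \<and>
     BVintegrable (b i i) A (\<lambda>s. comp i (u s)) \<and>
     set_integrable (LS (c i)) A (\<lambda>s. (comp i (u s))\<^sup>2) \<and>
     set_integrable (m i) (A \<times> UNIV) (\<lambda>p. Kfun i (u (fst p)) (snd p))"

lemma cbve_sol_drift:
  "cbve_sol c b m a t u \<longleftrightarrow> (\<forall>i\<in>{1,2}. \<forall>r\<in>{0..t}.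
     drift_integrable c b m i u {r<..t} \<and> comp i (u r) = a i r + drift c b m i u {r<..t})"
  unfolding cbve_sol_def drift_integrable_def drift_def by (simp add: algebra_simps)

lemma drift_empty [simp]: "drift c b m i u {} = 0"
  by (simp add: drift_def BVint_def set_lebesgue_integral_def)

lemma drift_cong:
  assumes "\<And>s. s \<in> A \<Longrightarrow> u s = v s"
  shows "drift c b m i u A = drift c b m i v A" "drift_integrable c b m i u A = drift_integrable c b m i v A"
proof -
  have r: "(\<lambda>s. indicator A s *\<^sub>R f (u s)) = (\<lambda>s. indicator A s *\<^sub>R f (v s))" for f :: "pt \<Rightarrow> real"
    using assms by (auto simp: fun_eq_iff split: split_indicator)
  have k: "(\<lambda>p. indicator (A \<times> UNIV) p *\<^sub>R Kfun i (u (fst p)) (snd p)) =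
      (\<lambda>p. indicator (A \<times> UNIV) p *\<^sub>R Kfun i (v (fst p)) (snd p))"
    using assms by (auto simp: fun_eq_iff split: split_indicator)
  show "drift c b m i u A = drift c b m i v A"
    unfolding drift_def BVint_def set_lebesgue_integral_def r[of "comp i"] r[of "comp (3 - i)"]
      r[of "\<lambda>p. (comp i p)\<^sup>2"] k ..
  show "drift_integrable c b m i u A = drift_integrable c b m i v A"
    unfolding drift_integrable_def BVintegrable_def set_integrable_def r[of "comp i"] r[of "comp (3 - i)"]
      r[of "\<lambda>p. (comp i p)\<^sup>2"] k ..
qed

text \<open>Measurability and the bound are imposed on the whole line, so that every integrability
  condition of \<open>cbve_sol\<close> follows from them and the Lipschitz estimates apply
  directly.\<close>

definition mild_solution :: "(nat \<Rightarrow> real \<Rightarrow> real) \<Rightarrow> (nat \<Rightarrow> nat \<Rightarrow> real \<Rightarrow> real) \<Rightarrow> (nat \<Rightarrow> (real \<times> pt) measure)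
    \<Rightarrow> real \<Rightarrow> real \<Rightarrow> (nat \<Rightarrow> real \<Rightarrow> real) \<Rightarrow> (real \<Rightarrow> pt) \<Rightarrow> bool" where
  "mild_solution c b m t M a u \<longleftrightarrow> u \<in> borel_measurable borel \<and> (\<forall>s. u s \<in> square M) \<and>
     (\<forall>i\<in>{1,2}. \<forall>r\<in>{0..t}. comp i (u r) = a i r + drift c b m i u {r<..t})"

lemma mild_solutionD:
  assumes "mild_solution c b m t M a u"
  shows "u \<in> borel_measurable borel" "u s \<in> square M"
    "i \<in> {1,2} \<Longrightarrow> r \<in> {0..t} \<Longrightarrow> comp i (u r) = a i r + drift c b m i u {r<..t}"
  using assms unfolding mild_solution_def by blast+

lemma mild_solution_Rplus2: "mild_solution c b m t M a u \<Longrightarrow> u s \<in> Rplus2"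
  using mild_solutionD(2)[of c b m t M a u s] by (auto simp: square_iff Rplus2_iff)

lemma mild_solution_mono: "mild_solution c b m t M a u \<Longrightarrow> M \<le> M' \<Longrightarrow> mild_solution c b m t M' a u"
  unfolding mild_solution_def square_def by (blast intro: order_trans)

text \<open>The constant source of \<open>vfun\<close>, the mass of \<open>[r, t]\<close> and its
  grid versions are all of this kind. Monotonicity gives measurability, and in the sign argument it
  ensures that the source can only help when moving to the left.\<close>

definition source_on :: "real \<Rightarrow> real \<Rightarrow> (nat \<Rightarrow> real \<Rightarrow> real) \<Rightarrow> bool" where
  "source_on t A a \<longleftrightarrow> (\<forall>i\<in>{1,2}. antimono_on {0..t} (a i) \<and> (\<forall>r\<in>{0..t}. 0 \<le> a i r \<and> a i r \<le> A))"

lemma source_onD: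
  assumes "source_on t A a" "i \<in> {1,2}"
  shows "antimono_on {0..t} (a i)" "r \<in> {0..t} \<Longrightarrow> 0 \<le> a i r" "r \<in> {0..t} \<Longrightarrow> a i r \<le> A"
  using assms unfolding source_on_def by blast+

section \<open>The parameters and one dominating measure up to a horizon\<close>

locale tcbve =
  fixes c :: "nat \<Rightarrow> real \<Rightarrow> real" and b :: "nat \<Rightarrow> nat \<Rightarrow> real \<Rightarrow> real" and m :: "nat \<Rightarrow> (real \<times> pt) measure"
  assumes params: "tcbve_params c b m"
begin

lemma
  assumes "i \<in> {1,2}"
  shows stB: "stieltjes (b i (3 - i))" and stP: "stieltjes (bpos (b i i))" and stN: "stieltjes (bneg (b i i))"
    and stC: "stieltjes (c i)" and sets_m: "sets (m i) = sets (restrict_space borel Edom)"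
    and sf_m: "sigma_finite_measure (m i)"
    and moment: "t \<ge> 0 \<Longrightarrow> set_nn_integral (m i) ({0<..t} \<times> UNIV) (\<lambda>p. ennreal (moment_fn i (snd p))) < \<infinity>"
    and jump: "s > 0 \<Longrightarrow> ereal (b i i s - Lim (at_left s) (b i i))
              + enn2ereal (set_nn_integral (m i) ({s} \<times> UNIV) (\<lambda>p. ennreal (comp i (snd p)))) \<le> 1"
    and lbv: "locally_bv (b i i)" "cadlag_on0 (b i i)"
    and cmono: "mono_on {0..} (c i)" "continuous_on {0..} (c i)"
proof -
  note p = bspec[OF params[unfolded tcbve_params_def] assms]
  from p have "mono_on {0..} (b i (3 - i))" "cadlag_on0 (b i (3 - i))" by - (elim conjE, assumption)+
  then show "stieltjes (b i (3 - i))" by (simp add: stieltjes_def cadlag_on0_def)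
  from p show lb: "locally_bv (b i i)" and cb: "cadlag_on0 (b i i)" by - (elim conjE, assumption)+
  show "stieltjes (bpos (b i i))" "stieltjes (bneg (b i i))"
    using stieltjes_bpos[OF lb cb] stieltjes_bneg[OF lb cb] by simp_all
  from p show c: "mono_on {0..} (c i)" "continuous_on {0..} (c i)" by - (elim conjE, assumption)+
  have "continuous (at_right x) (c i)" if "0 \<le> x" for x
    using c(2) that by (auto simp: continuous_on_eq_continuous_within intro: continuous_within_subset)
  with c(1) show "stieltjes (c i)" by (simp add: stieltjes_def)
  from p show "sets (m i) = sets (restrict_space borel Edom)" "sigma_finite_measure (m i)"
    by - (elim conjE, assumption)+
  from p have "\<forall>t\<ge>0. set_nn_integral (m i) ({0<..t} \<times> UNIV) (\<lambda>p. ennreal (moment_fn i (snd p))) < \<infinity>"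
    by - (elim conjE, assumption)
  then show "t \<ge> 0 \<Longrightarrow> set_nn_integral (m i) ({0<..t} \<times> UNIV) (\<lambda>p. ennreal (moment_fn i (snd p))) < \<infinity>" by (rule allE) (erule mp)
  from p have "\<forall>t>0. ereal (b i i t - Lim (at_left t) (b i i))
              + enn2ereal (set_nn_integral (m i) ({t} \<times> UNIV) (\<lambda>p. ennreal (comp i (snd p)))) \<le> 1"
    by - (elim conjE, assumption)
  then show "s > 0 \<Longrightarrow> ereal (b i i s - Lim (at_left s) (b i i))
              + enn2ereal (set_nn_integral (m i) ({s} \<times> UNIV) (\<lambda>p. ennreal (comp i (snd p)))) \<le> 1" by (rule allE) (erule mp)
qed

lemma space_m: "i \<in> {1,2} \<Longrightarrow> space (m i) = Edom"
  using sets_eq_imp_space_eq[OF sets_m] by (simp add: space_restrict_space)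

lemma snd_Rplus2: "i \<in> {1,2} \<Longrightarrow> p \<in> space (m i) \<Longrightarrow> snd p \<in> Rplus2"
  by (auto simp: space_m Edom_def)

lemma measurable_m: "i \<in> {1,2} \<Longrightarrow> f \<in> borel_measurable borel \<Longrightarrow> f \<in> borel_measurable (m i)"
  by (simp add: measurable_cong_sets[OF sets_m refl] measurable_restrict_space1)

lemma fst_m: "i \<in> {1,2} \<Longrightarrow> fst \<in> borel_measurable (m i)"
  and snd_m: "i \<in> {1,2} \<Longrightarrow> snd \<in> borel_measurable (m i)"
  by (auto intro!: measurable_m borel_measurable_continuous_onI continuous_intros)

end

lemma indicator_Times_UNIV: "indicator (A \<times> UNIV) p = indicator A (fst p)"
  by (cases p) (auto simp: indicator_def)

locale tcbve_horizon = tcbve +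
  fixes t :: real and \<mu> :: "real measure"
  assumes t: "0 \<le> t" and fin: "finite_measure \<mu>" and sets_\<mu>: "sets \<mu> = sets borel"
    and domB: "i \<in> {1,2} \<Longrightarrow> dominates \<mu> t (LS (b i (3 - i))) (\<lambda>s. s) (\<lambda>_. 1)"
    and domP: "i \<in> {1,2} \<Longrightarrow> dominates \<mu> t (LS (bpos (b i i))) (\<lambda>s. s) (\<lambda>_. 1)"
    and domN: "i \<in> {1,2} \<Longrightarrow> dominates \<mu> t (LS (bneg (b i i))) (\<lambda>s. s) (\<lambda>_. 1)"
    and domC: "i \<in> {1,2} \<Longrightarrow> dominates \<mu> t (LS (c i)) (\<lambda>s. s) (\<lambda>_. 1)"
    and domK: "i \<in> {1,2} \<Longrightarrow> dominates \<mu> t (m i) fst (\<lambda>p. moment_fn i (snd p))"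

text \<open>\<mu> is a sum of ten finite measures, five for each component: those of the
  off-diagonal \<open>b\<close>, of the two Jordan parts of the diagonal one, of \<open>c\<close>,
  and the time marginal of \<open>m i\<close> weighted by \<open>moment_fn\<close>. The moment
  condition makes the last one finite.\<close>

lemma (in tcbve) horizon_exists:
  assumes t: "0 \<le> t" shows "\<exists>\<mu>. tcbve_horizon c b m t \<mu>"
proof -
  define F :: "nat \<times> nat \<Rightarrow> real measure" where
    "F = (\<lambda>(i, k). if k = 0 then time_image t (LS (b i (3 - i))) (\<lambda>s. s) (\<lambda>_. 1)
       else if k = 1 then time_image t (LS (bpos (b i i))) (\<lambda>s. s) (\<lambda>_. 1)
       else if k = 2 then time_image t (LS (bneg (b i i))) (\<lambda>s. s) (\<lambda>_. 1)
       else if k = 3 then time_image t (LS (c i)) (\<lambda>s. s) (\<lambda>_. 1)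
       else time_image t (m i) fst (\<lambda>p. moment_fn i (snd p)))"
  define I :: "(nat \<times> nat) set" where "I = {1,2} \<times> {..4}"
  have st: "dominates \<mu> t (LS G) (\<lambda>s. s) (\<lambda>_. 1)"
      if "stieltjes G" "\<And>A. A \<in> sets borel \<Longrightarrow> emeasure (time_image t (LS G) (\<lambda>s. s) (\<lambda>_. 1)) A \<le> emeasure \<mu> A" for G \<mu>
  proof -
    interpret stieltjes G by fact
    show ?thesis using that(2) by (auto simp: dominates_def emeasure_time_image)
  qed
  have fin: "emeasure (time_image t (LS G) (\<lambda>s. s) (\<lambda>_. 1)) UNIV < \<infinity>" if "stieltjes G" for G
  proof -
    interpret stieltjes G by fact
    show ?thesis using emeasure_LS_Ioc[of 0 t] t by (simp add: emeasure_time_image)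
  qed
  have finK: "emeasure (time_image t (m i) fst (\<lambda>p. moment_fn i (snd p))) UNIV < \<infinity>" if "i \<in> {1,2}" for i
  proof -
    note [measurable] = fst_m[OF that] snd_m[OF that]
    show ?thesis using moment[OF that t]
      by (subst emeasure_time_image) (simp_all add: indicator_Times_UNIV)
  qed
  have "finite I" by (auto simp: I_def)
  moreover have "sets (F k) = sets borel" for k by (auto simp: F_def split: prod.split)
  moreover have "emeasure (F k) UNIV < \<infinity>" if kI: "k \<in> I" for k
  proof -
    obtain i j where k: "k = (i, j)" and i: "i \<in> {1,2}" using kI unfolding I_def by blast
    show ?thesis using fin[OF stB[OF i]] fin[OF stP[OF i]] fin[OF stN[OF i]] fin[OF stC[OF i]] finK[OF i]
      by (simp add: F_def k)
  qed
  ultimately have *: "finite_measure (sum_measure I F)"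
    "\<And>k A. k \<in> I \<Longrightarrow> A \<in> sets borel \<Longrightarrow> emeasure (F k) A \<le> emeasure (sum_measure I F) A"
    using dominating_measure[of I F] by blast+
  have "tcbve_horizon c b m t (sum_measure I F)"
  proof (intro tcbve_horizon.intro tcbve_axioms tcbve_horizon_axioms.intro)
    fix i :: nat assume i: "i \<in> {1,2}"
    have I: "(i, k) \<in> I" if "k \<le> 4" for k using i that unfolding I_def by blast
    have F: "F (i, 0) = time_image t (LS (b i (3 - i))) (\<lambda>s. s) (\<lambda>_. 1)"
      "F (i, 1) = time_image t (LS (bpos (b i i))) (\<lambda>s. s) (\<lambda>_. 1)"
      "F (i, 2) = time_image t (LS (bneg (b i i))) (\<lambda>s. s) (\<lambda>_. 1)"
      "F (i, 3) = time_image t (LS (c i)) (\<lambda>s. s) (\<lambda>_. 1)"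
      "F (i, 4) = time_image t (m i) fst (\<lambda>p. moment_fn i (snd p))"
      by (simp_all add: F_def)
    show "dominates (sum_measure I F) t (LS (b i (3 - i))) (\<lambda>s. s) (\<lambda>_. 1)"
      by (rule st[OF stB[OF i]], rule *(2)[OF I[of 0], unfolded F]) auto
    show "dominates (sum_measure I F) t (LS (bpos (b i i))) (\<lambda>s. s) (\<lambda>_. 1)"
      by (rule st[OF stP[OF i]], rule *(2)[OF I[of 1], unfolded F]) auto
    show "dominates (sum_measure I F) t (LS (bneg (b i i))) (\<lambda>s. s) (\<lambda>_. 1)"
      by (rule st[OF stN[OF i]], rule *(2)[OF I[of 2], unfolded F]) auto
    show "dominates (sum_measure I F) t (LS (c i)) (\<lambda>s. s) (\<lambda>_. 1)"
      by (rule st[OF stC[OF i]], rule *(2)[OF I[of 3], unfolded F]) auto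
    note [measurable] = fst_m[OF i] snd_m[OF i]
    have "emeasure (time_image t (m i) fst (\<lambda>p. moment_fn i (snd p))) A \<le> emeasure (sum_measure I F) A"
      if "A \<in> sets borel" for A
      by (rule *(2)[OF I[of 4], unfolded F]) (use that in auto)
    then show "dominates (sum_measure I F) t (m i) fst (\<lambda>p. moment_fn i (snd p))"
      by (simp add: dominates_def emeasure_time_image)
  qed (use t *(1) in simp_all)
  then show ?thesis ..
qed

section \<open>Lipschitz, growth and sign estimates for the drift\<close>

context tcbve_horizon
begin

lemma LS_integral:
  fixes f h :: "real \<Rightarrow> real"
  assumes st: "stieltjes G" and dom: "dominates \<mu> t (LS G) (\<lambda>s. s) (\<lambda>_. 1)"
    and [measurable]: "f \<in> borel_measurable borel" "h \<in> borel_measurable borel" "A \<in> sets borel"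
    and h: "\<And>s. 0 \<le> h s" "\<And>s. h s \<le> B" and A: "A \<subseteq> {0<..t}"
    and f: "\<And>s. s \<in> A \<Longrightarrow> \<bar>f s\<bar> \<le> h s"
  shows "set_integrable (LS G) A f" "\<bar>LINT s:A|LS G. f s\<bar> \<le> (LINT s:A|\<mu>. h s)"
proof -
  interpret stieltjes G by fact
  show "set_integrable (LS G) A f"
    unfolding set_integrable_def
    by (rule dominates_integral(1)[OF dom fin sets_\<mu>, where h=h and B=B]) (use h f A in auto)
  show "\<bar>LINT s:A|LS G. f s\<bar> \<le> (LINT s:A|\<mu>. h s)"
    unfolding set_lebesgue_integral_def[of "LS G"]
    by (rule dominates_integral(2)[OF dom fin sets_\<mu>, where h=h and B=B]) (use h f A in auto)
qed

lemma m_integral: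
  fixes f :: "real \<times> pt \<Rightarrow> real" and h :: "real \<Rightarrow> real"
  assumes i: "i \<in> {1,2}"
    and [measurable]: "f \<in> borel_measurable (m i)" "h \<in> borel_measurable borel" "A \<in> sets borel"
    and h: "\<And>s. 0 \<le> h s" "\<And>s. h s \<le> B" and A: "A \<subseteq> {0<..t}"
    and f: "\<And>p. p \<in> space (m i) \<Longrightarrow> fst p \<in> A \<Longrightarrow> \<bar>f p\<bar> \<le> h (fst p) * moment_fn i (snd p)"
  shows "set_integrable (m i) (A \<times> UNIV) f" "\<bar>LINT p:A \<times> UNIV|m i. f p\<bar> \<le> (LINT s:A|\<mu>. h s)"
proof -
  note [measurable] = fst_m[OF i] snd_m[OF i]
  show "set_integrable (m i) (A \<times> UNIV) f"
    unfolding set_integrable_def indicator_Times_UNIV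
    by (rule dominates_integral(1)[OF domK[OF i] fin sets_\<mu>, where h=h and B=B])
       (use h f A in \<open>auto intro: moment_fn_nonneg snd_Rplus2[OF i]\<close>)
  show "\<bar>LINT p:A \<times> UNIV|m i. f p\<bar> \<le> (LINT s:A|\<mu>. h s)"
    unfolding set_lebesgue_integral_def[of "m i"] indicator_Times_UNIV
    by (rule dominates_integral(2)[OF domK[OF i] fin sets_\<mu>, where h=h and B=B])
       (use h f A in \<open>auto intro: moment_fn_nonneg snd_Rplus2[OF i]\<close>)
qed

lemma set_integrable_\<mu>:
  fixes h :: "real \<Rightarrow> real"
  assumes "h \<in> borel_measurable borel" "\<And>s. \<bar>h s\<bar> \<le> B" "A \<in> sets borel"
  shows "set_integrable \<mu> A h"
  using finite_measure.set_integrable_bounded[OF fin, of h B A] assms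
  by (simp add: measurable_cong_sets[OF sets_\<mu> refl] sets_\<mu>)

lemma LS_lip:
  fixes f g d :: "real \<Rightarrow> real"
  assumes st: "stieltjes G" and dom: "dominates \<mu> t (LS G) (\<lambda>s. s) (\<lambda>_. 1)"
    and [measurable]: "f \<in> borel_measurable borel" "g \<in> borel_measurable borel" "d \<in> borel_measurable borel" "A \<in> sets borel"
    and A: "A \<subseteq> {0<..t}" and fb: "\<And>s. \<bar>f s\<bar> \<le> B" and gb: "\<And>s. \<bar>g s\<bar> \<le> B"
    and d: "\<And>s. 0 \<le> d s" "\<And>s. d s \<le> D"
    and fg: "\<And>s. \<bar>f s - g s\<bar> \<le> k * d s" and k: "0 \<le> k"
  shows "\<bar>(LINT s:A|LS G. f s) - (LINT s:A|LS G. g s)\<bar> \<le> k * (LINT s:A|\<mu>. d s)"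
proof -
  have B: "0 \<le> B" using fb[of 0] by linarith
  have "(LINT s:A|LS G. f s) - (LINT s:A|LS G. g s) = (LINT s:A|LS G. f s - g s)"
    by (rule set_integral_diff(2)[symmetric]; rule LS_integral(1)[OF st dom, where h="\<lambda>_. B" and B=B])
      (use A fb gb B in auto)
  also have "\<bar>\<dots>\<bar> \<le> (LINT s:A|\<mu>. k * d s)"
    by (rule LS_integral(2)[OF st dom, where B="k * D"]) (use A d fg k in \<open>auto intro: mult_left_mono\<close>)
  finally show ?thesis by simp
qed

lemma K_integrand_measurable:
  "i \<in> {1,2} \<Longrightarrow> u \<in> borel_measurable borel \<Longrightarrow> (\<lambda>p. Kfun i (u (fst p)) (snd p)) \<in> borel_measurable (m i)"
proof -
  assume i: "i \<in> {1,2}" and [measurable]: "u \<in> borel_measurable borel"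
  note [measurable] = fst_m[OF i] snd_m[OF i]
  show ?thesis by measurable
qed

lemma K_bound:
  assumes i: "i \<in> {1,2}" and u: "u \<in> square M" and z: "z \<in> Rplus2"
  shows "\<bar>Kfun i u z\<bar> \<le> (M + 2) * (2 * M) * moment_fn i z"
proof -
  have M: "0 \<le> M" using u by (auto simp: square_def)
  have "\<bar>Kfun i u z - Kfun i (0, 0) z\<bar> \<le> (M + 2) * l1_dist u (0, 0) * moment_fn i z"
    by (rule Kfun_lip[OF i u _ z]) (use M in \<open>auto simp: square_def\<close>)
  also have "\<dots> \<le> (M + 2) * (2 * M) * moment_fn i z"
    using u M moment_fn_nonneg[OF z] by (intro mult_right_mono mult_left_mono) (auto simp: l1_dist_def square_def)
  moreover have "Kfun i (0, 0) z = 0" by (simp add: Kfun_def comp_def inner_pt)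
  ultimately show ?thesis by simp
qed

lemma drift_integrable_square:
  assumes i: "i \<in> {1,2}" and [measurable]: "u \<in> borel_measurable borel" "A \<in> sets borel"
    and u: "\<And>s. u s \<in> square M" and A: "A \<subseteq> {0<..t}"
  shows "drift_integrable c b m i u A"
proof -
  have M: "0 \<le> M" using u[of 0] by (auto simp: square_def)
  have sq: "\<bar>(comp i (u s))\<^sup>2\<bar> \<le> M\<^sup>2" for s using comp_square[OF u, of i s] by (auto intro: power_mono)
  show ?thesis
    unfolding drift_integrable_def BVintegrable_def
  proof (intro conjI)
    show "set_integrable (LS (b i (3 - i))) A (\<lambda>s. comp (3 - i) (u s))"
      by (rule LS_integral(1)[OF stB[OF i] domB[OF i], where h="\<lambda>_. M" and B=M]) (use M A comp_square[OF u] in auto)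
    show "set_integrable (LS (bpos (b i i))) A (\<lambda>s. comp i (u s))"
      by (rule LS_integral(1)[OF stP[OF i] domP[OF i], where h="\<lambda>_. M" and B=M]) (use M A comp_square[OF u] in auto)
    show "set_integrable (LS (bneg (b i i))) A (\<lambda>s. comp i (u s))"
      by (rule LS_integral(1)[OF stN[OF i] domN[OF i], where h="\<lambda>_. M" and B=M]) (use M A comp_square[OF u] in auto)
    show "set_integrable (LS (c i)) A (\<lambda>s. (comp i (u s))\<^sup>2)"
      by (rule LS_integral(1)[OF stC[OF i] domC[OF i], where h="\<lambda>_. M\<^sup>2" and B="M\<^sup>2"]) (use M A sq in auto)
    show "set_integrable (m i) (A \<times> UNIV) (\<lambda>p. Kfun i (u (fst p)) (snd p))"
      by (rule m_integral(1)[OF i K_integrand_measurable[OF i], where h="\<lambda>_. (M + 2) * (2 * M)" and B="(M + 2) * (2 * M)"])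
        (use M A in \<open>auto intro!: K_bound[OF i] u snd_Rplus2[OF i]\<close>)
  qed
qed

text \<open>The three linear integrals contribute 1 each, the square contributes
  \<open>2 * M\<close> and the kernel \<open>M + 2\<close>.\<close>

lemma drift_lip:
  assumes i: "i \<in> {1,2}" and um[measurable]: "u \<in> borel_measurable borel" and vm[measurable]: "v \<in> borel_measurable borel"
    and [measurable]: "A \<in> sets borel"
    and u: "\<And>s. u s \<in> square M" and v: "\<And>s. v s \<in> square M" and A: "A \<subseteq> {0<..t}"
  shows "\<bar>drift c b m i u A - drift c b m i v A\<bar> \<le> (3 * M + 5) * (LINT s:A|\<mu>. l1_dist (u s) (v s))"
proof -
  have M: "0 \<le> M" using u[of 0] by (auto simp: square_def)
  have bu: "\<bar>comp k (u s)\<bar> \<le> M" and bv: "\<bar>comp k (v s)\<bar> \<le> M" for k s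
    using comp_square[OF u, of k s] comp_square[OF v, of k s] by auto
  have squ: "\<bar>(comp i (u s))\<^sup>2\<bar> \<le> M\<^sup>2" "\<bar>(comp i (v s))\<^sup>2\<bar> \<le> M\<^sup>2" for s
    using comp_square[OF u, of i s] comp_square[OF v, of i s] by (auto intro: power_mono)
  have sqd: "\<bar>(comp i (u s))\<^sup>2 - (comp i (v s))\<^sup>2\<bar> \<le> (2 * M) * l1_dist (u s) (v s)" for s
  proof -
    have "(comp i (u s))\<^sup>2 - (comp i (v s))\<^sup>2 = (comp i (u s) + comp i (v s)) * (comp i (u s) - comp i (v s))"
      by (simp add: power2_eq_square algebra_simps)
    also have "\<bar>\<dots>\<bar> \<le> (2 * M) * l1_dist (u s) (v s)"
      unfolding abs_mult using bu[of i s] bv[of i s] M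
      by (intro mult_mono comp_l1_dist) linarith+
    finally show ?thesis .
  qed
  have d: "l1_dist (u s) (v s) \<le> 2 * M" for s
    using u[of s] v[of s] by (auto simp: square_def l1_dist_def)
  have lin: "\<bar>comp k (u s) - comp k (v s)\<bar> \<le> 1 * l1_dist (u s) (v s)" for k s
    by (simp add: comp_l1_dist)
  define J where "J = (LINT s:A|\<mu>. l1_dist (u s) (v s))"
  have 1: "\<bar>(LINT s:A|LS (b i (3 - i)). comp (3 - i) (u s)) - (LINT s:A|LS (b i (3 - i)). comp (3 - i) (v s))\<bar> \<le> 1 * J"
    unfolding J_def by (rule LS_lip[OF stB[OF i] domB[OF i], where B=M and D="2 * M"]) (use A bu bv d lin in auto)
  have 2: "\<bar>(LINT s:A|LS (bpos (b i i)). comp i (u s)) - (LINT s:A|LS (bpos (b i i)). comp i (v s))\<bar> \<le> 1 * J"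
    unfolding J_def by (rule LS_lip[OF stP[OF i] domP[OF i], where B=M and D="2 * M"]) (use A bu bv d lin in auto)
  have 3: "\<bar>(LINT s:A|LS (bneg (b i i)). comp i (u s)) - (LINT s:A|LS (bneg (b i i)). comp i (v s))\<bar> \<le> 1 * J"
    unfolding J_def by (rule LS_lip[OF stN[OF i] domN[OF i], where B=M and D="2 * M"]) (use A bu bv d lin in auto)
  have 4: "\<bar>(LINT s:A|LS (c i). (comp i (u s))\<^sup>2) - (LINT s:A|LS (c i). (comp i (v s))\<^sup>2)\<bar> \<le> (2 * M) * J"
    unfolding J_def by (rule LS_lip[OF stC[OF i] domC[OF i], where B="M\<^sup>2" and D="2 * M"]) (use A squ sqd d M in auto)
  have 5: "\<bar>(LINT p:A \<times> UNIV|m i. Kfun i (u (fst p)) (snd p)) - (LINT p:A \<times> UNIV|m i. Kfun i (v (fst p)) (snd p))\<bar> \<le> (M + 2) * J"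
  proof -
    note [measurable] = K_integrand_measurable[OF i]
    have "(LINT p:A \<times> UNIV|m i. Kfun i (u (fst p)) (snd p)) - (LINT p:A \<times> UNIV|m i. Kfun i (v (fst p)) (snd p))
      = (LINT p:A \<times> UNIV|m i. Kfun i (u (fst p)) (snd p) - Kfun i (v (fst p)) (snd p))"
      using drift_integrable_square[OF i um _ u A] drift_integrable_square[OF i vm _ v A]
      by (intro set_integral_diff(2)[symmetric]) (auto simp: drift_integrable_def)
    also have "\<bar>\<dots>\<bar> \<le> (LINT s:A|\<mu>. (M + 2) * l1_dist (u s) (v s))"
      by (rule m_integral(2)[OF i, where B="(M + 2) * (2 * M)"])
        (use A M d in \<open>auto intro!: mult_left_mono Kfun_lip[OF i] u v snd_Rplus2[OF i]\<close>)
    also have "\<dots> = (M + 2) * J" by (simp add: J_def)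
    finally show ?thesis .
  qed
  have "\<bar>drift c b m i u A - drift c b m i v A\<bar> \<le> 1 * J + 1 * J + 1 * J + (2 * M) * J + (M + 2) * J"
    unfolding drift_def BVint_def
    using 1[THEN abs_le_D1] 2[THEN abs_le_D1] 3[THEN abs_le_D1] 4[THEN abs_le_D1] 5[THEN abs_le_D1]
      1[THEN abs_le_D2] 2[THEN abs_le_D2] 3[THEN abs_le_D2] 4[THEN abs_le_D2] 5[THEN abs_le_D2]
    by (intro abs_leI) linarith+
  also have "\<dots> = (3 * M + 5) * J" by (simp add: algebra_simps)
  finally show ?thesis by (simp add: J_def)
qed

lemma drift_0: "drift c b m i (\<lambda>_. (0, 0)) A = 0"
proof -
  have "Kfun i (0, 0) z = 0" "comp k (0, 0) = 0" for z k
    by (simp_all add: Kfun_def comp_def inner_pt)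
  then show ?thesis by (simp add: drift_def BVint_def)
qed

text \<open>Comparison with the zero function, whose drift vanishes and whose distance from a point
  of the square is at most \<open>2 * M\<close>.\<close>

lemma drift_abs:
  assumes i: "i \<in> {1,2}" and um[measurable]: "u \<in> borel_measurable borel" and [measurable]: "A \<in> sets borel"
    and u: "\<And>s. u s \<in> square M" and A: "A \<subseteq> {0<..t}"
  shows "\<bar>drift c b m i u A\<bar> \<le> (3 * M + 5) * (2 * M) * measure \<mu> A"
proof -
  have M: "0 \<le> M" using u[of 0] by (auto simp: square_def)
  have "\<bar>drift c b m i u A\<bar> \<le> (3 * M + 5) * (LINT s:A|\<mu>. l1_dist (u s) (0, 0))"
    using drift_lip[OF i um _ _ u _ A, of "\<lambda>_. (0, 0)"] M by (simp add: drift_0 square_def)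
  also have "(LINT s:A|\<mu>. l1_dist (u s) (0, 0)) \<le> (LINT s:A|\<mu>. 2 * M)"
  proof (rule set_integral_mono)
    have d: "l1_dist (u s) (0, 0) \<le> 2 * M" for s using u[of s] by (auto simp: l1_dist_def square_def)
    show "set_integrable \<mu> A (\<lambda>s. l1_dist (u s) (0, 0))"
      by (rule set_integrable_\<mu>[where B="2 * M"]) (use d in auto)
    show "set_integrable \<mu> A (\<lambda>s. 2 * M)"
      by (rule set_integrable_\<mu>[where B="2 * M"]) (use M in auto)
    show "l1_dist (u s) (0, 0) \<le> 2 * M" for s by (rule d)
  qed
  also have "(LINT s:A|\<mu>. 2 * M) = 2 * M * measure \<mu> A"
    using finite_measure.emeasure_finite[OF fin] by (simp add: set_lebesgue_integral_def sets_\<mu> mult.commute)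
  finally show ?thesis using M by (simp add: mult.assoc)
qed

lemma drift_Un:
  assumes i: "i \<in> {1,2}" and um[measurable]: "u \<in> borel_measurable borel" and "A \<in> sets borel" "A' \<in> sets borel"
    and u: "\<And>s. u s \<in> square M" and A: "A \<subseteq> {0<..t}" "A' \<subseteq> {0<..t}" "A \<inter> A' = {}"
  shows "drift c b m i u (A \<union> A') = drift c b m i u A + drift c b m i u A'"
proof -
  note iA = drift_integrable_square[OF i um assms(3) u A(1), unfolded drift_integrable_def BVintegrable_def]
  note iA' = drift_integrable_square[OF i um assms(4) u A(2), unfolded drift_integrable_def BVintegrable_def]
  have un: "(A \<union> A') \<times> UNIV = A \<times> UNIV \<union> A' \<times> (UNIV :: pt set)"
    and dj: "(A \<times> UNIV) \<inter> (A' \<times> (UNIV :: pt set)) = {}" using A(3) by auto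
  show ?thesis
    unfolding drift_def BVint_def un using iA iA' A(3) dj
    by (simp add: set_integral_Un)
qed

text \<open>Only three terms can raise a nonnegative solution: the off-diagonal integral, the
  negative part of \<open>b i i\<close>, and minus the kernel, which is at most the product of the
  other components by \<open>Kfun_ge\<close>. Each is linear in \<open>u\<close> and costs one
  integral; the positive part of \<open>b i i\<close> and the quadratic term have the favourable
  sign. Hence the constant 3 carries no \<open>M\<close>.\<close>

lemma drift_upper:
  assumes i: "i \<in> {1,2}" and um[measurable]: "u \<in> borel_measurable borel" and [measurable]: "A \<in> sets borel"
    and u: "\<And>s. u s \<in> square M" and A: "A \<subseteq> {0<..t}"
  shows "drift c b m i u A \<le> 3 * (LINT s:A|\<mu>. fst (u s) + snd (u s))"
proof -
  have M: "0 \<le> M" using u[of 0] by (auto simp: square_def)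
  define h where "h = (\<lambda>s. fst (u s) + snd (u s))"
  have hc: "h = (\<lambda>s. comp 1 (u s) + comp 2 (u s))" by (simp add: h_def comp_def)
  have hm[measurable]: "h \<in> borel_measurable borel" unfolding hc by measurable
  have h: "0 \<le> h s" "h s \<le> 2 * M" "\<bar>comp k (u s)\<bar> \<le> h s" "comp k (u s) \<ge> 0" for s k
    using u[of s] by (auto simp: h_def square_def comp_def)
  define J where "J = (LINT s:A|\<mu>. h s)"
  have 1: "\<bar>LINT s:A|LS (b i (3 - i)). comp (3 - i) (u s)\<bar> \<le> J"
    unfolding J_def by (rule LS_integral(2)[OF stB[OF i] domB[OF i], where B="2 * M"]) (use A h in auto)
  have 2: "\<bar>LINT s:A|LS (bneg (b i i)). comp i (u s)\<bar> \<le> J"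
    unfolding J_def by (rule LS_integral(2)[OF stN[OF i] domN[OF i], where B="2 * M"]) (use A h in auto)
  have 3: "0 \<le> (LINT s:A|LS (bpos (b i i)). comp i (u s))" "0 \<le> (LINT s:A|LS (c i). (comp i (u s))\<^sup>2)"
    unfolding set_lebesgue_integral_def by (intro integral_nonneg_AE AE_I2, simp add: h)+
  have 4: "- (LINT p:A \<times> UNIV|m i. Kfun i (u (fst p)) (snd p)) \<le> J"
  proof -
    note [measurable] = fst_m[OF i] snd_m[OF i]
    have R: "u s \<in> Rplus2" for s using h(4) by (auto simp: Rplus2_iff)
    have bd: "\<bar>comp (3 - i) (u (fst p)) * comp (3 - i) (snd p)\<bar> \<le> h (fst p) * moment_fn i (snd p)" if "p \<in> space (m i)" for p
    proof -
      have "comp (3 - i) (snd p) \<le> moment_fn i (snd p)"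
        using comp_Rplus2[OF snd_Rplus2[OF i that]] by (auto simp: moment_fn_def)
      then show ?thesis unfolding abs_mult
        using h(1)[of "fst p"] h(3)[of "3 - i" "fst p"] comp_Rplus2[OF snd_Rplus2[OF i that], of "3 - i"] by (intro mult_mono) auto
    qed
    have int: "set_integrable (m i) (A \<times> UNIV) (\<lambda>p. comp (3 - i) (u (fst p)) * comp (3 - i) (snd p))"
      and le: "\<bar>LINT p:A \<times> UNIV|m i. comp (3 - i) (u (fst p)) * comp (3 - i) (snd p)\<bar> \<le> J"
      unfolding J_def by (rule m_integral[OF i, where h=h and B="2 * M"]; use A h bd in simp)+
    have "- (LINT p:A \<times> UNIV|m i. Kfun i (u (fst p)) (snd p)) = (LINT p:A \<times> UNIV|m i. - Kfun i (u (fst p)) (snd p))"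
      by (simp add: set_lebesgue_integral_def)
    also have "\<dots> \<le> (LINT p:A \<times> UNIV|m i. comp (3 - i) (u (fst p)) * comp (3 - i) (snd p))"
      unfolding set_lebesgue_integral_def
    proof (rule integral_mono)
      show "integrable (m i) (\<lambda>p. indicator (A \<times> UNIV) p *\<^sub>R - Kfun i (u (fst p)) (snd p))"
        using drift_integrable_square[OF i um _ u A] by (simp add: drift_integrable_def set_integrable_def)
      show "integrable (m i) (\<lambda>p. indicator (A \<times> UNIV) p *\<^sub>R (comp (3 - i) (u (fst p)) * comp (3 - i) (snd p)))"
        using int by (simp add: set_integrable_def)
      fix p assume p: "p \<in> space (m i)"
      show "indicator (A \<times> UNIV) p *\<^sub>R - Kfun i (u (fst p)) (snd p)
          \<le> indicator (A \<times> UNIV) p *\<^sub>R (comp (3 - i) (u (fst p)) * comp (3 - i) (snd p))"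
        using Kfun_ge(1)[OF i R[of "fst p"] snd_Rplus2[OF i p]] by (auto split: split_indicator)
    qed
    finally show ?thesis using le by linarith
  qed
  show ?thesis
    using 1[THEN abs_le_D1] 2[THEN abs_le_D1] 3 4 unfolding drift_def BVint_def h_def[symmetric] J_def by linarith
qed

text \<open>Where the component \<open>i\<close> vanishes, the other component can only feed it: the
  kernel is then nonpositive and enters with a minus sign.\<close>

lemma drift_nonneg:
  assumes i: "i \<in> {1,2}" and u: "\<And>s. s \<in> A \<Longrightarrow> u s \<in> Rplus2" and z: "\<And>s. s \<in> A \<Longrightarrow> comp i (u s) = 0"
  shows "0 \<le> drift c b m i u A"
proof -
  have "(LINT s:A|N. comp i (u s)) = 0" "(LINT s:A|N. (comp i (u s))\<^sup>2) = 0" for N :: "real measure"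
    unfolding set_lebesgue_integral_def by (rule integral_eq_zero_AE, use z in \<open>auto split: split_indicator\<close>)+
  moreover have "0 \<le> (LINT s:A|LS (b i (3 - i)). comp (3 - i) (u s))"
    unfolding set_lebesgue_integral_def
    by (rule integral_nonneg_AE) (use comp_Rplus2[OF u] in \<open>auto split: split_indicator\<close>)
  moreover have "0 \<le> (LINT p:A \<times> UNIV|m i. - Kfun i (u (fst p)) (snd p))"
    unfolding set_lebesgue_integral_def
  proof (rule integral_nonneg_AE, rule AE_I2)
    fix p assume p: "p \<in> space (m i)"
    show "0 \<le> indicator (A \<times> UNIV) p *\<^sub>R - Kfun i (u (fst p)) (snd p)"
    proof (cases "fst p \<in> A")
      case True
      from Kfun_ge(2)[OF i u[OF True] snd_Rplus2[OF i p]] z[OF True] True show ?thesis by (simp add: indicator_Times_UNIV)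
    qed (simp add: indicator_Times_UNIV)
  qed
  then have "(LINT p:A \<times> UNIV|m i. Kfun i (u (fst p)) (snd p)) \<le> 0"
    by (simp add: set_lebesgue_integral_def)
  ultimately show ?thesis by (simp add: drift_def BVint_def)
qed

text \<open>At a single time the off-diagonal term is nonnegative, \<open>c\<close> has no atom, and
  the kernel is at most \<open>comp i (u s)\<close> times the jump size. What is left is minus
  \<open>comp i (u s)\<close> times the quantity that the jump condition bounds by 1.\<close>

lemma drift_atom:
  assumes i: "i \<in> {1,2}" and u: "u s \<in> Rplus2" and s: "0 < s" "s \<le> t"
  shows "- comp i (u s) \<le> drift c b m i u {s}"
proof -
  note [measurable] = fst_m[OF i] snd_m[OF i]
  have at: "(LINT x:{s}|LS G. f (u x)) = f (u s) * measure (LS G) {s}" if "stieltjes G" for G f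
  proof -
    interpret stieltjes G by fact
    have "emeasure (LS G) {s} \<le> emeasure (LS G) {0<..s}" using s by (intro emeasure_mono) auto
    also have "\<dots> < \<infinity>" using s by (simp add: emeasure_LS_Ioc)
    finally have fin: "emeasure (LS G) {s} < \<infinity>" .
    have "(LINT x:{s}|LS G. f (u x)) = (LINT x|LS G. indicator {s} x *\<^sub>R f (u s))"
      unfolding set_lebesgue_integral_def by (rule Bochner_Integration.integral_cong) (auto split: split_indicator)
    also have "\<dots> = f (u s) * measure (LS G) {s}" using fin by simp
    finally show ?thesis .
  qed
  define Z where "Z = set_nn_integral (m i) ({s} \<times> UNIV) (\<lambda>p. ennreal (comp i (snd p)))"
  define z where "z = enn2real Z"
  have j: "ereal (b i i s - Lim (at_left s) (b i i)) + enn2ereal Z \<le> 1"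
    using jump[OF i s(1)] by (simp add: Z_def)
  \<comment> \<open>The jump condition is an inequality of extended reals, so an infinite first
    moment would contradict its bound 1.\<close>
  have Zf: "Z < \<infinity>"
    using j by (cases Z) (auto simp: enn2ereal_ennreal)
  then have Zz: "Z = ennreal z" "0 \<le> z" by (auto simp: z_def)
  have jz: "b i i s - Lim (at_left s) (b i i) + z \<le> 1"
    using j Zz by (simp add: enn2ereal_ennreal one_ereal_def)
  have f0: "0 \<le> indicator {s} (fst p) * comp i (snd p)" if "p \<in> space (m i)" for p
    using comp_Rplus2[OF snd_Rplus2[OF i that]] by auto
  have Zint: "(\<integral>\<^sup>+p. ennreal (indicator {s} (fst p) * comp i (snd p)) \<partial>m i) = ennreal z"
    unfolding Zz(1)[symmetric] Z_def
    by (intro nn_integral_cong) (auto simp: indicator_Times_UNIV split: split_indicator)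
  have int: "integrable (m i) (\<lambda>p. indicator {s} (fst p) * comp i (snd p))"
    by (rule integrableI_nonneg) (use f0 Zint in auto)
  have intz: "(LINT p|m i. indicator {s} (fst p) * comp i (snd p)) = z"
    using Zint Zz(2) f0 by (subst integral_eq_nn_integral) auto
  define M where "M = max (fst (u s)) (snd (u s))"
  have ub: "u s \<in> square M" using u by (auto simp: M_def square_def Rplus2_def)
  \<comment> \<open>Away from \<open>s\<close> the function \<open>u\<close> may be neither
    measurable nor bounded; the constant function \<open>u s\<close> has the same drift over
    \<open>{s}\<close>.\<close>
  have cg: "drift_integrable c b m i u {s} = drift_integrable c b m i (\<lambda>_. u s) {s}"
    by (rule drift_cong(2)) auto
  have "drift_integrable c b m i (\<lambda>_. u s) {s}"
    by (rule drift_integrable_square[OF i _ _ ub]) (use s in auto)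
  then have Ki: "set_integrable (m i) ({s} \<times> UNIV) (\<lambda>p. Kfun i (u (fst p)) (snd p))"
    using cg by (simp add: drift_integrable_def)
  have "(LINT p:{s} \<times> UNIV|m i. Kfun i (u (fst p)) (snd p)) \<le> (LINT p|m i. comp i (u s) * (indicator {s} (fst p) * comp i (snd p)))"
    unfolding set_lebesgue_integral_def
  proof (rule integral_mono)
    show "integrable (m i) (\<lambda>p. indicator ({s} \<times> UNIV) p *\<^sub>R Kfun i (u (fst p)) (snd p))"
      using Ki by (simp add: set_integrable_def)
    show "integrable (m i) (\<lambda>p. comp i (u s) * (indicator {s} (fst p) * comp i (snd p)))" using int by simp
    fix p assume p: "p \<in> space (m i)"
    show "indicator ({s} \<times> UNIV) p *\<^sub>R Kfun i (u (fst p)) (snd p) \<le> comp i (u s) * (indicator {s} (fst p) * comp i (snd p))"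
    proof (cases "fst p = s")
      case True
      with Kfun_ge(2)[OF i u snd_Rplus2[OF i p]] show ?thesis by (simp add: indicator_Times_UNIV)
    qed (simp add: indicator_Times_UNIV)
  qed
  also have "\<dots> = comp i (u s) * z" by (simp add: intz)
  finally have K: "(LINT p:{s} \<times> UNIV|m i. Kfun i (u (fst p)) (snd p)) \<le> comp i (u s) * z" .
  have "measure (LS (bpos (b i i))) {s} - measure (LS (bneg (b i i))) {s} = b i i s - Lim (at_left s) (b i i)"
    by (rule LS_bv_jump[OF lbv[OF i] s(1)])
  then have "BVint (b i i) {s} (\<lambda>x. comp i (u x)) = comp i (u s) * (b i i s - Lim (at_left s) (b i i))"
    unfolding BVint_def at[OF stP[OF i], of "comp i"] at[OF stN[OF i], of "comp i"]
    by (simp only: right_diff_distrib[symmetric])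
  moreover have "(LINT x:{s}|LS (c i). (comp i (u x))\<^sup>2) = 0"
    using at[OF stC[OF i], of "\<lambda>x. (comp i x)\<^sup>2"] LS_continuous_singleton[OF cmono[OF i] s(1)] by simp
  moreover have "0 \<le> (LINT x:{s}|LS (b i (3 - i)). comp (3 - i) (u x))"
    unfolding at[OF stB[OF i], of "comp (3 - i)"] using comp_Rplus2[OF u] by simp
  ultimately have "- (comp i (u s) * (b i i s - Lim (at_left s) (b i i) + z)) \<le> drift c b m i u {s}"
    unfolding drift_def using K by (simp add: algebra_simps)
  moreover have "comp i (u s) * (b i i s - Lim (at_left s) (b i i) + z) \<le> comp i (u s) * 1"
    by (rule mult_left_mono[OF jz comp_Rplus2[OF u]])
  ultimately show ?thesis by simp
qed

text \<open>Turning the moving interval into a condition on the integrand gives a function jointly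
  measurable in \<open>r\<close> and the integration variable, so sigma-finiteness applies. The
  Picard map needs this in order to produce Borel functions.\<close>

lemma drift_measurable:
  assumes i: "i \<in> {1,2}" and um[measurable]: "u \<in> borel_measurable borel"
  shows "(\<lambda>r. drift c b m i u {r<..q}) \<in> borel_measurable borel"
proof -
  have LSm: "(\<lambda>r. LINT s:{r<..q}|LS G. f s) \<in> borel_measurable borel"
    if "stieltjes G" and [measurable]: "f \<in> borel_measurable borel" for G and f :: "real \<Rightarrow> real"
  proof -
    interpret stieltjes G by fact
    interpret sigma_finite_measure "LS G" by (rule sigma_finite_LS)
    have "(\<lambda>r. LINT s:{r<..q}|LS G. f s) = (\<lambda>r. LINT s|LS G. (if r < s \<and> s \<le> q then f s else 0))"
      unfolding set_lebesgue_integral_def by (intro ext Bochner_Integration.integral_cong) auto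
    also have "\<dots> \<in> borel_measurable borel" by measurable
    finally show ?thesis .
  qed
  have Km: "(\<lambda>r. LINT p:{r<..q} \<times> UNIV|m i. Kfun i (u (fst p)) (snd p)) \<in> borel_measurable borel"
  proof -
    note [measurable] = fst_m[OF i] snd_m[OF i]
    interpret sigma_finite_measure "m i" by (rule sf_m[OF i])
    have "(\<lambda>r. LINT p:{r<..q} \<times> UNIV|m i. Kfun i (u (fst p)) (snd p)) =
       (\<lambda>r. LINT p|m i. (if r < fst p \<and> fst p \<le> q then Kfun i (u (fst p)) (snd p) else 0))"
      unfolding set_lebesgue_integral_def indicator_Times_UNIV
      by (intro ext Bochner_Integration.integral_cong) auto
    also have "\<dots> \<in> borel_measurable borel" by measurable
    finally show ?thesis .
  qed
  show ?thesis unfolding drift_def BVint_def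
    by (intro borel_measurable_diff LSm stB stP stN stC Km i) measurable
qed

end

section \<open>Existence and uniqueness of nonnegative solutions\<close>

lemma antimono_on_clip_measurable:
  fixes f :: "real \<Rightarrow> real"
  assumes t: "0 \<le> t" and anti: "antimono_on {0..t} f"
  shows "(\<lambda>r. f (max 0 (min t r))) \<in> borel_measurable borel"
proof -
  have "mono (\<lambda>r. - f (max 0 (min t r)))"
  proof (rule monoI)
    fix x y :: real assume "x \<le> y"
    then have "max 0 (min t x) \<le> max 0 (min t y)" by auto
    moreover have "max 0 (min t x) \<in> {0..t}" "max 0 (min t y) \<in> {0..t}" using t by auto
    ultimately show "- f (max 0 (min t x)) \<le> - f (max 0 (min t y))" using anti by (simp add: monotone_on_def)
  qed
  then have "(\<lambda>r. - (- f (max 0 (min t r)))) \<in> borel_measurable borel"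
    by (intro borel_measurable_uminus borel_measurable_mono)
  then show ?thesis by simp
qed

context tcbve_horizon
begin

lemma Ioc_subset: "0 \<le> r \<Longrightarrow> q \<le> t \<Longrightarrow> {r<..q} \<subseteq> {0<..t}"
  by auto

text \<open>The left end \<open>s0\<close> is excluded because in the grid argument the source jumps
  there. \<open>\<alpha>\<close> stands for whatever the two equations share on the
  interval.\<close>

lemma drift_unique_Ioc:
  assumes s0: "0 \<le> s0" and q: "0 \<le> q" "q \<le> t"
    and um[measurable]: "u \<in> borel_measurable borel" and vm[measurable]: "v \<in> borel_measurable borel"
    and u: "\<And>s. u s \<in> square M" and v: "\<And>s. v s \<in> square M"
    and equ: "\<And>i r. i \<in> {1,2} \<Longrightarrow> s0 < r \<Longrightarrow> r \<le> q \<Longrightarrow> comp i (u r) = \<alpha> i r + drift c b m i u {r<..q}"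
    and eqv: "\<And>i r. i \<in> {1,2} \<Longrightarrow> s0 < r \<Longrightarrow> r \<le> q \<Longrightarrow> comp i (v r) = \<alpha> i r + drift c b m i v {r<..q}"
    and r: "s0 < r" "r \<le> q"
  shows "u r = v r"
proof -
  have M: "0 \<le> M" using u[of 0] by (auto simp: square_def)
  define L where "L = 2 * (3 * M + 5)"
  have L: "0 \<le> L" using M by (simp add: L_def)
  obtain C where C: "\<And>A h B. 0 \<le> A \<Longrightarrow> h \<in> borel_measurable borel \<Longrightarrow> (\<forall>r. 0 \<le> h r \<and> h r \<le> B) \<Longrightarrow>
           (\<forall>r\<in>{0..q}. h r \<le> A + L * (LINT s:{r<..q}|\<mu>. h s)) \<Longrightarrow> (\<forall>r\<in>{0..q}. h r \<le> A * C)"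
    using volterra_gronwall[OF fin sets_\<mu> q(1) L] by blast
  \<comment> \<open>The cut-off beyond the interval makes the Gronwall inequality trivial on
    \<open>[0, s0]\<close>, where nothing is known about the two functions.\<close>
  define h where "h = (\<lambda>s. if s0 < s \<and> s \<le> q then l1_dist (u s) (v s) else 0)"
  have hm[measurable]: "h \<in> borel_measurable borel" unfolding h_def by measurable
  have hb: "0 \<le> h s \<and> h s \<le> 2 * M" for s
    using u[of s] v[of s] M by (auto simp: h_def square_def l1_dist_def)
  have "h r \<le> 0 + L * (LINT s:{r<..q}|\<mu>. h s)" if r: "r \<in> {0..q}" for r
  proof (cases "s0 < r")
    case True
    have d: "\<bar>comp i (u r) - comp i (v r)\<bar> \<le> (3 * M + 5) * (LINT s:{r<..q}|\<mu>. l1_dist (u s) (v s))" if "i \<in> {1,2}" for i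
      using drift_lip[OF that um vm _ u v Ioc_subset, of r q] equ[OF that True] eqv[OF that True] r q by simp
    have "l1_dist (u r) (v r) \<le> (3 * M + 5) * (LINT s:{r<..q}|\<mu>. l1_dist (u s) (v s))
        + (3 * M + 5) * (LINT s:{r<..q}|\<mu>. l1_dist (u s) (v s))"
      using d[of 1] d[of 2] l1_dist_comp[of 1 "u r" "v r"] by simp
    also have "\<dots> = L * (LINT s:{r<..q}|\<mu>. l1_dist (u s) (v s))" by (simp add: L_def)
    also have "(LINT s:{r<..q}|\<mu>. l1_dist (u s) (v s)) = (LINT s:{r<..q}|\<mu>. h s)"
      using True by (intro set_lebesgue_integral_cong) (auto simp: h_def sets_\<mu>)
    finally show ?thesis using True r by (simp add: h_def)
  next
    case False
    have "0 \<le> (LINT s:{r<..q}|\<mu>. h s)"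
      unfolding set_lebesgue_integral_def by (rule integral_nonneg_AE) (use hb in auto)
    with False L show ?thesis by (simp add: h_def)
  qed
  with C[of 0 h "2 * M"] hm hb have "h r \<le> 0" using r s0 by auto
  then have "l1_dist (u r) (v r) = 0" using r l1_dist_nonneg[of "u r" "v r"] by (simp add: h_def)
  then show ?thesis by (auto simp: l1_dist_def prod_eq_iff)
qed

definition clip :: "real \<Rightarrow> pt \<Rightarrow> pt" where
  "clip M p = (min M (max 0 (fst p)), min M (max 0 (snd p)))"

lemma comp_clip: "comp i (clip M p) = min M (max 0 (comp i p))"
  by (simp add: clip_def comp_def)

lemma pair_measurable:
  assumes "(\<lambda>s. comp 1 (u s)) \<in> borel_measurable N" "(\<lambda>s. comp 2 (u s)) \<in> borel_measurable N"
  shows "u \<in> borel_measurable N"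
proof -
  have "u = (\<lambda>s. (comp 1 (u s), comp 2 (u s)))" by (auto simp: comp_def)
  also have "\<dots> \<in> borel_measurable N" using assms by (rule borel_measurable_Pair)
  finally show ?thesis .
qed

lemma clip_measurable: "u \<in> borel_measurable N \<Longrightarrow> (\<lambda>s. clip M (u s)) \<in> borel_measurable N"
  by (rule pair_measurable) (simp_all add: comp_clip)

lemma clip_square: "0 \<le> M \<Longrightarrow> clip M p \<in> square M"
  by (auto simp: clip_def square_def)

lemma l1_dist_clip: "l1_dist (clip M p) (clip M q) \<le> l1_dist p q"
  by (auto simp: clip_def l1_dist_def min_def max_def)

lemma l1_dist_norm: "l1_dist p q \<le> 2 * norm (p - q)"
  using norm_fst_le[of "fst (p - q)" "snd (p - q)"] norm_snd_le[of "snd (p - q)" "fst (p - q)"]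
  by (simp add: l1_dist_def minus_prod_def)

text \<open>Clipping the argument of the drift makes it bounded and globally Lipschitz, so the
  Picard map sends every Borel function into one ball. The solution itself stays unclipped, because
  its sign and size are still to be determined.\<close>

lemma clipped_solution:
  assumes M: "0 \<le> M" and src: "source_on t A a"
  shows "\<exists>u R. u \<in> borel_measurable borel \<and> (\<forall>s. norm (u s) \<le> R) \<and>
     (\<forall>i\<in>{1,2}. \<forall>r\<in>{0..t}. comp i (u r) = a i r + drift c b m i (\<lambda>s. clip M (u s)) {r<..t})"
proof -
  \<comment> \<open>Clamping the time extends the monotone source to a Borel function on the
    line.\<close>
  define a' where "a' = (\<lambda>i r. a i (max 0 (min t r)))"
  have am[measurable]: "a' i \<in> borel_measurable borel" if "i \<in> {1,2}" for i
    unfolding a'_def by (rule antimono_on_clip_measurable[OF t source_onD(1)[OF src that]])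
  \<comment> \<open>Outside \<open>[0, t]\<close> the map is 0, since for negative \<open>r\<close>
    the interval \<open>(r, t]\<close> would leave the times on which \<mu> dominates.\<close>
  define T where "T = (\<lambda>(u :: real \<Rightarrow> pt) r. if r \<in> {0..t} then
     (a' 1 r + drift c b m 1 (\<lambda>s. clip M (u s)) {r<..t}, a' 2 r + drift c b m 2 (\<lambda>s. clip M (u s)) {r<..t}) else (0, 0))"
  define R where "R = 2 * (A + (3 * M + 5) * (2 * M) * measure \<mu> (space \<mu>))"
  have Tm: "T u \<in> borel_measurable borel" if "u \<in> borel_measurable borel" for u
    unfolding T_def
    by (intro measurable_If borel_measurable_Pair borel_measurable_add drift_measurable am clip_measurable that) auto
  have A: "0 \<le> A" using source_onD(2,3)[OF src, of 1 0] t by auto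
  have Tb: "norm (T u r) \<le> R" if [measurable]: "u \<in> borel_measurable borel" for u r
  proof (cases "r \<in> {0..t}")
    case True
    have *: "\<bar>a' i r + drift c b m i (\<lambda>s. clip M (u s)) {r<..t}\<bar> \<le> A + (3 * M + 5) * (2 * M) * measure \<mu> (space \<mu>)"
      if i: "i \<in> {1,2}" for i
    proof -
      have "\<bar>drift c b m i (\<lambda>s. clip M (u s)) {r<..t}\<bar> \<le> (3 * M + 5) * (2 * M) * measure \<mu> {r<..t}"
        using True M by (intro drift_abs i clip_measurable clip_square) auto
      also have "\<dots> \<le> (3 * M + 5) * (2 * M) * measure \<mu> (space \<mu>)"
        using M by (intro mult_left_mono finite_measure.bounded_measure fin) auto
      finally show ?thesis using source_onD(2,3)[OF src i True] True by (auto simp: a'_def)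
    qed
    have "norm (T u r) \<le> \<bar>fst (T u r)\<bar> + \<bar>snd (T u r)\<bar>"
      using norm_Pair_le[of "fst (T u r)" "snd (T u r)"] by simp
    also have "\<dots> \<le> R" using *[of 1] *[of 2] True by (simp add: T_def R_def)
    finally show ?thesis .
  next
    case False
    then have "T u r = 0" unfolding T_def zero_prod_def by (rule if_not_P)
    then show ?thesis using A M by (simp add: R_def)
  qed
  \<comment> \<open>In \<open>4 * (3 * M + 5)\<close> one factor 2 counts the components and the
    other compares \<open>l1_dist\<close> with the norm.\<close>
  have TL: "norm (T u r - T v r) \<le> (4 * (3 * M + 5)) * (LINT s:{r<..t}|\<mu>. norm (u s - v s))"
    if um[measurable]: "u \<in> borel_measurable borel" and vm[measurable]: "v \<in> borel_measurable borel"
      and r: "r \<in> {0..t}" and B: "\<And>s. norm (u s - v s) \<le> B" for u v r B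
  proof -
    have "norm (T u r - T v r) \<le> \<bar>fst (T u r - T v r)\<bar> + \<bar>snd (T u r - T v r)\<bar>"
      using norm_Pair_le[of "fst (T u r - T v r)" "snd (T u r - T v r)"] by (simp add: minus_prod_def)
    also have "\<dots> = \<bar>drift c b m 1 (\<lambda>s. clip M (u s)) {r<..t} - drift c b m 1 (\<lambda>s. clip M (v s)) {r<..t}\<bar> +
        \<bar>drift c b m 2 (\<lambda>s. clip M (u s)) {r<..t} - drift c b m 2 (\<lambda>s. clip M (v s)) {r<..t}\<bar>"
      using r by (simp add: T_def)
    also have "\<dots> \<le> (3 * M + 5) * (LINT s:{r<..t}|\<mu>. l1_dist (clip M (u s)) (clip M (v s)))
        + (3 * M + 5) * (LINT s:{r<..t}|\<mu>. l1_dist (clip M (u s)) (clip M (v s)))"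
      using M r by (intro add_mono drift_lip clip_measurable clip_square) auto
    also have "\<dots> = 2 * (3 * M + 5) * (LINT s:{r<..t}|\<mu>. l1_dist (clip M (u s)) (clip M (v s)))" by simp
    also have "\<dots> \<le> 2 * (3 * M + 5) * (LINT s:{r<..t}|\<mu>. 2 * norm (u s - v s))"
    proof (intro mult_left_mono set_integral_mono)
      have cm: "l1_dist (clip M (u s)) (clip M (v s)) \<le> 2 * norm (u s - v s)" for s
        using l1_dist_clip l1_dist_norm order_trans by blast
      have B2: "2 * norm (u s - v s) \<le> 2 * B" for s using B[of s] by simp
      show "set_integrable \<mu> {r<..t} (\<lambda>s. 2 * norm (u s - v s))"
        by (rule set_integrable_\<mu>[where B="2 * B"]) (use B2 in auto)
      show "set_integrable \<mu> {r<..t} (\<lambda>s. l1_dist (clip M (u s)) (clip M (v s)))"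
        by (rule set_integrable_\<mu>[where B="2 * B"])
          (use order_trans[OF cm B2] in \<open>auto intro!: l1_dist_measurable clip_measurable\<close>)
      show "l1_dist (clip M (u s)) (clip M (v s)) \<le> 2 * norm (u s - v s)" for s by (rule cm)
    qed (use M in auto)
    finally show ?thesis by (simp add: algebra_simps)
  qed
  have L: "0 \<le> 4 * (3 * M + 5)" using M by simp
  have "\<exists>u. u \<in> borel_measurable borel \<and> (\<forall>s. norm (u s) \<le> R) \<and> (\<forall>r\<in>{0..t}. u r = T u r)"
    by (rule volterra_fixed_point[OF fin sets_\<mu> t L]) (fact Tm Tb TL)+
  then obtain u where "u \<in> borel_measurable borel" "\<forall>s. norm (u s) \<le> R" and eq: "\<forall>r\<in>{0..t}. u r = T u r"
    by blast
  moreover have "comp i (u r) = a i r + drift c b m i (\<lambda>s. clip M (u s)) {r<..t}" if "i \<in> {1,2}" "r \<in> {0..t}" for i r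
  proof -
    have "u r = T u r" using eq that by blast
    moreover have "comp i (T u r) = a i r + drift c b m i (\<lambda>s. clip M (u s)) {r<..t}"
      using that by (auto simp: T_def comp_def a'_def)
    ultimately show ?thesis by metis
  qed
  ultimately show ?thesis by blast
qed

text \<open>A component that is negative at \<open>r0\<close> stays negative up to some \<open>r1\<close>; its drift is nonnegative in
  between, and the jump at \<open>r1\<close> cannot push a nonnegative value below zero by \<open>drift_atom\<close>.\<close>
lemma clipped_solution_nonneg:
  assumes M: "0 \<le> M" and src: "source_on t A a"
    and um: "u \<in> borel_measurable borel"
    and eq: "\<And>i r. i \<in> {1,2} \<Longrightarrow> r \<in> {0..t} \<Longrightarrow> comp i (u r) = a i r + drift c b m i (\<lambda>s. clip M (u s)) {r<..t}"
    and i: "i \<in> {1,2}" and r0: "r0 \<in> {0..t}"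
  shows "0 \<le> comp i (u r0)"
proof (rule ccontr)
  assume "\<not> ?thesis"
  then have neg: "comp i (u r0) < 0" by simp
  define w where "w = (\<lambda>s. clip M (u s))"
  have wm: "w \<in> borel_measurable borel" unfolding w_def by (rule clip_measurable[OF um])
  have wb: "w s \<in> square M" for s unfolding w_def by (rule clip_square[OF M])
  have wR: "w s \<in> Rplus2" for s using wb[of s] by (auto simp: square_iff Rplus2_iff)
  define D where "D = drift c b m i w"
  have incr: "comp i (u r) \<ge> comp i (u s) + D {r<..s}" if "0 \<le> r" "r \<le> s" "s \<le> t" for r s
  proof -
    have "{r<..t} = {r<..s} \<union> {s<..t}" using that by auto
    then have "D {r<..t} = D {r<..s} + D {s<..t}"
      using drift_Un[OF i wm _ _ wb Ioc_subset Ioc_subset, of r s s t] that by (simp add: D_def)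
    moreover have "a i s \<le> a i r" using source_onD(1)[OF src i] that by (auto simp: monotone_on_def)
    ultimately show ?thesis using eq[OF i, of r] eq[OF i, of s] that by (simp add: D_def w_def)
  qed
  define S where "S = {s\<in>{r0..t}. 0 \<le> comp i (u s)}"
  have "D {t<..t} = 0" by (simp add: D_def)
  then have tS: "t \<in> S" using eq[OF i, of t] source_onD(2)[OF src i, of t] t r0 by (auto simp: S_def D_def w_def)
  have bdd: "bdd_below S" by (rule bdd_belowI[of _ r0]) (auto simp: S_def)
  define r1 where "r1 = Inf S"
  have r1: "r0 \<le> r1" "r1 \<le> t"
  proof -
    show "r1 \<le> t" unfolding r1_def by (rule cInf_lower[OF tS bdd])
    show "r0 \<le> r1" unfolding r1_def by (rule cInf_greatest) (use tS in \<open>auto simp: S_def\<close>)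
  qed
  have below: "comp i (u s) < 0" if "r0 \<le> s" "s < r1" for s
  proof (rule ccontr)
    assume "\<not> ?thesis"
    then have "s \<in> S" using that r1 by (auto simp: S_def)
    then have "r1 \<le> s" unfolding r1_def by (rule cInf_lower[OF _ bdd])
    with that show False by simp
  qed
  have at: "0 \<le> comp i (u r1)"
  proof (rule ccontr)
    assume "\<not> ?thesis"
    then have n: "comp i (u r1) < 0" by simp
    define K where "K = (3 * M + 5) * (2 * M)"
    have K: "0 \<le> K" using M by (simp add: K_def)
    \<comment> \<open>Over a gap of mass below \<open>e\<close> the drift is too small to bring a
      nonnegative value just right of \<open>r1\<close> down to \<open>comp i (u r1)\<close>. The
      \<open>+ 1\<close> covers \<open>K = 0\<close>.\<close>
    define e where "e = - comp i (u r1) / (K + 1)"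
    have e: "0 < e" unfolding e_def by (rule divide_pos_pos) (use n K in auto)
    obtain d where d: "0 < d" "measure \<mu> {r1<..<r1 + d} < e"
      using finite_measure_open_interval_small[OF fin sets_\<mu> e, of r1] by blast
    have "\<exists>s\<in>S. s < r1 + d"
      using cInf_lessD[of S "r1 + d"] tS d(1) unfolding r1_def by auto
    then obtain s where s: "s \<in> S" "s < r1 + d" by blast
    have rs: "r1 \<le> s" unfolding r1_def by (rule cInf_lower[OF s(1) bdd])
    have "\<bar>D {r1<..s}\<bar> \<le> K * measure \<mu> {r1<..s}"
      unfolding D_def K_def by (rule drift_abs[OF i wm _ wb]) (use s r1 r0 in \<open>auto simp: S_def\<close>)
    also have "\<dots> \<le> K * measure \<mu> {r1<..<r1 + d}"
      using s K by (intro mult_left_mono finite_measure.finite_measure_mono[OF fin]) (auto simp: sets_\<mu>)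
    also have "\<dots> \<le> K * e" using d K by (intro mult_left_mono) auto
    also have "\<dots> < - comp i (u r1)" using n K by (simp add: e_def field_simps)
    finally have "- D {r1<..s} < - comp i (u r1)" by linarith
    moreover have "comp i (u r1) \<ge> comp i (u s) + D {r1<..s}"
      using rs s r1 r0 by (intro incr) (auto simp: S_def)
    moreover have "0 \<le> comp i (u s)" using s by (simp add: S_def)
    ultimately show False by linarith
  qed
  with neg r1 have lt: "r0 < r1" by (cases "r0 = r1") auto
  have r00: "0 \<le> r0" using r0 by simp
  have sub: "{r0<..<r1} \<subseteq> {0<..t}" "{r1} \<subseteq> {0<..t}" using lt r00 r1 by auto
  have "{r0<..r1} = {r0<..<r1} \<union> {r1}" using lt by auto
  then have "D {r0<..r1} = D {r0<..<r1} + D {r1}"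
    using drift_Un[OF i wm _ _ wb sub] lt by (simp add: D_def)
  \<comment> \<open>Clipping sets the negative component to 0 on the open interval, which is what
    \<open>drift_nonneg\<close> asks for.\<close>
  moreover have "0 \<le> D {r0<..<r1}" unfolding D_def
  proof (rule drift_nonneg[OF i])
    fix s assume "s \<in> {r0<..<r1}"
    then have "comp i (u s) < 0" by (intro below) auto
    then show "comp i (w s) = 0" using M by (simp add: w_def comp_clip)
  qed (rule wR)
  moreover have "- comp i (w r1) \<le> D {r1}"
    unfolding D_def using lt r00 r1 by (intro drift_atom i wR) auto
  moreover have "comp i (w r1) \<le> comp i (u r1)" using at by (simp add: w_def comp_clip)
  moreover have "comp i (u r0) \<ge> comp i (u r1) + D {r0<..r1}" using r00 r1 by (intro incr) auto
  ultimately show False using neg by linarith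
qed

text \<open>\<open>M\<close> is chosen before the source and depends on its bound \<open>A\<close>
  only; the approximating sources later share one \<open>M\<close> for this reason. The clipped
  solution obeys a linear Gronwall inequality whose constants do not involve \<open>M\<close>, so
  choosing \<open>M\<close> as the resulting bound makes the clipping inactive.\<close>

lemma bounded_solution_exists:
  assumes A: "0 \<le> A"
  shows "\<exists>M. \<forall>a. source_on t A a \<longrightarrow> (\<exists>u. mild_solution c b m t M a u)"
proof -
  have L: "0 \<le> (6::real)" by simp
  from volterra_gronwall[OF fin sets_\<mu> t L]
  obtain C where C0: "0 \<le> C" and C: "\<forall>A\<ge>0. \<forall>h B. h \<in> borel_measurable borel \<longrightarrow> (\<forall>r. 0 \<le> h r \<and> h r \<le> B) \<longrightarrow>
           (\<forall>r\<in>{0..t}. h r \<le> A + (6::real) * (LINT s:{r<..t}|\<mu>. h s)) \<longrightarrow> (\<forall>r\<in>{0..t}. h r \<le> A * C)"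
    by blast
  \<comment> \<open>Adding the two components turns the source bound \<open>A\<close> into
    \<open>2 * A\<close> and the constant 3 of \<open>drift_upper\<close> into 6, for which
    \<open>C\<close> is the Gronwall constant.\<close>
  define M where "M = 2 * A * C"
  have M: "0 \<le> M" using A C0 by (simp add: M_def)
  show ?thesis
  proof (intro exI[of _ M] allI impI)
    fix a assume src: "source_on t A a"
    obtain u R where um[measurable]: "u \<in> borel_measurable borel" and uR': "\<forall>s. norm (u s) \<le> R"
      and eq': "\<forall>i\<in>{1,2}. \<forall>r\<in>{0..t}. comp i (u r) = a i r + drift c b m i (\<lambda>s. clip M (u s)) {r<..t}"
      using clipped_solution[OF M src] by blast
    have uR: "norm (u s) \<le> R" for s using uR' ..
    have eq: "comp i (u r) = a i r + drift c b m i (\<lambda>s. clip M (u s)) {r<..t}" if "i \<in> {1,2}" "r \<in> {0..t}" for i r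
      using bspec[OF bspec[OF eq' that(1)] that(2)] .
    have nn: "0 \<le> comp i (u r)" if "i \<in> {1,2}" "r \<in> {0..t}" for i r
      using clipped_solution_nonneg[OF M src um eq that] .
    define w where "w = (\<lambda>s. clip M (u s))"
    have wm[measurable]: "w \<in> borel_measurable borel" unfolding w_def by (rule clip_measurable[OF um])
    have wb: "w s \<in> square M" for s unfolding w_def by (rule clip_square[OF M])
    define h where "h = (\<lambda>s. if s \<in> {0..t} then comp 1 (u s) + comp 2 (u s) else 0)"
    have hm[measurable]: "h \<in> borel_measurable borel" unfolding h_def by measurable
    have hb: "0 \<le> h s \<and> h s \<le> 2 * R" for s
    proof -
      have "comp 1 (u s) \<le> norm (u s)" "comp 2 (u s) \<le> norm (u s)" "0 \<le> norm (u s)"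
        using norm_fst_le[of "fst (u s)" "snd (u s)"] norm_snd_le[of "snd (u s)" "fst (u s)"]
        by (auto simp: comp_def)
      then show ?thesis using order_trans[OF norm_ge_zero uR[of s]] uR[of s] nn[of 1 s] nn[of 2 s] by (auto simp: h_def)
    qed
    \<comment> \<open>Clipping can only lower nonnegative values, so the growth estimate for
      \<open>w\<close> closes up in terms of the unclipped \<open>u\<close>.\<close>
    have wh: "fst (w s) + snd (w s) \<le> h s" if "s \<in> {0..t}" for s
      using nn[of 1 s] nn[of 2 s] that by (auto simp: h_def w_def clip_def comp_def)
    have "h r \<le> 2 * A + 6 * (LINT s:{r<..t}|\<mu>. h s)" if r: "r \<in> {0..t}" for r
    proof -
      have le: "comp i (u r) \<le> A + 3 * (LINT s:{r<..t}|\<mu>. h s)" if i: "i \<in> {1,2}" for i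
      proof -
        have "drift c b m i w {r<..t} \<le> 3 * (LINT s:{r<..t}|\<mu>. fst (w s) + snd (w s))"
          by (rule drift_upper[OF i wm _ wb]) (use r in auto)
        also have "\<dots> \<le> 3 * (LINT s:{r<..t}|\<mu>. h s)"
        proof (intro mult_left_mono set_integral_mono)
          have "(\<lambda>s. fst (w s) + snd (w s)) = (\<lambda>s. comp 1 (w s) + comp 2 (w s))" by (simp add: comp_def)
          moreover have "\<bar>fst (w s) + snd (w s)\<bar> \<le> 2 * M" for s using wb[of s] by (auto simp: square_def)
          ultimately show "set_integrable \<mu> {r<..t} (\<lambda>s. fst (w s) + snd (w s))"
            by (intro set_integrable_\<mu>[where B="2 * M"]) auto
          show "set_integrable \<mu> {r<..t} h"
            by (rule set_integrable_\<mu>[where B="2 * R"]) (use hb in auto)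
          show "fst (w s) + snd (w s) \<le> h s" if "s \<in> {r<..t}" for s using that r by (intro wh) auto
        qed simp
        finally show ?thesis using eq[OF i r] source_onD(3)[OF src i r] unfolding w_def by simp
      qed
      show ?thesis using le[of 1] le[of 2] r by (simp add: h_def)
    qed
    then have "\<forall>r\<in>{0..t}. h r \<le> 2 * A + 6 * (LINT s:{r<..t}|\<mu>. h s)" ..
    then have hM: "h r \<le> M" if "r \<in> {0..t}" for r
      unfolding M_def by (intro C[rule_format, of "2 * A" h "2 * R"] hm that) (use A hb in simp_all)
    have wu: "w s = u s" if "s \<in> {0..t}" for s
    proof (rule pt_eqI)
      fix i :: nat assume i: "i \<in> {1,2}"
      have "comp i (u s) \<le> h s" using i nn[of 1 s] nn[of 2 s] that by (auto simp: h_def)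
      with hM[OF that] nn[OF i that] show "comp i (w s) = comp i (u s)" by (simp add: w_def comp_clip)
    qed
    show "\<exists>u. mild_solution c b m t M a u"
      unfolding mild_solution_def
    proof (intro exI[of _ w] conjI ballI allI wm wb)
      fix i r assume ir: "i \<in> {1::nat,2}" "r \<in> {0..t}"
      show "comp i (w r) = a i r + drift c b m i w {r<..t}"
        using eq[OF ir] wu[OF ir(2)] by (simp add: w_def)
    qed
  qed
qed

lemma mild_solution_cbve_sol:
  assumes u: "mild_solution c b m t M a u"
  shows "cbve_sol c b m a t u"
  unfolding cbve_sol_drift
proof (intro ballI conjI)
  fix i r assume ir: "i \<in> {1::nat,2}" "r \<in> {0..t}"
  show "drift_integrable c b m i u {r<..t}"
    by (rule drift_integrable_square[OF ir(1) mild_solutionD(1)[OF u] _ mild_solutionD(2)[OF u]]) (use ir in auto)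
  show "comp i (u r) = a i r + drift c b m i u {r<..t}" by (rule mild_solutionD(3)[OF u ir])
qed

lemma abs_set_integral_le:
  fixes f :: "'x \<Rightarrow> real"
  assumes "set_integrable N A f" "set_integrable N A' f" "A \<subseteq> A'"
  shows "\<bar>LINT x:A|N. f x\<bar> \<le> (LINT x:A'|N. \<bar>f x\<bar>)"
proof -
  have "\<bar>LINT x:A|N. f x\<bar> \<le> (LINT x|N. \<bar>indicator A x *\<^sub>R f x\<bar>)"
    unfolding set_lebesgue_integral_def by (rule integral_abs_bound)
  also have "\<dots> \<le> (LINT x:A'|N. \<bar>f x\<bar>)"
    unfolding set_lebesgue_integral_def
  proof (rule integral_mono)
    show "integrable N (\<lambda>x. \<bar>indicator A x *\<^sub>R f x\<bar>)"
      using assms(1) unfolding set_integrable_def by (rule integrable_abs)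
    show "integrable N (\<lambda>x. indicator A' x *\<^sub>R \<bar>f x\<bar>)"
      using set_integrable_abs[OF assms(2)] unfolding set_integrable_def .
    show "\<bar>indicator A x *\<^sub>R f x\<bar> \<le> indicator A' x *\<^sub>R \<bar>f x\<bar>" for x
      using assms(3) by (auto split: split_indicator)
  qed
  finally show ?thesis .
qed

text \<open>Integrability over \<open>(0, t]\<close> contains measurability there, and the
  off-diagonal integrals of the two equations between them see both components. Each integral over
  \<open>(r, t]\<close> is at most the integral of the absolute value over \<open>(0, t]\<close>,
  which bounds the solution by \<open>A + E i\<close> for all \<open>r\<close> at once.\<close>

lemma nonneg_solution_bounded:
  assumes sol: "cbve_sol c b m a t u" and nn: "\<And>s. s \<in> {0..t} \<Longrightarrow> u s \<in> Rplus2"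
    and a: "\<And>i r. i \<in> {1,2} \<Longrightarrow> r \<in> {0..t} \<Longrightarrow> a i r \<le> A"
  shows "\<exists>M v. v \<in> borel_measurable borel \<and> (\<forall>s. v s \<in> square M) \<and> (\<forall>s\<in>{0<..t}. v s = u s)"
proof -
  have di: "drift_integrable c b m i u {r<..t}" and ueq: "comp i (u r) = a i r + drift c b m i u {r<..t}"
    if "i \<in> {1,2}" "r \<in> {0..t}" for i r
    using sol that unfolding cbve_sol_drift by blast+
  \<comment> \<open>The drift over \<open>(0, t]\<close> never sees the value at time 0, so nothing
    is claimed about \<open>u\<close> there.\<close>
  define v where "v = (\<lambda>s. if s \<in> {0<..t} then u s else (0, 0))"
  have vm: "(\<lambda>s. comp (3 - i) (v s)) \<in> borel_measurable borel" if i: "i \<in> {1,2}" for i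
  proof -
    interpret stieltjes "b i (3 - i)" by (rule stB[OF i])
    have "set_integrable (LS (b i (3 - i))) {0<..t} (\<lambda>s. comp (3 - i) (u s))"
      using di[OF i, of 0] t by (simp add: drift_integrable_def)
    then have "(\<lambda>s. indicator {0<..t} s *\<^sub>R comp (3 - i) (u s)) \<in> borel_measurable (LS (b i (3 - i)))"
      unfolding set_integrable_def by (rule borel_measurable_integrable)
    moreover have "(\<lambda>s. indicator {0<..t} s *\<^sub>R comp (3 - i) (u s)) = (\<lambda>s. comp (3 - i) (v s))"
      by (auto simp: v_def comp_def)
    ultimately show ?thesis by (simp add: measurable_cong_sets[OF sets_LS refl])
  qed
  have "v \<in> borel_measurable borel"
    by (rule pair_measurable) (use vm[of 1] vm[of 2] in simp_all)
  moreover
  define E where "E = (\<lambda>i. (LINT s:{0<..t}|LS (b i (3 - i)). \<bar>comp (3 - i) (u s)\<bar>) +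
      (LINT s:{0<..t}|LS (bpos (b i i)). \<bar>comp i (u s)\<bar>) + (LINT s:{0<..t}|LS (bneg (b i i)). \<bar>comp i (u s)\<bar>) +
      (LINT s:{0<..t}|LS (c i). \<bar>(comp i (u s))\<^sup>2\<bar>) + (LINT p:{0<..t} \<times> UNIV|m i. \<bar>Kfun i (u (fst p)) (snd p)\<bar>))"
  have bound: "comp i (u r) \<le> A + E i" if ir: "i \<in> {1,2}" "r \<in> {0..t}" for i r
  proof -
    have r: "{r<..t} \<subseteq> {0<..t}" using ir by auto
    have rU: "{r<..t} \<times> UNIV \<subseteq> {0<..t} \<times> (UNIV :: pt set)" using r by auto
    have "0 \<in> {0..t}" using t by simp
    note i0 = di[OF ir(1) this, unfolded drift_integrable_def BVintegrable_def]
      and i1 = di[OF ir, unfolded drift_integrable_def BVintegrable_def]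
    have "drift c b m i u {r<..t} \<le> E i"
      unfolding drift_def BVint_def E_def
      using abs_set_integral_le[OF conjunct1[OF i1] conjunct1[OF i0] r]
        abs_set_integral_le[OF conjunct1[OF conjunct1[OF conjunct2[OF i1]]] conjunct1[OF conjunct1[OF conjunct2[OF i0]]] r]
        abs_set_integral_le[OF conjunct2[OF conjunct1[OF conjunct2[OF i1]]] conjunct2[OF conjunct1[OF conjunct2[OF i0]]] r]
        abs_set_integral_le[OF conjunct1[OF conjunct2[OF conjunct2[OF i1]]] conjunct1[OF conjunct2[OF conjunct2[OF i0]]] r]
        abs_set_integral_le[OF conjunct2[OF conjunct2[OF conjunct2[OF i1]]] conjunct2[OF conjunct2[OF conjunct2[OF i0]]] rU]
      unfolding abs_le_iff by linarith
    then show ?thesis using ueq[OF ir] a[OF ir] by simp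
  qed
  define M where "M = max 0 (max (A + E 1) (A + E 2))"
  have "v s \<in> square M" for s
    using bound[of 1 s] bound[of 2 s] comp_Rplus2[OF nn, of s]
    by (auto simp: v_def square_iff M_def) (auto simp: comp_def)
  moreover have "\<forall>s\<in>{0<..t}. v s = u s" by (simp add: v_def)
  ultimately show ?thesis by blast
qed

text \<open>Both solutions are replaced by bounded Borel versions and identified on
  \<open>(0, t]\<close>; the value at 0 is then recovered from the equation, whose right side
  depends on positive times only.\<close>

lemma nonneg_solution_unique:
  assumes solu: "cbve_sol c b m a t u" and nu: "\<And>s. s \<in> {0..t} \<Longrightarrow> u s \<in> Rplus2"
    and solv: "cbve_sol c b m a t v" and nv: "\<And>s. s \<in> {0..t} \<Longrightarrow> v s \<in> Rplus2"
    and a: "\<And>i r. i \<in> {1,2} \<Longrightarrow> r \<in> {0..t} \<Longrightarrow> a i r \<le> A" and s: "s \<in> {0..t}"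
  shows "u s = v s"
proof -
  obtain M1 u' where u': "u' \<in> borel_measurable borel" "\<And>s. u' s \<in> square M1" "\<And>s. s \<in> {0<..t} \<Longrightarrow> u' s = u s"
    using nonneg_solution_bounded[OF solu nu a] by blast
  obtain M2 v' where v': "v' \<in> borel_measurable borel" "\<And>s. v' s \<in> square M2" "\<And>s. s \<in> {0<..t} \<Longrightarrow> v' s = v s"
    using nonneg_solution_bounded[OF solv nv a] by blast
  define M where "M = max M1 M2"
  have square: "u' s \<in> square M" "v' s \<in> square M" for s
    using u'(2)[of s] v'(2)[of s] by (auto simp: square_def M_def)
  have ueq: "comp i (u r) = a i r + drift c b m i u {r<..t}" and veq: "comp i (v r) = a i r + drift c b m i v {r<..t}"
    if "i \<in> {1,2}" "r \<in> {0..t}" for i r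
    using solu solv that unfolding cbve_sol_drift by blast+
  have cg: "drift c b m i u' {r<..t} = drift c b m i u {r<..t}" "drift c b m i v' {r<..t} = drift c b m i v {r<..t}"
    if "0 \<le> r" for i r
    by (rule drift_cong(1); use that u'(3) v'(3) in force)+
  have eq': "u' r = v' r" if r: "0 < r" "r \<le> t" for r
  proof (rule drift_unique_Ioc[OF order_refl t order_refl u'(1) v'(1) square _ _ r])
    fix i r assume "i \<in> {1::nat,2}" "0 < r" "r \<le> t"
    then show "comp i (u' r) = a i r + drift c b m i u' {r<..t}" "comp i (v' r) = a i r + drift c b m i v' {r<..t}"
      using ueq[of i r] veq[of i r] cg[of r i] u'(3)[of r] v'(3)[of r] by simp_all
  qed
  then have pos: "u r = v r" if "0 < r" "r \<le> t" for r using u'(3)[of r] v'(3)[of r] that by simp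
  have "drift c b m i u {s<..t} = drift c b m i v {s<..t}" for i
    by (rule drift_cong(1)) (use pos s in auto)
  then show ?thesis using ueq[OF _ s] veq[OF _ s] by (intro pt_eqI) simp
qed

end

section \<open>Laplace functionals of finite marginals\<close>

lemma Rplus2_inner: "p \<in> Rplus2 \<Longrightarrow> q \<in> Rplus2 \<Longrightarrow> 0 \<le> p \<bullet> q"
  by (auto simp: inner_pt Rplus2_def)

lemma Rplus2_borel [measurable]: "Rplus2 \<in> sets borel"
  unfolding Rplus2_def by (intro borel_closed closed_Times) auto

locale tcbve_transition = tcbve +
  fixes Q :: "real \<Rightarrow> real \<Rightarrow> pt \<Rightarrow> pt measure"
  assumes semigroup: "tcbve_semigroup c b m Q"
begin

lemma
  assumes "0 \<le> s" "s \<le> q" "y \<in> Rplus2"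
  shows prob_Q: "prob_space (Q s q y)" and sets_Q: "sets (Q s q y) = sets borel"
    and null_Q: "emeasure (Q s q y) (- Rplus2) = 0"
    and laplace_Q: "l \<in> Rplus2 \<Longrightarrow> (\<integral>z. exp (- (l \<bullet> z)) \<partial>Q s q y) = exp (- (y \<bullet> vfun c b m s q l))"
  using semigroup assms unfolding tcbve_semigroup_def by blast+

lemma AE_Q: 
  assumes "0 \<le> s" "s \<le> q" "y \<in> Rplus2"
  shows "AE z in Q s q y. z \<in> Rplus2"
proof (rule AE_I')
  show "- Rplus2 \<in> null_sets (Q s q y)"
    using null_Q[OF assms] sets_Q[OF assms] by (auto simp: null_sets_def intro: borel_open)
qed auto

text \<open>Among the bounded solutions, \<open>vfun\<close> might select one with negative values; the existence of
  the transition semigroup rules this out, since a Laplace transform is at most 1.\<close>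
lemma vfun_nonneg:
  assumes s: "0 \<le> s" "s \<le> q" and l: "l \<in> Rplus2"
  shows "vfun c b m s q l \<in> Rplus2"
proof -
  have "0 \<le> y \<bullet> vfun c b m s q l" if y: "y \<in> Rplus2" for y
  proof -
    interpret prob_space "Q s q y" by (rule prob_Q[OF s y])
    have "(\<integral>z. exp (- (l \<bullet> z)) \<partial>Q s q y) \<le> (\<integral>z. 1 \<partial>Q s q y)"
    proof (rule integral_mono_AE)
      show "AE z in Q s q y. exp (- (l \<bullet> z)) \<le> 1"
        using AE_Q[OF s y] by eventually_elim (use Rplus2_inner[OF l] in auto)
      then show "integrable (Q s q y) (\<lambda>z. exp (- (l \<bullet> z)))"
        by (intro integrable_const_bound[where B=1]) (auto simp: measurable_cong_sets[OF sets_Q[OF s y] refl])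
    qed auto
    then show ?thesis using laplace_Q[OF s y l] by (simp add: prob_space)
  qed
  from this[of "(1, 0)"] this[of "(0, 1)"] show ?thesis
    by (cases "vfun c b m s q l") (auto simp: Rplus2_def inner_pt)
qed

text \<open>The choice inside \<open>vfun\<close> does not involve its first time argument, so
  varying that argument runs through a single chosen solution. A constant source supplies the
  bounded witness that the choice needs.\<close>

lemma vfun_sol:
  assumes q: "0 \<le> q" and l: "l \<in> Rplus2"
  shows "cbve_sol c b m (\<lambda>i s. comp i l) q (\<lambda>s. vfun c b m s q l)"
proof -
  obtain \<mu> where "tcbve_horizon c b m q \<mu>" using horizon_exists[OF q] by blast
  then interpret h: tcbve_horizon c b m q \<mu> .
  define A where "A = fst l + snd l"
  have A: "0 \<le> comp i l" "comp i l \<le> A" "0 \<le> A" for i using l by (auto simp: A_def Rplus2_def comp_def)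
  have "source_on q A (\<lambda>i s. comp i l)" using A by (simp add: source_on_def monotone_on_def)
  then obtain M u where u: "mild_solution c b m q M (\<lambda>i s. comp i l) u"
    using h.bounded_solution_exists[OF A(3)] by blast
  have sol: "cbve_sol c b m (\<lambda>i s. comp i l) q u" by (rule h.mild_solution_cbve_sol[OF u])
  have "bounded (u ` {0..q})"
  proof (rule bounded_subset)
    show "bounded ({0..M} \<times> {0..M})" by (intro bounded_Times bounded_closed_interval)
    have "u s \<in> {0..M} \<times> {0..M}" for s
      using mild_solutionD(2)[OF u, of s] by (cases "u s") (simp add: square_def)
    then show "u ` {0..q} \<subseteq> {0..M} \<times> {0..M}" by blast
  qed
  with sol have "\<exists>u. cbve_sol c b m (\<lambda>i s. comp i l) q u \<and> bounded (u ` {0..q})" by blast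
  from someI_ex[OF this] show ?thesis unfolding vfun_def by simp
qed

text \<open>After splitting the drift at \<open>q\<close>, the solution \<open>w\<close> satisfies
  on \<open>(s, q]\<close> the equation of \<open>vfun\<close> with terminal value
  \<open>w q\<close>, and uniqueness identifies the two. At \<open>s\<close> itself the source may
  jump; the drift over \<open>(s, q]\<close> does not see that time, so the jump is simply
  added.\<close>

lemma flow_step:
  assumes hor: "tcbve_horizon c b m t \<mu>" and w: "mild_solution c b m t M a w"
    and s: "0 \<le> s" "s < q" "q \<le> t" and const: "\<And>i r. i \<in> {1,2} \<Longrightarrow> s < r \<Longrightarrow> r \<le> q \<Longrightarrow> a i r = a i q"
    and i: "i \<in> {1,2}"
  shows "comp i (w s) = (a i s - a i q) + comp i (vfun c b m s q (w q))"
proof -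
  interpret h: tcbve_horizon c b m t \<mu> by fact
  note wm = mild_solutionD(1)[OF w] and wb = mild_solutionD(2)[OF w] and eq = mild_solutionD(3)[OF w]
  have q: "0 \<le> q" using s by simp
  obtain \<mu>' where "tcbve_horizon c b m q \<mu>'" using horizon_exists[OF q] by blast
  then interpret h': tcbve_horizon c b m q \<mu>' .
  have l: "w q \<in> Rplus2" by (rule mild_solution_Rplus2[OF w])
  define v where "v = (\<lambda>s. vfun c b m s q (w q))"
  have vsol: "cbve_sol c b m (\<lambda>i s. comp i (w q)) q v" unfolding v_def by (rule vfun_sol[OF q l])
  have veq: "comp i (v r) = comp i (w q) + drift c b m i v {r<..q}" if "i \<in> {1,2}" "r \<in> {0..q}" for i r
    using vsol that unfolding cbve_sol_drift by blast
  have wq: "comp i (w q) \<le> M" if "i \<in> {1,2}" for i using comp_square[OF wb] by blast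
  \<comment> \<open>Nonnegativity of \<open>vfun\<close>, which comes from the semigroup, yields the
    bounded Borel version that \<open>drift_unique_Ioc\<close> requires.\<close>
  obtain M' v' where v': "v' \<in> borel_measurable borel" "\<And>s. v' s \<in> square M'" "\<And>s. s \<in> {0<..q} \<Longrightarrow> v' s = v s"
    using h'.nonneg_solution_bounded[OF vsol _ wq] vfun_nonneg[OF _ _ l] unfolding v_def by force
  have cg: "drift c b m i v' {r<..q} = drift c b m i v {r<..q}" if "0 \<le> r" for i r
    by (rule drift_cong(1)) (use that v'(3) in auto)
  have weq: "comp i (w r) = (a i r - a i q) + comp i (w q) + drift c b m i w {r<..q}"
    if i: "i \<in> {1,2}" and r: "0 \<le> r" "r \<le> q" for i r
  proof -
    have "{r<..t} = {r<..q} \<union> {q<..t}" using r s by auto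
    then have "drift c b m i w {r<..t} = drift c b m i w {r<..q} + drift c b m i w {q<..t}"
      using h.drift_Un[OF i wm _ _ wb h.Ioc_subset h.Ioc_subset, of r q q t] r s by simp
    then show ?thesis using eq[OF i, of r] eq[OF i, of q] r s by simp
  qed
  define M2 where "M2 = max M M'"
  have square: "w s \<in> square M2" "v' s \<in> square M2" for s
    using wb[of s] v'(2)[of s] by (auto simp: square_def M2_def)
  have wv: "w r = v' r" if r: "s < r" "r \<le> q" for r
  proof (rule h.drift_unique_Ioc[OF s(1) q s(3) wm v'(1) square _ _ r, where \<alpha>="\<lambda>i r. comp i (w q)"])
    fix i r assume i: "i \<in> {1::nat,2}" and r: "s < r" "r \<le> q"
    show "comp i (w r) = comp i (w q) + drift c b m i w {r<..q}"
      using weq[OF i, of r] const[OF i r] r s by simp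
    show "comp i (v' r) = comp i (w q) + drift c b m i v' {r<..q}"
      using veq[OF i, of r] cg[of r i] v'(3)[of r] r s by simp
  qed
  have "drift c b m i w {s<..q} = drift c b m i v {s<..q}"
    by (rule drift_cong(1)) (use wv v'(3) s in auto)
  then show ?thesis using weq[OF i, of s] veq[OF i, of s] s by (simp add: v_def)
qed

end

section \<open>The process under one starting law\<close>

locale tcbve_started = tcbve_transition +
  fixes r :: real and x :: pt and P :: "'a measure" and Fl :: "real \<Rightarrow> 'a measure" and X :: "real \<Rightarrow> 'a \<Rightarrow> pt"
  assumes r: "0 \<le> r" and x: "x \<in> Rplus2" and prob: "prob_space P"
    and adapted: "r \<le> s \<Longrightarrow> subalgebra P (Fl s)" "r \<le> s \<Longrightarrow> X s \<in> borel_measurable (Fl s)"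
    and filtration: "r \<le> s \<Longrightarrow> s \<le> q \<Longrightarrow> sets (Fl s) \<subseteq> sets (Fl q)"
    and X_Rplus2: "\<omega> \<in> space P \<Longrightarrow> r \<le> s \<Longrightarrow> X s \<omega> \<in> Rplus2"
    and X_rc: "\<omega> \<in> space P \<Longrightarrow> r \<le> s \<Longrightarrow> continuous (at_right s) (\<lambda>q. X q \<omega>)"
    and X_ll: "\<omega> \<in> space P \<Longrightarrow> r < s \<Longrightarrow> \<exists>l. ((\<lambda>q. X q \<omega>) \<longlongrightarrow> l) (at_left s)"
    and start: "AE \<omega> in P. X r \<omega> = x"
    and markov: "r \<le> s \<Longrightarrow> s \<le> q \<Longrightarrow> f \<in> borel_measurable borel \<Longrightarrow> bounded (range f) \<Longrightarrow>
      AE \<omega> in P. real_cond_exp P (Fl s) (\<lambda>\<omega>'. f (X q \<omega>')) \<omega> = (\<integral>y. (f y :: real) \<partial>Q s q (X s \<omega>))"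
begin

lemma X_Fl: "r \<le> s \<Longrightarrow> s \<le> q \<Longrightarrow> X s \<in> borel_measurable (Fl q)"
proof -
  assume s: "r \<le> s" "s \<le> q"
  then have "subalgebra (Fl q) (Fl s)"
    using adapted(1)[of s] adapted(1)[of q] filtration[of s q] by (auto simp: subalgebra_def)
  then show ?thesis using adapted(2)[OF s(1)] by (rule measurable_from_subalg)
qed

lemma X_P: "r \<le> s \<Longrightarrow> X s \<in> borel_measurable P"
  using measurable_from_subalg[OF adapted(1) adapted(2)] .

text \<open>The factor \<open>Y\<close> carries everything observed up to time \<open>s\<close>, so
  that the identity can be iterated along a finite set of times.\<close>

lemma markov_laplace:
  assumes s: "r \<le> s" "s \<le> q" and l: "l \<in> Rplus2"
    and Ym: "Y \<in> borel_measurable (Fl s)" and Yb: "\<And>\<omega>. \<omega> \<in> space P \<Longrightarrow> \<bar>Y \<omega>\<bar> \<le> (1::real)"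
  shows "(\<integral>\<omega>. Y \<omega> * exp (- (l \<bullet> X q \<omega>)) \<partial>P) = (\<integral>\<omega>. Y \<omega> * exp (- (vfun c b m s q l \<bullet> X s \<omega>)) \<partial>P)"
proof -
  interpret prob_space P by (rule prob)
  interpret finite_measure_subalgebra P "Fl s"
    by unfold_locales (rule adapted(1)[OF s(1)])
  \<comment> \<open>On the whole plane the exponential is unbounded and the Markov property concerns
    bounded test functions. The cut-off is invisible, because both \<open>X q\<close> and
    \<open>Q s q y\<close> live on \<open>Rplus2\<close>.\<close>
  define g where "g = (\<lambda>z::pt. if z \<in> Rplus2 then exp (- (l \<bullet> z)) else 0)"
  have gm[measurable]: "g \<in> borel_measurable borel" unfolding g_def by measurable
  have g01: "0 \<le> g z" "g z \<le> 1" for z using Rplus2_inner[OF l, of z] by (auto simp: g_def)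
  have gb: "bounded (range g)"
    by (rule boundedI[of _ 1]) (use g01 in auto)
  have [measurable]: "X q \<in> borel_measurable P" "X s \<in> borel_measurable P" using s by (auto intro: X_P)
  have YP[measurable]: "Y \<in> borel_measurable P" by (rule measurable_from_subalg[OF adapted(1)[OF s(1)] Ym])
  have int: "integrable P (\<lambda>\<omega>. Y \<omega> * g (X q \<omega>))"
  proof (rule integrable_const_bound[where B=1])
    show "AE \<omega> in P. norm (Y \<omega> * g (X q \<omega>)) \<le> 1"
    proof (rule AE_I2)
      fix \<omega> assume "\<omega> \<in> space P"
      from Yb[OF this] g01[of "X q \<omega>"] show "norm (Y \<omega> * g (X q \<omega>)) \<le> 1"
        using mult_mono[of "\<bar>Y \<omega>\<bar>" 1 "\<bar>g (X q \<omega>)\<bar>" 1] by (simp add: abs_mult)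
    qed
  qed measurable
  have "(\<integral>\<omega>. Y \<omega> * exp (- (l \<bullet> X q \<omega>)) \<partial>P) = (\<integral>\<omega>. Y \<omega> * g (X q \<omega>) \<partial>P)"
    by (rule Bochner_Integration.integral_cong) (use X_Rplus2 s in \<open>auto simp: g_def\<close>)
  also have "\<dots> = (\<integral>\<omega>. Y \<omega> * real_cond_exp P (Fl s) (\<lambda>\<omega>. g (X q \<omega>)) \<omega> \<partial>P)"
    by (rule real_cond_exp_intg(2)[symmetric]) (use int Ym in auto)
  also have "\<dots> = (\<integral>\<omega>. Y \<omega> * exp (- (vfun c b m s q l \<bullet> X s \<omega>)) \<partial>P)"
  proof (rule integral_cong_AE)
    have "AE \<omega> in P. real_cond_exp P (Fl s) (\<lambda>\<omega>'. g (X q \<omega>')) \<omega> = (\<integral>y. g y \<partial>Q s q (X s \<omega>))"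
      by (rule markov[OF s gm gb])
    then show "AE \<omega> in P. Y \<omega> * real_cond_exp P (Fl s) (\<lambda>\<omega>. g (X q \<omega>)) \<omega>
        = Y \<omega> * exp (- (vfun c b m s q l \<bullet> X s \<omega>))"
    proof (rule AE_mp, intro AE_I2 impI)
      fix \<omega> assume \<omega>: "\<omega> \<in> space P"
        and e: "real_cond_exp P (Fl s) (\<lambda>\<omega>'. g (X q \<omega>')) \<omega> = (\<integral>y. g y \<partial>Q s q (X s \<omega>))"
      have y: "X s \<omega> \<in> Rplus2" using X_Rplus2[OF \<omega> s(1)] .
      have s0: "0 \<le> s" using r s by simp
      have "(\<integral>y. g y \<partial>Q s q (X s \<omega>)) = (\<integral>z. exp (- (l \<bullet> z)) \<partial>Q s q (X s \<omega>))"
      proof (rule integral_cong_AE)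
        show "AE z in Q s q (X s \<omega>). g z = exp (- (l \<bullet> z))"
          using AE_Q[OF s0 s(2) y] by eventually_elim (simp add: g_def)
      qed (simp_all add: measurable_cong_sets[OF sets_Q[OF s0 s(2) y] refl])
      also have "\<dots> = exp (- (vfun c b m s q l \<bullet> X s \<omega>))"
        using laplace_Q[OF s0 s(2) y l] by (simp add: inner_commute)
      finally show "Y \<omega> * real_cond_exp P (Fl s) (\<lambda>\<omega>. g (X q \<omega>)) \<omega>
          = Y \<omega> * exp (- (vfun c b m s q l \<bullet> X s \<omega>))" using e by simp
    qed
  qed measurable
  finally show ?thesis .
qed

text \<open>The expectation in \<open>claim\<close> has the same value for every \<open>n\<close>:
  conditioning at \<open>\<tau> n\<close> replaces \<open>W (Suc n)\<close> by its flow back to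
  \<open>\<tau> n\<close>, and adding the weight \<open>\<theta> n\<close> gives \<open>W n\<close>.
  For \<open>n = N\<close> it is the wanted functional, for \<open>n = 0\<close> only the starting
  point remains.\<close>

lemma laplace_discrete:
  assumes \<tau>0: "\<tau> 0 = r" and \<tau>: "\<And>k. \<tau> k \<le> \<tau> (Suc k)"
    and \<theta>: "\<And>k. \<theta> k \<in> Rplus2" and W: "\<And>k. k \<le> N \<Longrightarrow> W k \<in> Rplus2" and WN: "W N = \<theta> N"
    and Wk: "\<And>k. k < N \<Longrightarrow> W k = \<theta> k + vfun c b m (\<tau> k) (\<tau> (Suc k)) (W (Suc k))"
  shows "(\<integral>\<omega>. exp (- (\<Sum>k\<le>N. \<theta> k \<bullet> X (\<tau> k) \<omega>)) \<partial>P) = exp (- (x \<bullet> W 0))"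
proof -
  interpret prob_space P by (rule prob)
  have \<tau>mono: "\<tau> k \<le> \<tau> n" if "k \<le> n" for k n using lift_Suc_mono_le[of \<tau>, OF \<tau> that] .
  have \<tau>r: "r \<le> \<tau> k" for k using \<tau>mono[of 0 k] \<tau>0 by simp
  have claim: "(\<integral>\<omega>. exp (- (\<Sum>k<n. \<theta> k \<bullet> X (\<tau> k) \<omega>)) * exp (- (W n \<bullet> X (\<tau> n) \<omega>)) \<partial>P) = exp (- (x \<bullet> W 0))" if "n \<le> N" for n
    using that
  proof (induction n)
    case 0
    have [measurable]: "X r \<in> borel_measurable P" by (rule X_P) simp
    have "(\<integral>\<omega>. exp (- (W 0 \<bullet> X r \<omega>)) \<partial>P) = (\<integral>\<omega>. exp (- (W 0 \<bullet> x)) \<partial>P)"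
    proof (rule integral_cong_AE)
      show "AE \<omega> in P. exp (- (W 0 \<bullet> X r \<omega>)) = exp (- (W 0 \<bullet> x))"
        using start by eventually_elim simp
    qed measurable
    then show ?case by (simp add: \<tau>0 prob_space inner_commute)
  next
    case (Suc n)
    define Y where "Y = (\<lambda>\<omega>. exp (- (\<Sum>k<Suc n. \<theta> k \<bullet> X (\<tau> k) \<omega>)))"
    have Xm: "X (\<tau> k) \<in> borel_measurable (Fl (\<tau> n))" if "k \<in> {..<Suc n}" for k
      using that by (intro X_Fl \<tau>r \<tau>mono) auto
    have "(\<lambda>\<omega>. \<Sum>k<Suc n. \<theta> k \<bullet> X (\<tau> k) \<omega>) \<in> borel_measurable (Fl (\<tau> n))"
      by (intro borel_measurable_sum borel_measurable_inner borel_measurable_const Xm)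
    then have Ym: "Y \<in> borel_measurable (Fl (\<tau> n))" unfolding Y_def by measurable
    have Yb: "\<bar>Y \<omega>\<bar> \<le> 1" if "\<omega> \<in> space P" for \<omega>
      unfolding Y_def using that by (auto intro!: sum_nonneg Rplus2_inner \<theta> X_Rplus2 \<tau>r simp del: sum.lessThan_Suc)
    have "(\<integral>\<omega>. Y \<omega> * exp (- (W (Suc n) \<bullet> X (\<tau> (Suc n)) \<omega>)) \<partial>P) =
        (\<integral>\<omega>. Y \<omega> * exp (- (vfun c b m (\<tau> n) (\<tau> (Suc n)) (W (Suc n)) \<bullet> X (\<tau> n) \<omega>)) \<partial>P)"
      by (rule markov_laplace[OF \<tau>r \<tau> W[OF Suc.prems] Ym Yb])
    also have "\<dots> = (\<integral>\<omega>. exp (- (\<Sum>k<n. \<theta> k \<bullet> X (\<tau> k) \<omega>)) * exp (- (W n \<bullet> X (\<tau> n) \<omega>)) \<partial>P)"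
      using Wk[of n] Suc.prems
      by (intro Bochner_Integration.integral_cong) (auto simp: Y_def inner_add_left exp_add[symmetric])
    also have "\<dots> = exp (- (x \<bullet> W 0))" using Suc by simp
    finally show ?case by (simp only: Y_def)
  qed
  have "(\<Sum>k\<le>N. \<theta> k \<bullet> X (\<tau> k) \<omega>) = (\<Sum>k<N. \<theta> k \<bullet> X (\<tau> k) \<omega>) + W N \<bullet> X (\<tau> N) \<omega>" for \<omega>
    by (simp add: WN lessThan_Suc_atMost[symmetric])
  then show ?thesis using claim[of N] by (simp add: exp_add[symmetric])
qed

text \<open>Right-continuity and left limits give a bound near each time, and compactness of
  \<open>[r, t]\<close> combines finitely many of them. The bound provides the dominating constant
  for the pathwise integrals.\<close>

lemma X_bounded:
  assumes \<omega>: "\<omega> \<in> space P"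
  shows "\<exists>B. \<forall>s\<in>{r..t}. norm (X s \<omega>) \<le> B"
proof -
  define f where "f = (\<lambda>s. X s \<omega>)"
  have "\<exists>d>0. \<exists>B. \<forall>y\<in>{r..t}. \<bar>y - s\<bar> < d \<longrightarrow> norm (f y) \<le> B" if s: "s \<in> {r..t}" for s
  proof -
    have right: "\<exists>d>0. \<exists>B. \<forall>y. s < y \<and> y < s + d \<longrightarrow> norm (f y) \<le> B"
    proof -
      have "(f \<longlongrightarrow> f s) (at_right s)"
        using X_rc[OF \<omega>, of s] s by (simp add: f_def continuous_within)
      from tendstoD[OF this, of 1] obtain y0 where y0: "s < y0" "\<And>y. s < y \<Longrightarrow> y < y0 \<Longrightarrow> dist (f y) (f s) < 1"
        by (auto simp: eventually_at_right_field)
      have "norm (f y) \<le> norm (f s) + 1" if "s < y" "y < s + (y0 - s)" for y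
        using y0(2)[of y] that norm_triangle_ineq2[of "f y" "f s"] by (simp add: dist_norm)
      then show ?thesis using y0(1) by (intro exI[of _ "y0 - s"]) auto
    qed
    \<comment> \<open>The guard \<open>r \<le> y\<close> matters at \<open>s = r\<close>, where the
      path is not controlled further to the left.\<close>
    have left: "\<exists>d>0. \<exists>B. \<forall>y. r \<le> y \<and> s - d < y \<and> y < s \<longrightarrow> norm (f y) \<le> B"
    proof (cases "s = r")
      case False
      then obtain l where "(f \<longlongrightarrow> l) (at_left s)" using X_ll[OF \<omega>, of s] s by (auto simp: f_def)
      from tendstoD[OF this, of 1] obtain y0 where y0: "y0 < s" "\<And>y. y0 < y \<Longrightarrow> y < s \<Longrightarrow> dist (f y) l < 1"
        by (auto simp: eventually_at_left_field)
      have "norm (f y) \<le> norm l + 1" if "s - (s - y0) < y" "y < s" for y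
        using y0(2)[of y] that norm_triangle_ineq2[of "f y" l] by (simp add: dist_norm)
      then show ?thesis using y0(1) by (intro exI[of _ "s - y0"]) auto
    qed (auto intro!: exI[of _ 1])
    obtain d1 B1 where 1: "0 < d1" "\<And>y. s < y \<Longrightarrow> y < s + d1 \<Longrightarrow> norm (f y) \<le> B1" using right by blast
    obtain d2 B2 where 2: "0 < d2" "\<And>y. r \<le> y \<Longrightarrow> s - d2 < y \<Longrightarrow> y < s \<Longrightarrow> norm (f y) \<le> B2" using left by blast
    have "norm (f y) \<le> max (norm (f s)) (max B1 B2)" if "y \<in> {r..t}" "\<bar>y - s\<bar> < min d1 d2" for y
    proof -
      consider "y < s" | "y = s" | "s < y" by linarith
      then show ?thesis
      proof cases
        case 1 then show ?thesis using 2(2)[of y] that by auto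
      next
        case 3 then show ?thesis using \<open>\<And>y. s < y \<Longrightarrow> y < s + d1 \<Longrightarrow> norm (f y) \<le> B1\<close>[of y] that by auto
      qed simp
    qed
    then have "\<forall>y\<in>{r..t}. \<bar>y - s\<bar> < min d1 d2 \<longrightarrow> norm (f y) \<le> max (norm (f s)) (max B1 B2)" by blast
    moreover have "0 < min d1 d2" using 1(1) 2(1) by simp
    ultimately show ?thesis by blast
  qed
  then obtain d B where d: "\<And>s. s \<in> {r..t} \<Longrightarrow> 0 < d s"
    and B: "\<And>s y. s \<in> {r..t} \<Longrightarrow> y \<in> {r..t} \<Longrightarrow> \<bar>y - s\<bar> < d s \<Longrightarrow> norm (f y) \<le> B s"
    by metis
  have "compact {r..t}" by simp
  then obtain C where C: "C \<subseteq> {r..t}" "finite C" "{r..t} \<subseteq> (\<Union>s\<in>C. ball s (d s))"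
    by (rule compactE_image[of _ "{r..t}" "\<lambda>s. ball s (d s)"]) (use d in auto)
  have "norm (f y) \<le> (\<Sum>s\<in>C. \<bar>B s\<bar>)" if y: "y \<in> {r..t}" for y
  proof -
    obtain s where s: "s \<in> C" "\<bar>y - s\<bar> < d s" using C(3) y by (auto simp: dist_real_def abs_minus_commute)
    have "norm (f y) \<le> \<bar>B s\<bar>" using B[of s y] s y C(1) by force
    also have "\<dots> \<le> (\<Sum>s\<in>C. \<bar>B s\<bar>)" by (rule member_le_sum) (use s C in auto)
    finally show ?thesis .
  qed
  then show ?thesis unfolding f_def by blast
qed

end

section \<open>Continuity in the source and discretisation of the weights\<close>

text \<open>The error satisfies \<open>e \<le> h + y\<close> with \<open>h\<close> the error of the
  sources and \<open>y\<close> the integral of \<open>e\<close> times \<open>L\<close>. As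
  \<open>h\<close> tends to 0 only pointwise, Gronwall is applied to \<open>y\<close>: it satisfies
  an inequality with the constant \<open>H n\<close>, an integral of \<open>h\<close> over \<mu>,
  and this tends to 0 by dominated convergence. Everything is cut to \<open>[r, t]\<close>, where
  the sources are assumed to converge.\<close>

lemma (in tcbve_horizon) solution_continuous_in_source:
  assumes r: "r \<in> {0..t}"
    and wn: "\<And>n. mild_solution c b m t M (an n) (wn n)" and w: "mild_solution c b m t M a w"
    and src: "\<And>n. source_on t A (an n)" "source_on t A a"
    and conv: "\<And>i s. i \<in> {1,2} \<Longrightarrow> s \<in> {r..t} \<Longrightarrow> (\<lambda>n. an n i s) \<longlonglongrightarrow> a i s"
  shows "(\<lambda>n. comp i (wn n r)) \<longlonglongrightarrow> comp i (w r)"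
proof -
  interpret mu: finite_measure \<mu> by (rule fin)
  have [measurable_cong]: "sets \<mu> = sets borel" by (rule sets_\<mu>)
  note wnm[measurable] = mild_solutionD(1)[OF wn] and wnb = mild_solutionD(2)[OF wn] and wnE = mild_solutionD(3)[OF wn]
    and wm[measurable] = mild_solutionD(1)[OF w] and wb = mild_solutionD(2)[OF w] and wE = mild_solutionD(3)[OF w]
  have M: "0 \<le> M" using wb[of 0] by (auto simp: square_def)
  define L where "L = 2 * (3 * M + 5)"
  have L: "0 \<le> L" using M by (simp add: L_def)
  from volterra_gronwall[OF fin sets_\<mu> t L]
  obtain C where C0: "0 \<le> C" and C: "\<forall>A\<ge>0. \<forall>h B. h \<in> borel_measurable borel \<longrightarrow> (\<forall>r. 0 \<le> h r \<and> h r \<le> B) \<longrightarrow>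
           (\<forall>r\<in>{0..t}. h r \<le> A + L * (LINT s:{r<..t}|\<mu>. h s)) \<longrightarrow> (\<forall>r\<in>{0..t}. h r \<le> A * C)"
    by blast
  define cl where "cl = (\<lambda>s. max 0 (min t s))"
  have clt: "cl s = s" if "s \<in> {r..t}" for s using that r by (auto simp: cl_def)
  have [measurable]: "(\<lambda>s. an n 1 (cl s)) \<in> borel_measurable borel" "(\<lambda>s. an n 2 (cl s)) \<in> borel_measurable borel"
    "(\<lambda>s. a 1 (cl s)) \<in> borel_measurable borel" "(\<lambda>s. a 2 (cl s)) \<in> borel_measurable borel" for n
    unfolding cl_def by (intro antimono_on_clip_measurable t source_onD(1)[OF src(1)] source_onD(1)[OF src(2)]; simp)+
  define h where "h = (\<lambda>n s. if s \<in> {r..t} then \<bar>an n 1 (cl s) - a 1 (cl s)\<bar> + \<bar>an n 2 (cl s) - a 2 (cl s)\<bar> else 0)"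
  define e where "e = (\<lambda>n s. if s \<in> {r..t} then l1_dist (wn n s) (w s) else 0)"
  define y where "y = (\<lambda>n s. if s \<in> {r..t} then L * (LINT q:{s<..t}|\<mu>. e n q) else 0)"
  define H where "H = (\<lambda>n. L * (LINT s:{0<..t}|\<mu>. h n s))"
  have hm[measurable]: "h n \<in> borel_measurable borel" for n unfolding h_def by measurable
  have em[measurable]: "e n \<in> borel_measurable borel" for n unfolding e_def by measurable
  have A: "0 \<le> A" using source_onD(2,3)[OF src(2), of 1 r] r by auto
  have hb: "0 \<le> h n s" "h n s \<le> 2 * A" for n s
  proof -
    have "\<bar>an n i s - a i s\<bar> \<le> A" if "i \<in> {1,2}" "s \<in> {r..t}" for i
      using source_onD(2,3)[OF src(1) that(1), of s n] source_onD(2,3)[OF src(2) that(1), of s] that(2) r by auto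
    from this[of 1] this[of 2] show "0 \<le> h n s" "h n s \<le> 2 * A" using A by (auto simp: h_def clt)
  qed
  have eb: "0 \<le> e n s" "e n s \<le> 2 * M" for n s
    using wnb[of n s] wb[of s] M by (auto simp: e_def l1_dist_def square_def)
  have int_e: "set_integrable \<mu> {s<..t} (e n)" for s n
    by (rule set_integrable_\<mu>[where B="2 * M"]) (use eb in auto)
  have int_h: "set_integrable \<mu> {s<..t} (h n)" for s n
    by (rule set_integrable_\<mu>[where B="2 * A"]) (use hb in auto)
  have I0: "0 \<le> (LINT q:{s<..t}|\<mu>. e n q)" "0 \<le> (LINT q:{s<..t}|\<mu>. h n q)" for s n
    unfolding set_lebesgue_integral_def by (intro integral_nonneg_AE AE_I2, simp add: eb hb)+
  have ym[measurable]: "y n \<in> borel_measurable borel" for n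
  proof -
    have "(\<lambda>s. LINT q:{s<..t}|\<mu>. e n q) = (\<lambda>s. LINT q|\<mu>. (if s < q \<and> q \<le> t then e n q else 0))"
      unfolding set_lebesgue_integral_def by (intro ext Bochner_Integration.integral_cong) auto
    also have "\<dots> \<in> borel_measurable borel" by measurable
    finally show ?thesis unfolding y_def by measurable
  qed
  have yb: "0 \<le> y n s" "y n s \<le> L * (2 * M * measure \<mu> (space \<mu>))" for n s
  proof -
    have "(LINT q:{s<..t}|\<mu>. e n q) \<le> (LINT q|\<mu>. 2 * M)"
      unfolding set_lebesgue_integral_def
      by (rule integral_mono) (use int_e[of s n] eb M in \<open>auto simp: set_integrable_def split: split_indicator\<close>)
    also have "\<dots> = 2 * M * measure \<mu> (space \<mu>)" by (simp add: mult.commute)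
    finally show "0 \<le> y n s" "y n s \<le> L * (2 * M * measure \<mu> (space \<mu>))"
      using I0(1)[of s n] L M by (auto simp: y_def intro: mult_left_mono)
  qed
  have int_y: "set_integrable \<mu> {s<..t} (y n)" for s n
    by (rule set_integrable_\<mu>[where B="L * (2 * M * measure \<mu> (space \<mu>))"]) (use yb in auto)
  have e_le: "e n s \<le> h n s + y n s" for n s
  proof (cases "s \<in> {r..t}")
    case True
    then have s: "s \<in> {0..t}" "0 \<le> s" using r by auto
    have *: "\<bar>comp i (wn n s) - comp i (w s)\<bar> \<le> \<bar>an n i s - a i s\<bar> + (3 * M + 5) * (LINT q:{s<..t}|\<mu>. l1_dist (wn n q) (w q))"
      if i: "i \<in> {1,2}" for i
      using drift_lip[OF i wnm[of n] wm _ wnb[of n] wb Ioc_subset[OF s(2) order_refl]] wnE[OF i s(1), of n] wE[OF i s(1)] by simp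
    have eq: "(LINT q:{s<..t}|\<mu>. l1_dist (wn n q) (w q)) = (LINT q:{s<..t}|\<mu>. e n q)"
      using True by (intro set_lebesgue_integral_cong) (auto simp: e_def sets_\<mu>)
    have "e n s \<le> h n s + ((3 * M + 5) * (LINT q:{s<..t}|\<mu>. e n q) + (3 * M + 5) * (LINT q:{s<..t}|\<mu>. e n q))"
      using *[of 1] *[of 2] l1_dist_comp[of 1 "wn n s" "w s"] True by (simp add: e_def[of] h_def clt eq[unfolded e_def])
    also have "(3 * M + 5) * (LINT q:{s<..t}|\<mu>. e n q) + (3 * M + 5) * (LINT q:{s<..t}|\<mu>. e n q) = y n s"
      using True by (simp add: y_def L_def)
    finally show ?thesis .
  next
    case False
    then have "e n s = 0" by (simp only: e_def if_False)
    then show ?thesis using hb(1)[of n s] yb(1)[of n s] by simp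
  qed
  have yH: "y n s \<le> H n + L * (LINT q:{s<..t}|\<mu>. y n q)" if s: "s \<in> {0..t}" for n s
  proof -
    have "(LINT q:{s<..t}|\<mu>. e n q) \<le> (LINT q:{s<..t}|\<mu>. h n q + y n q)"
      by (rule set_integral_mono) (use int_e int_h int_y e_le in \<open>auto intro: set_integral_add(1)\<close>)
    also have "\<dots> = (LINT q:{s<..t}|\<mu>. h n q) + (LINT q:{s<..t}|\<mu>. y n q)"
      by (rule set_integral_add(2)[OF int_h int_y])
    also have "(LINT q:{s<..t}|\<mu>. h n q) \<le> (LINT q:{0<..t}|\<mu>. h n q)"
      unfolding set_lebesgue_integral_def
      by (rule integral_mono) (use int_h[of s n] int_h[of 0 n] hb s in \<open>auto simp: set_integrable_def split: split_indicator\<close>)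
    finally have le: "(LINT q:{s<..t}|\<mu>. e n q) \<le> (LINT q:{0<..t}|\<mu>. h n q) + (LINT q:{s<..t}|\<mu>. y n q)" by simp
    have "L * (LINT q:{s<..t}|\<mu>. e n q) \<le> H n + L * (LINT q:{s<..t}|\<mu>. y n q)"
      using mult_left_mono[OF le L] by (simp add: H_def distrib_left)
    moreover have "y n s \<le> L * (LINT q:{s<..t}|\<mu>. e n q)"
      using mult_nonneg_nonneg[OF L I0(1)[of s n]] by (simp add: y_def)
    ultimately show ?thesis by simp
  qed
  have H0: "0 \<le> H n" for n unfolding H_def using L I0(2)[where s=0] by simp
  have yr: "y n r \<le> H n * C" for n
  proof (rule C[rule_format, of "H n" "y n" "L * (2 * M * measure \<mu> (space \<mu>))"])
    show "0 \<le> H n" by (rule H0)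
    show "0 \<le> y n s \<and> y n s \<le> L * (2 * M * measure \<mu> (space \<mu>))" for s using yb by simp
    show "y n s \<le> H n + L * (LINT q:{s<..t}|\<mu>. y n q)" if "s \<in> {0..t}" for s by (rule yH[OF that])
  qed (use r in simp_all)
  have hlim: "(\<lambda>n. h n s) \<longlonglongrightarrow> 0" for s
  proof (cases "s \<in> {r..t}")
    case True
    have "(\<lambda>n. \<bar>an n 1 s - a 1 s\<bar> + \<bar>an n 2 s - a 2 s\<bar>) \<longlonglongrightarrow> \<bar>a 1 s - a 1 s\<bar> + \<bar>a 2 s - a 2 s\<bar>"
      by (intro tendsto_intros conv True) auto
    moreover have "h n s = \<bar>an n 1 s - a 1 s\<bar> + \<bar>an n 2 s - a 2 s\<bar>" for n
      unfolding h_def clt[OF True] using True by (rule if_P)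
    ultimately show ?thesis by simp
  next
    case False
    then have "h n s = 0" for n unfolding h_def by (rule if_not_P)
    then show ?thesis by simp
  qed
  have "(\<lambda>n. LINT s:{0<..t}|\<mu>. h n s) \<longlonglongrightarrow> (LINT s:{0<..t}|\<mu>. 0)"
    unfolding set_lebesgue_integral_def
  proof (rule integral_dominated_convergence[where w="\<lambda>_. 2 * A"])
    show "AE s in \<mu>. (\<lambda>n. indicator {0<..t} s *\<^sub>R h n s) \<longlonglongrightarrow> indicator {0<..t} s *\<^sub>R 0"
      by (intro AE_I2 tendsto_scaleR tendsto_const hlim)
    show "AE s in \<mu>. norm (indicator {0<..t} s *\<^sub>R h n s) \<le> 2 * A" for n
      by (rule AE_I2) (use hb A in \<open>auto split: split_indicator\<close>)
  qed auto
  then have "(\<lambda>n. L * (LINT s:{0<..t}|\<mu>. h n s)) \<longlonglongrightarrow> L * 0"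
    by (intro tendsto_mult tendsto_const) simp
  then have "H \<longlonglongrightarrow> 0" by (simp add: H_def)
  then have "(\<lambda>n. h n r + H n * C) \<longlonglongrightarrow> 0 + 0 * C"
    by (intro tendsto_intros hlim)
  then have lim: "(\<lambda>n. h n r + H n * C) \<longlonglongrightarrow> 0" by simp
  have "norm (comp i (wn n r) - comp i (w r)) \<le> h n r + H n * C" for n
  proof -
    have "norm (comp i (wn n r) - comp i (w r)) \<le> e n r"
      using r comp_l1_dist[of i "wn n r" "w r"] by (simp add: e_def)
    also have "\<dots> \<le> h n r + H n * C" using e_le[of n r] yr[of n] by simp
    finally show ?thesis .
  qed
  then have "(\<lambda>n. comp i (wn n r) - comp i (w r)) \<longlonglongrightarrow> 0"
    by (intro Lim_null_comparison[OF always_eventually lim]) blast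
  then show ?thesis by (rule LIM_zero_cancel)
qed

section \<open>Moving a measure to the right endpoints of a grid\<close>

definition grid :: "real \<Rightarrow> real \<Rightarrow> nat \<Rightarrow> nat \<Rightarrow> real" where
  "grid r t n k = r + real k * ((t - r) / real (Suc n))"

text \<open>The ceiling selects the first grid point at or after \<open>y\<close>. Cells are open on
  the left, except that \<open>r\<close> forms the cell of index 0 by itself, so an atom at
  \<open>r\<close> stays in place.\<close>

definition grid_index :: "real \<Rightarrow> real \<Rightarrow> nat \<Rightarrow> real \<Rightarrow> nat" where
  "grid_index r t n y = nat \<lceil>(y - r) / ((t - r) / real (Suc n))\<rceil>"

definition grid_weight :: "real measure \<Rightarrow> real \<Rightarrow> real \<Rightarrow> nat \<Rightarrow> nat \<Rightarrow> real" where
  "grid_weight Z r t n k = measure Z {y\<in>{r..t}. grid_index r t n y = k}"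

lemma grid_0 [simp]: "grid r t n 0 = r" by (simp add: grid_def)

lemma grid_last [simp]: "grid r t n (Suc n) = t"
proof -
  have "real (Suc n) * ((t - r) / real (Suc n)) = t - r" by simp
  then show ?thesis unfolding grid_def by linarith
qed

lemma grid_mono_iff: "r < t \<Longrightarrow> grid r t n j \<le> grid r t n k \<longleftrightarrow> j \<le> k"
proof -
  assume "r < t"
  then have "0 < (t - r) / real (Suc n)" by simp
  then show ?thesis unfolding grid_def add_le_cancel_left by (simp only: mult_le_cancel_right_pos of_nat_le_iff)
qed

lemma grid_index_le_iff:
  assumes "r < t" shows "grid_index r t n y \<le> k \<longleftrightarrow> y \<le> grid r t n k"
proof -
  define d where "d = (t - r) / real (Suc n)"
  have "0 < d" using assms by (simp add: d_def)
  then show ?thesis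
    unfolding grid_index_def grid_def nat_le_iff ceiling_le_iff d_def[symmetric] by (simp add: pos_divide_le_eq algebra_simps)
qed

lemma grid_index_bounds:
  assumes rt: "r < t" and y: "y \<in> {r..t}"
  shows "grid_index r t n y \<le> Suc n" "y \<le> grid r t n (grid_index r t n y)"
    "grid r t n (grid_index r t n y) \<le> y + (t - r) / real (Suc n)"
proof -
  show "grid_index r t n y \<le> Suc n" unfolding grid_index_le_iff[OF rt] using y by simp
  show "y \<le> grid r t n (grid_index r t n y)" using grid_index_le_iff[OF rt, of n y] by blast
  define d where "d = (t - r) / real (Suc n)"
  have d: "0 < d" using rt by (simp add: d_def)
  have z: "0 \<le> (y - r) / d" using y d by simp
  have "0 \<le> real_of_int \<lceil>(y - r) / d\<rceil>" using z le_of_int_ceiling[of "(y - r) / d"] by linarith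
  then have "0 \<le> \<lceil>(y - r) / d\<rceil>" by (simp only: of_int_0_le_iff)
  then have "real (nat \<lceil>(y - r) / d\<rceil>) = real_of_int \<lceil>(y - r) / d\<rceil>" by (rule of_nat_nat)
  then have "real (grid_index r t n y) \<le> (y - r) / d + 1"
    using ceiling_correct[of "(y - r) / d"] unfolding grid_index_def d_def[symmetric] by linarith
  then have "real (grid_index r t n y) * d \<le> ((y - r) / d + 1) * d" using d by (intro mult_right_mono) auto
  also have "\<dots> = y - r + d" using d by (simp add: field_simps)
  finally show "grid r t n (grid_index r t n y) \<le> y + (t - r) / real (Suc n)"
    unfolding grid_def d_def[symmetric] by simp
qed

locale source_measure =
  fixes Z :: "real measure"
  assumes sets_Z: "sets Z = sets (restrict_space borel {0..})"
    and finite_Z: "\<And>B. B \<in> sets Z \<Longrightarrow> bounded B \<Longrightarrow> emeasure Z B < \<infinity>"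
begin

lemma in_sets: "A \<in> sets borel \<Longrightarrow> A \<subseteq> {0..} \<Longrightarrow> A \<in> sets Z"
  by (simp add: sets_Z sets_restrict_space_iff)

lemma fin_Z: "A \<in> sets borel \<Longrightarrow> A \<subseteq> {0..t} \<Longrightarrow> A \<in> sets Z \<and> emeasure Z A < \<infinity>"
proof -
  assume A: "A \<in> sets borel" "A \<subseteq> {0..t}"
  have "A \<subseteq> {0..}" using A(2) by (rule order_trans) auto
  then show ?thesis
    using in_sets[OF A(1)] finite_Z bounded_subset[OF bounded_closed_interval A(2)] by blast
qed

lemma measure_Icc_mono: "0 \<le> r \<Longrightarrow> r \<le> s \<Longrightarrow> measure Z {s..t} \<le> measure Z {r..t}"
  using fin_Z[of "{r..t}" t] fin_Z[of "{s..t}" t]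
  by (intro measure_mono_fmeasurable) (auto simp: fmeasurable_def)

lemma grid_cell:
  assumes "0 \<le> r"
  shows "{y\<in>{r..t}. grid_index r t n y = k} \<in> sets Z" "emeasure Z {y\<in>{r..t}. grid_index r t n y = k} < \<infinity>"
proof -
  have "{y\<in>space borel. y \<in> {r..t} \<and> grid_index r t n y = k} \<in> sets borel"
    unfolding grid_index_def by measurable
  then have "{y\<in>{r..t}. grid_index r t n y = k} \<in> sets borel" by simp
  moreover have "{y\<in>{r..t}. grid_index r t n y = k} \<subseteq> {0..t}" using assms by auto
  ultimately have "{y\<in>{r..t}. grid_index r t n y = k} \<in> sets Z \<and> emeasure Z {y\<in>{r..t}. grid_index r t n y = k} < \<infinity>"
    by (rule fin_Z)
  then
  show "{y\<in>{r..t}. grid_index r t n y = k} \<in> sets Z" "emeasure Z {y\<in>{r..t}. grid_index r t n y = k} < \<infinity>"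
    by blast+
qed

lemma grid_step:
  assumes rt: "r < t"
  shows "indicator {r..t} y *\<^sub>R f (grid r t n (grid_index r t n y)) =
    (\<Sum>k\<le>Suc n. f (grid r t n k) * indicator {y\<in>{r..t}. grid_index r t n y = k} y :: real)"
proof (cases "y \<in> {r..t}")
  case True
  have "(\<Sum>k\<le>Suc n. f (grid r t n k) * indicator {y\<in>{r..t}. grid_index r t n y = k} y :: real) =
      (\<Sum>k\<le>Suc n. if grid_index r t n y = k then f (grid r t n k) else 0)"
    using True by (intro sum.cong) (auto simp: indicator_def)
  also have "\<dots> = f (grid r t n (grid_index r t n y))"
    using grid_index_bounds(1)[OF rt True, of n] by (subst sum.delta') auto
  finally show ?thesis using True by simp
qed (auto intro!: sum.neutral simp: indicator_def)

lemma grid_sum: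
  assumes r: "0 \<le> r" "r < t"
  shows "(\<Sum>k\<le>Suc n. f (grid r t n k) * grid_weight Z r t n k) = (LINT y:{r..t}|Z. f (grid r t n (grid_index r t n y)))"
proof -
  note cell = grid_cell[OF r(1), of t n]
  have "(LINT y:{r..t}|Z. f (grid r t n (grid_index r t n y))) =
      (LINT y|Z. (\<Sum>k\<le>Suc n. f (grid r t n k) * indicator {y\<in>{r..t}. grid_index r t n y = k} y))"
    unfolding set_lebesgue_integral_def grid_step[OF r(2)] ..
  also have "\<dots> = (\<Sum>k\<le>Suc n. f (grid r t n k) * grid_weight Z r t n k)"
    unfolding grid_weight_def using cell by (subst Bochner_Integration.integral_sum) (auto simp: less_top)
  finally show ?thesis ..
qed

text \<open>Mass moves only to the right, by at most the mesh width, so right-continuity of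
  \<open>f\<close> gives pointwise convergence of the step functions. Their limit is measurable,
  which provides the measurability of \<open>f\<close> on \<open>[r, t]\<close>; a constant on
  \<open>[r, t]\<close> dominates.\<close>

lemma grid_sum_limit:
  fixes f :: "real \<Rightarrow> real"
  assumes r: "0 \<le> r" "r < t" and B: "\<And>y. y \<in> {r..t} \<Longrightarrow> \<bar>f y\<bar> \<le> B"
    and rc: "\<And>y. y \<in> {r..t} \<Longrightarrow> continuous (at_right y) f"
  shows "(\<lambda>n. \<Sum>k\<le>Suc n. f (grid r t n k) * grid_weight Z r t n k) \<longlonglongrightarrow> (LINT y:{r..t}|Z. f y)"
  unfolding grid_sum[OF r] set_lebesgue_integral_def
proof (rule integral_dominated_convergence[where w="\<lambda>y. B * indicator {r..t} y"])
  note cell = grid_cell[OF r(1), of t]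
  show m: "(\<lambda>y. indicator {r..t} y *\<^sub>R f (grid r t n (grid_index r t n y))) \<in> borel_measurable Z" for n
    unfolding grid_step[OF r(2)] using cell by (intro borel_measurable_sum borel_measurable_times) auto
  have lim: "(\<lambda>n. indicator {r..t} y *\<^sub>R f (grid r t n (grid_index r t n y))) \<longlonglongrightarrow> indicator {r..t} y *\<^sub>R f y" for y
  proof (cases "y \<in> {r..t}")
    case True
    define q where "q = (\<lambda>n. grid r t n (grid_index r t n y))"
    have "(\<lambda>n. y + (t - r) / real (Suc n)) \<longlonglongrightarrow> y + 0"
      by (intro tendsto_intros LIMSEQ_Suc[OF lim_const_over_n])
    then have qy: "q \<longlonglongrightarrow> y"
      by (intro tendsto_sandwich[of "\<lambda>_. y" q sequentially "\<lambda>n. y + (t - r) / real (Suc n)"])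
        (use grid_index_bounds[OF r(2) True] in \<open>auto simp: q_def\<close>)
    \<comment> \<open>The grid points may coincide with \<open>y\<close>, so the closed ray replaces
      the punctured right neighbourhood.\<close>
    have "continuous (at y within {y..}) f" using rc[OF True] by (simp add: at_within_Ici_at_right)
    then have "(f \<circ> q) \<longlonglongrightarrow> f y"
      unfolding continuous_within_sequentially using qy grid_index_bounds(2)[OF r(2) True] by (auto simp: q_def)
    then show ?thesis using True by (simp add: q_def o_def)
  qed simp
  then show "AE y in Z. (\<lambda>n. indicator {r..t} y *\<^sub>R f (grid r t n (grid_index r t n y))) \<longlonglongrightarrow> indicator {r..t} y *\<^sub>R f y"
    by simp
  show "(\<lambda>y. indicator {r..t} y *\<^sub>R f y) \<in> borel_measurable Z"
    by (rule borel_measurable_LIMSEQ_metric[OF m lim])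
  show "integrable Z (\<lambda>y. B * indicator {r..t} y)"
    using fin_Z[of "{r..t}" t] r by (auto simp: less_top)
  show "AE y in Z. norm (indicator {r..t} y *\<^sub>R f (grid r t n (grid_index r t n y))) \<le> B * indicator {r..t} y" for n
  proof (rule AE_I2)
    fix y
    show "norm (indicator {r..t} y *\<^sub>R f (grid r t n (grid_index r t n y))) \<le> B * indicator {r..t} y"
    proof (cases "y \<in> {r..t}")
      case True
      have "grid r t n (grid_index r t n y) \<le> grid r t n (Suc n)"
        using grid_index_bounds(1)[OF r(2) True] by (simp only: grid_mono_iff[OF r(2)])
      then have "grid r t n (grid_index r t n y) \<in> {r..t}"
        using grid_index_bounds(2)[OF r(2) True, of n] True by simp
      with B True show ?thesis by simp
    qed simp
  qed
qed

text \<open>This is the mass that the discretised measure puts on \<open>[s, t]\<close>, written as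
  a grid sum of an indicator so that \<open>grid_sum\<close> and \<open>grid_sum_limit\<close> apply
  to it.\<close>

definition grid_source :: "real \<Rightarrow> real \<Rightarrow> nat \<Rightarrow> real \<Rightarrow> real" where
  "grid_source r t n s = (\<Sum>k\<le>Suc n. (if s \<le> grid r t n k then 1 else 0) * grid_weight Z r t n k)"

text \<open>The indicator of \<open>s \<le> y\<close> is right-continuous in \<open>y\<close>. Hence
  the limit holds at every \<open>s\<close>, including atoms of \<open>Z\<close>, and it follows
  from the same lemma that treats the paths.\<close>

lemma grid_source_limit:
  assumes r: "0 \<le> r" "r < t" and s: "s \<in> {r..t}"
  shows "(\<lambda>n. grid_source r t n s) \<longlonglongrightarrow> measure Z {s..t}"
proof -
  have "(\<lambda>n. grid_source r t n s) \<longlonglongrightarrow> (LINT y:{r..t}|Z. (if s \<le> y then 1 else 0))"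
    unfolding grid_source_def
  proof (rule grid_sum_limit[OF r])
    show "\<bar>if s \<le> y then 1 else 0 :: real\<bar> \<le> 1" for y by simp
    show "continuous (at_right y) (\<lambda>y. if s \<le> y then 1 else 0 :: real)" for y
    proof -
      have "\<forall>\<^sub>F z in at_right y. (if s \<le> z then 1 else 0 :: real) = (if s \<le> y then 1 else 0)"
        unfolding eventually_at_right_field
        by (intro exI[of _ "if s \<le> y then y + 1 else s"]) auto
      then show ?thesis unfolding continuous_within by (rule tendsto_eventually)
    qed
  qed
  also have "(LINT y:{r..t}|Z. (if s \<le> y then 1 else 0)) = (LINT y|Z. indicator {s..t} y)"
    unfolding set_lebesgue_integral_def using s
    by (intro Bochner_Integration.integral_cong) (auto split: split_indicator)
  also have "\<dots> = measure Z {s..t}"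
  proof -
    have "{s..t} \<subseteq> {0..t}" using s r by auto
    then have "{s..t} \<in> sets Z" using fin_Z[of "{s..t}" t] by simp
    from sets.Int_space_eq2[OF this] show ?thesis by simp
  qed
  finally show ?thesis .
qed

lemma grid_weight_nonneg [simp]: "0 \<le> grid_weight Z r t n k"
  by (simp add: grid_weight_def)

lemma grid_source_bounds:
  assumes r: "0 \<le> r" "r < t"
  shows "0 \<le> grid_source r t n s" "grid_source r t n s \<le> measure Z {0..t}"
proof -
  show "0 \<le> grid_source r t n s" unfolding grid_source_def by (intro sum_nonneg) auto
  have "grid_source r t n s \<le> (\<Sum>k\<le>Suc n. (\<lambda>_. 1) (grid r t n k) * grid_weight Z r t n k)"
    unfolding grid_source_def by (intro sum_mono mult_right_mono) auto
  also have "\<dots> = (LINT y:{r..t}|Z. 1)" by (rule grid_sum[OF r])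
  also have "\<dots> = measure Z {r..t}"
  proof -
    have "{r..t} \<subseteq> {0..t}" using r by auto
    then have "{r..t} \<in> sets Z" using fin_Z[of "{r..t}" t] by simp
    from sets.Int_space_eq2[OF this] show ?thesis by (simp add: set_lebesgue_integral_def)
  qed
  also have "\<dots> \<le> measure Z {0..t}" by (rule measure_Icc_mono) (use r in auto)
  finally show "grid_source r t n s \<le> measure Z {0..t}" .
qed

lemma grid_source_antimono: "antimono_on A (grid_source r t n)"
  unfolding monotone_on_def grid_source_def by (intro ballI impI sum_mono mult_right_mono) auto

lemma grid_source_tail:
  assumes "\<And>j. j \<le> Suc n \<Longrightarrow> s \<le> grid r t n j \<longleftrightarrow> k \<le> j"
  shows "grid_source r t n s = (\<Sum>j=k..Suc n. grid_weight Z r t n j)"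
proof -
  have "grid_source r t n s = (\<Sum>j\<le>Suc n. if k \<le> j then grid_weight Z r t n j else 0)"
    unfolding grid_source_def using assms by (intro sum.cong) auto
  also have "\<dots> = (\<Sum>j\<in>{..Suc n} \<inter> {k..}. grid_weight Z r t n j)"
    by (subst sum.inter_restrict) auto
  also have "{..Suc n} \<inter> {k..} = {k..Suc n}" by auto
  finally show ?thesis .
qed

end

section \<open>The weighted occupation time\<close>

context tcbve_started
begin

text \<open>The source of a measure carried by the grid is constant on each interval
  \<open>(grid r t n k, grid r t n (Suc k)]\<close> and jumps by the weight at its left end. So
  \<open>flow_step\<close> is precisely the recursion that \<open>laplace_discrete\<close>
  requires.\<close>

lemma laplace_grid:
  assumes hor: "tcbve_horizon c b m t \<mu>" and rt: "r < t"
    and Z: "\<And>i. i \<in> {1,2} \<Longrightarrow> source_measure (\<zeta> i)"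
    and w: "mild_solution c b m t M (\<lambda>i. source_measure.grid_source (\<zeta> i) r t n) w"
  shows "(\<integral>\<omega>. exp (- (\<Sum>k\<le>Suc n. (grid_weight (\<zeta> 1) r t n k, grid_weight (\<zeta> 2) r t n k) \<bullet> X (grid r t n k) \<omega>)) \<partial>P)
    = exp (- (x \<bullet> w r))"
proof -
  define \<theta> where "\<theta> k = (grid_weight (\<zeta> 1) r t n k, grid_weight (\<zeta> 2) r t n k)" for k
  have \<theta>c: "comp i (\<theta> k) = grid_weight (\<zeta> i) r t n k" if "i \<in> {1,2}" for i k
    using that by (auto simp: \<theta>_def comp_def)
  have tail: "source_measure.grid_source (\<zeta> i) r t n s = (\<Sum>j=k..Suc n. grid_weight (\<zeta> i) r t n j)"
    if "i \<in> {1,2}" "\<And>j. j \<le> Suc n \<Longrightarrow> s \<le> grid r t n j \<longleftrightarrow> k \<le> j" for i s k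
    using source_measure.grid_source_tail[OF Z[OF that(1)] that(2)] by simp
  have gr: "r \<le> grid r t n k" for k using grid_mono_iff[OF rt, of n 0 k] by simp
  have gt: "grid r t n k \<le> t" if "k \<le> Suc n" for k
    using grid_mono_iff[OF rt, of n k "Suc n"] that by simp
  have glt: "grid r t n k < grid r t n (Suc k)" for k
    using grid_mono_iff[OF rt, of n "Suc k" k] by (simp add: not_le[symmetric])
  have "(\<integral>\<omega>. exp (- (\<Sum>k\<le>Suc n. \<theta> k \<bullet> X (grid r t n k) \<omega>)) \<partial>P) = exp (- (x \<bullet> w (grid r t n 0)))"
  proof (rule laplace_discrete[where W="\<lambda>k. w (grid r t n k)"])
    show "grid r t n 0 = r" by simp
    show "grid r t n k \<le> grid r t n (Suc k)" for k using glt[of k] by simp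
    show "\<theta> k \<in> Rplus2" for k by (simp add: \<theta>_def Rplus2_def grid_weight_def)
    show "w (grid r t n k) \<in> Rplus2" for k by (rule mild_solution_Rplus2[OF w])
    show "w (grid r t n (Suc n)) = \<theta> (Suc n)"
    proof (rule pt_eqI)
      fix i :: nat assume i: "i \<in> {1,2}"
      have "source_measure.grid_source (\<zeta> i) r t n t = (\<Sum>j=Suc n..Suc n. grid_weight (\<zeta> i) r t n j)"
      proof (rule tail[OF i])
        fix j show "t \<le> grid r t n j \<longleftrightarrow> Suc n \<le> j" using grid_mono_iff[OF rt, of n "Suc n" j] by simp
      qed
      moreover have "t \<in> {0..t}" using r rt by simp
      ultimately show "comp i (w (grid r t n (Suc n))) = comp i (\<theta> (Suc n))"
        using mild_solutionD(3)[OF w i, of t] by (simp add: \<theta>c[OF i])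
    qed
    fix k assume k: "k < Suc n"
    show "w (grid r t n k) = \<theta> k + vfun c b m (grid r t n k) (grid r t n (Suc k)) (w (grid r t n (Suc k)))"
    proof (rule pt_eqI)
      fix i :: nat assume i: "i \<in> {1,2}"
      define a where "a = (\<lambda>i. source_measure.grid_source (\<zeta> i) r t n)"
      have a1: "a i s = (\<Sum>j=Suc k..Suc n. grid_weight (\<zeta> i) r t n j)"
        if "i \<in> {1,2}" "grid r t n k < s" "s \<le> grid r t n (Suc k)" for i s
        unfolding a_def
      proof (rule tail[OF that(1)])
        fix j show "s \<le> grid r t n j \<longleftrightarrow> Suc k \<le> j"
          using that(2,3) grid_mono_iff[OF rt, of n j k] grid_mono_iff[OF rt, of n "Suc k" j]
          by (meson not_less_eq_eq order_trans linorder_not_le)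
      qed
      have a0: "a i (grid r t n k) = (\<Sum>j=k..Suc n. grid_weight (\<zeta> i) r t n j)"
        unfolding a_def by (rule tail[OF i]) (rule grid_mono_iff[OF rt])
      have "comp i (w (grid r t n k)) = (a i (grid r t n k) - a i (grid r t n (Suc k)))
          + comp i (vfun c b m (grid r t n k) (grid r t n (Suc k)) (w (grid r t n (Suc k))))"
      proof (rule flow_step[OF hor w[folded a_def] _ glt _ _ i])
        show "0 \<le> grid r t n k" using r gr[of k] by simp
        show "grid r t n (Suc k) \<le> t" using k by (intro gt) simp
        show "a i s = a i (grid r t n (Suc k))"
          if "i \<in> {1,2}" "grid r t n k < s" "s \<le> grid r t n (Suc k)" for i s
          using a1[OF that] a1[OF that(1) glt order_refl] by simp
      qed
      \<comment> \<open>Two tail sums, starting at \<open>k\<close> and at \<open>Suc k\<close>,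
        differ by the weight at \<open>k\<close>.\<close>
      also have "a i (grid r t n k) - a i (grid r t n (Suc k)) = comp i (\<theta> k)"
        unfolding a0 a1[OF i glt order_refl] \<theta>c[OF i] using k by (subst sum.atLeast_Suc_atMost) auto
      finally show "comp i (w (grid r t n k)) =
          comp i (\<theta> k + vfun c b m (grid r t n k) (grid r t n (Suc k)) (w (grid r t n (Suc k))))"
        by (simp add: comp_def)
    qed
  qed
  then show ?thesis by (simp only: \<theta>_def grid_0)
qed

lemma comp_X_rc:
  assumes "\<omega> \<in> space P" "r \<le> s" shows "continuous (at_right s) (\<lambda>q. comp i (X q \<omega>))"
  using X_rc[OF assms] unfolding comp_def by (cases "i = 1") (simp_all add: continuous_fst continuous_snd)

lemma laplace_functional:
  assumes hor: "tcbve_horizon c b m t \<mu>" and rt: "r \<le> t"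
    and Z: "\<And>i. i \<in> {1,2} \<Longrightarrow> source_measure (\<zeta> i)"
    and w: "mild_solution c b m t M (\<lambda>i s. measure (\<zeta> i) {s..t}) w"
    and src: "source_on t A (\<lambda>i s. measure (\<zeta> i) {s..t})"
  shows "(\<integral>\<omega>. exp (- (\<Sum>i\<in>{1::nat,2}. LINT s:{r..t}|\<zeta> i. comp i (X s \<omega>))) \<partial>P) = exp (- (x \<bullet> w r))"
proof (cases "r = t")
  \<comment> \<open>A one-point interval has no grid; the integral reduces to the atom at
    \<open>r\<close> and the start condition decides.\<close>
  case True
  interpret prob_space P by (rule prob)
  have [measurable]: "X r \<in> borel_measurable P" by (rule X_P) simp
  have wr: "comp i (w r) = measure (\<zeta> i) {r}" if "i \<in> {1,2}" for i
    using mild_solutionD(3)[OF w that, of r] r True by simp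
  have "(LINT s:{r..t}|\<zeta> i. comp i (X s \<omega>)) = comp i (w r) * comp i (X r \<omega>)" if i: "i \<in> {1,2}" for i \<omega>
  proof -
    interpret source_measure "\<zeta> i" by (rule Z[OF i])
    have "{r} \<subseteq> {0..r}" using r by simp
    with fin_Z[of "{r}" r] have S: "{r} \<in> sets (\<zeta> i)" "emeasure (\<zeta> i) {r} < \<infinity>" by auto
    have "(LINT s:{r..t}|\<zeta> i. comp i (X s \<omega>)) = (LINT s|\<zeta> i. indicator {r} s *\<^sub>R comp i (X r \<omega>))"
      unfolding set_lebesgue_integral_def using True
      by (intro Bochner_Integration.integral_cong) (auto split: split_indicator)
    also have "\<dots> = measure (\<zeta> i) {r} * comp i (X r \<omega>)" using S by (simp add: less_top)
    finally show ?thesis using wr[OF i] by simp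
  qed
  then have "(\<integral>\<omega>. exp (- (\<Sum>i\<in>{1::nat,2}. LINT s:{r..t}|\<zeta> i. comp i (X s \<omega>))) \<partial>P) = (\<integral>\<omega>. exp (- (w r \<bullet> X r \<omega>)) \<partial>P)"
    by (simp add: inner_pt comp_def)
  also have "\<dots> = (\<integral>\<omega>. exp (- (w r \<bullet> x)) \<partial>P)"
  proof (rule integral_cong_AE)
    show "AE \<omega> in P. exp (- (w r \<bullet> X r \<omega>)) = exp (- (w r \<bullet> x))"
      using start by eventually_elim simp
  qed measurable
  also have "\<dots> = exp (- (x \<bullet> w r))" by (simp add: prob_space inner_commute)
  finally show ?thesis .
next
  case False
  with rt have rt: "r < t" by simp
  interpret prob_space P by (rule prob)
  interpret h: tcbve_horizon c b m t \<mu> by (rule hor)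
  have r0: "r \<in> {0..t}" and t0: "0 \<in> {0..t}" using r rt by simp_all
  have A0: "0 \<le> A" using order_trans[OF measure_nonneg source_onD(3)[OF src _ t0, of 1]] by simp
  have gsrc: "source_on t A (\<lambda>i. source_measure.grid_source (\<zeta> i) r t n)" for n
    unfolding source_on_def
  proof (intro ballI conjI)
    fix i s assume i: "i \<in> {1::nat,2}"
    show "antimono_on {0..t} (source_measure.grid_source (\<zeta> i) r t n)"
      by (rule source_measure.grid_source_antimono[OF Z[OF i]])
    show "0 \<le> source_measure.grid_source (\<zeta> i) r t n s" "source_measure.grid_source (\<zeta> i) r t n s \<le> A"
      using source_measure.grid_source_bounds[OF Z[OF i] r rt, of n s] source_onD(3)[OF src i t0] by linarith+
  qed
  obtain M' where "\<And>a. source_on t A a \<Longrightarrow> \<exists>u. mild_solution c b m t M' a u"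
    using h.bounded_solution_exists[OF A0] by blast
  from this[OF gsrc] obtain wn where wn: "\<And>n. mild_solution c b m t M' (\<lambda>i. source_measure.grid_source (\<zeta> i) r t n) (wn n)"
    by metis
  \<comment> \<open>All \<open>wn n\<close> share the level \<open>M'\<close> because every grid
    source is bounded by \<open>A\<close>; passing to the larger of \<open>M\<close> and
    \<open>M'\<close> puts them in one square with \<open>w\<close>.\<close>
  have wlim: "(\<lambda>n. comp i (wn n r)) \<longlonglongrightarrow> comp i (w r)" for i
  proof (rule h.solution_continuous_in_source[OF r0 mild_solution_mono[OF wn max.cobounded2]
        mild_solution_mono[OF w max.cobounded1] gsrc src])
    show "(\<lambda>n. source_measure.grid_source (\<zeta> i) r t n s) \<longlonglongrightarrow> measure (\<zeta> i) {s..t}"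
      if "i \<in> {1,2}" "s \<in> {r..t}" for i s
      by (rule source_measure.grid_source_limit[OF Z[OF that(1)] r rt that(2)])
  qed
  have "(\<lambda>n. exp (- (x \<bullet> wn n r))) \<longlonglongrightarrow> exp (- (x \<bullet> w r))"
  proof -
    have "(\<lambda>n. fst x * comp 1 (wn n r) + snd x * comp 2 (wn n r)) \<longlonglongrightarrow> fst x * comp 1 (w r) + snd x * comp 2 (w r)"
      by (intro tendsto_add tendsto_mult tendsto_const wlim)
    from tendsto_exp[OF tendsto_minus[OF this]] show ?thesis by (simp add: inner_pt comp_def)
  qed
  moreover
  define S where "S = (\<lambda>n \<omega>. \<Sum>k\<le>Suc n. (grid_weight (\<zeta> 1) r t n k, grid_weight (\<zeta> 2) r t n k) \<bullet> X (grid r t n k) \<omega>)"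
  have gr: "r \<le> grid r t n k" for n k using grid_mono_iff[OF rt, of n 0 k] by simp
  have "(\<lambda>n. \<integral>\<omega>. exp (- S n \<omega>) \<partial>P) \<longlonglongrightarrow> (\<integral>\<omega>. exp (- (\<Sum>i\<in>{1::nat,2}. LINT s:{r..t}|\<zeta> i. comp i (X s \<omega>))) \<partial>P)"
  proof (rule integral_dominated_convergence[where w="\<lambda>_. 1"])
    note [measurable] = X_P[OF gr]
    show m: "(\<lambda>\<omega>. exp (- S n \<omega>)) \<in> borel_measurable P" for n unfolding S_def by measurable
    have lim: "(\<lambda>n. exp (- S n \<omega>)) \<longlonglongrightarrow> exp (- (\<Sum>i\<in>{1::nat,2}. LINT s:{r..t}|\<zeta> i. comp i (X s \<omega>)))"
      if \<omega>: "\<omega> \<in> space P" for \<omega>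
    proof -
      obtain B where B: "\<And>s. s \<in> {r..t} \<Longrightarrow> norm (X s \<omega>) \<le> B" using X_bounded[OF \<omega>] by blast
      have cb: "\<bar>comp i (X s \<omega>)\<bar> \<le> B" if "s \<in> {r..t}" for i s
        using B[OF that] norm_fst_le[of "fst (X s \<omega>)" "snd (X s \<omega>)"] norm_snd_le[of "snd (X s \<omega>)" "fst (X s \<omega>)"]
        by (auto simp: comp_def)
      have "(\<lambda>n. \<Sum>k\<le>Suc n. comp i (X (grid r t n k) \<omega>) * grid_weight (\<zeta> i) r t n k) \<longlonglongrightarrow> (LINT s:{r..t}|\<zeta> i. comp i (X s \<omega>))"
        if "i \<in> {1,2}" for i
        by (rule source_measure.grid_sum_limit[OF Z[OF that] r rt cb comp_X_rc[OF \<omega>]]) auto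
      from tendsto_add[OF this[of 1] this[of 2]]
      have "(\<lambda>n. (\<Sum>k\<le>Suc n. comp 1 (X (grid r t n k) \<omega>) * grid_weight (\<zeta> 1) r t n k)
          + (\<Sum>k\<le>Suc n. comp 2 (X (grid r t n k) \<omega>) * grid_weight (\<zeta> 2) r t n k))
        \<longlonglongrightarrow> (LINT s:{r..t}|\<zeta> 1. comp 1 (X s \<omega>)) + (LINT s:{r..t}|\<zeta> 2. comp 2 (X s \<omega>))"
        by simp
      moreover have "S n \<omega> = (\<Sum>k\<le>Suc n. comp 1 (X (grid r t n k) \<omega>) * grid_weight (\<zeta> 1) r t n k)
          + (\<Sum>k\<le>Suc n. comp 2 (X (grid r t n k) \<omega>) * grid_weight (\<zeta> 2) r t n k)" for n
        unfolding S_def sum.distrib[symmetric] by (rule sum.cong) (simp_all add: inner_pt comp_def)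
      ultimately have "(\<lambda>n. S n \<omega>) \<longlonglongrightarrow> (LINT s:{r..t}|\<zeta> 1. comp 1 (X s \<omega>)) + (LINT s:{r..t}|\<zeta> 2. comp 2 (X s \<omega>))"
        by (simp only:)
      then show ?thesis by (intro tendsto_exp tendsto_minus) simp
    qed
    \<comment> \<open>Measurability in the sample point is inherited from the finite grid
      sums.\<close>
    show "(\<lambda>\<omega>. exp (- (\<Sum>i\<in>{1::nat,2}. LINT s:{r..t}|\<zeta> i. comp i (X s \<omega>)))) \<in> borel_measurable P"
      by (rule borel_measurable_LIMSEQ_metric[OF m lim])
    show "AE \<omega> in P. (\<lambda>n. exp (- S n \<omega>)) \<longlonglongrightarrow> exp (- (\<Sum>i\<in>{1::nat,2}. LINT s:{r..t}|\<zeta> i. comp i (X s \<omega>)))"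
      by (rule AE_I2) (rule lim)
    show "AE \<omega> in P. norm (exp (- S n \<omega>)) \<le> 1" for n
    proof (rule AE_I2)
      fix \<omega> assume \<omega>: "\<omega> \<in> space P"
      have "0 \<le> S n \<omega>" unfolding S_def
        by (intro sum_nonneg Rplus2_inner X_Rplus2[OF \<omega> gr]) (simp add: Rplus2_def grid_weight_def)
      then show "norm (exp (- S n \<omega>)) \<le> 1" by simp
    qed
  qed simp
  moreover have "(\<integral>\<omega>. exp (- S n \<omega>) \<partial>P) = exp (- (x \<bullet> wn n r))" for n
    unfolding S_def by (rule laplace_grid[OF hor rt Z wn])
  ultimately show ?thesis by (simp add: LIMSEQ_unique)
qed

end

theorem theorem1p2:
  fixes c :: "nat \<Rightarrow> real \<Rightarrow> real"
    and b :: "nat \<Rightarrow> nat \<Rightarrow> real \<Rightarrow> real"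
    and m :: "nat \<Rightarrow> (real \<times> pt) measure"
    and \<zeta> :: "nat \<Rightarrow> real measure"
    and r :: real
    and P :: "pt \<Rightarrow> 'a measure"
    and Fl :: "real \<Rightarrow> 'a measure"
    and X :: "real \<Rightarrow> 'a \<Rightarrow> pt"
  assumes params: "tcbve_params c b m"
    and r_nonneg: "0 \<le> r"
    and proc: "tcbve_process c b m r P Fl X"
    and zeta: "\<forall>i\<in>{1::nat,2}. sets (\<zeta> i) = sets (restrict_space borel {0..}) \<and>
                 sigma_finite_measure (\<zeta> i) \<and>
                 (\<forall>B\<in>sets (\<zeta> i). bounded B \<longrightarrow> emeasure (\<zeta> i) B < \<infinity>)"
  shows "\<forall>t\<ge>r. \<exists>w.
           cbve_sol c b m (\<lambda>i s. measure (\<zeta> i) {s..t}) t w \<and> (\<forall>s\<in>{0..t}. w s \<in> Rplus2) \<and>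
           (\<forall>w'. cbve_sol c b m (\<lambda>i s. measure (\<zeta> i) {s..t}) t w' \<and> (\<forall>s\<in>{0..t}. w' s \<in> Rplus2)
                  \<longrightarrow> (\<forall>s\<in>{0..t}. w' s = w s)) \<and>
           (\<forall>x\<in>Rplus2.
              (\<integral>\<omega>. exp (- (\<Sum>i\<in>{1::nat,2}. set_lebesgue_integral (\<zeta> i) {r..t} (\<lambda>s. comp i (X s \<omega>)))) \<partial>P x)
                = exp (- (x \<bullet> w r)))"
proof (intro allI impI)
  fix t assume rt: "r \<le> t"
  with r_nonneg have t: "0 \<le> t" by simp
  interpret tcbve c b m by unfold_locales (rule params)
  obtain Q where Q: "tcbve_semigroup c b m Q" and PP: "\<forall>x\<in>Rplus2.
        prob_space (P x) \<and>
        (\<forall>t\<ge>r. subalgebra (P x) (Fl t) \<and> X t \<in> borel_measurable (Fl t)) \<and>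
        (\<forall>s t. r \<le> s \<and> s \<le> t \<longrightarrow> sets (Fl s) \<subseteq> sets (Fl t)) \<and>
        (\<forall>\<omega>\<in>space (P x). (\<forall>t\<ge>r. X t \<omega> \<in> Rplus2) \<and>
           (\<forall>s\<ge>r. continuous (at_right s) (\<lambda>t. X t \<omega>) \<and>
                   (s > r \<longrightarrow> (\<exists>l. ((\<lambda>t. X t \<omega>) \<longlongrightarrow> l) (at_left s))))) \<and>
        (AE \<omega> in P x. X r \<omega> = x) \<and>
        (\<forall>s t (f :: pt \<Rightarrow> real). r \<le> s \<and> s \<le> t \<and> f \<in> borel_measurable borel \<and> bounded (range f) \<longrightarrow>
           (AE \<omega> in P x. real_cond_exp (P x) (Fl s) (\<lambda>\<omega>'. f (X t \<omega>')) \<omega>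
                           = (\<integral>y. f y \<partial>Q s t (X s \<omega>))))"
    using proc unfolding tcbve_process_def by (elim exE conjE)
  interpret tcbve_transition c b m Q by unfold_locales (rule Q)
  have started: "tcbve_started c b m Q r x (P x) Fl X" if x: "x \<in> Rplus2" for x
  proof (intro tcbve_started.intro tcbve_transition_axioms tcbve_started_axioms.intro)
    note p = bspec[OF PP x]
    from p show "prob_space (P x)" by (elim conjE)
    from p have 1: "\<forall>t\<ge>r. subalgebra (P x) (Fl t) \<and> X t \<in> borel_measurable (Fl t)" by (elim conjE)
    from p have 2: "\<forall>s t. r \<le> s \<and> s \<le> t \<longrightarrow> sets (Fl s) \<subseteq> sets (Fl t)" by (elim conjE)
    from p have 3: "\<forall>\<omega>\<in>space (P x). (\<forall>t\<ge>r. X t \<omega> \<in> Rplus2) \<and>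
           (\<forall>s\<ge>r. continuous (at_right s) (\<lambda>t. X t \<omega>) \<and>
                   (s > r \<longrightarrow> (\<exists>l. ((\<lambda>t. X t \<omega>) \<longlongrightarrow> l) (at_left s))))" by (elim conjE)
    from p show "AE \<omega> in P x. X r \<omega> = x" by (elim conjE)
    from p have 4: "\<forall>s t (f :: pt \<Rightarrow> real). r \<le> s \<and> s \<le> t \<and> f \<in> borel_measurable borel \<and> bounded (range f) \<longrightarrow>
           (AE \<omega> in P x. real_cond_exp (P x) (Fl s) (\<lambda>\<omega>'. f (X t \<omega>')) \<omega>
                           = (\<integral>y. f y \<partial>Q s t (X s \<omega>)))" by (elim conjE)
    show "subalgebra (P x) (Fl s)" "X s \<in> borel_measurable (Fl s)" if "r \<le> s" for s
      using 1 that by blast+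
    show "sets (Fl s) \<subseteq> sets (Fl q)" if "r \<le> s" "s \<le> q" for s q
      using 2 that by blast
    show "X s \<omega> \<in> Rplus2" "continuous (at_right s) (\<lambda>q. X q \<omega>)" if "\<omega> \<in> space (P x)" "r \<le> s" for s \<omega>
      using bspec[OF 3 that(1)] that(2) by blast+
    show "\<exists>l. ((\<lambda>q. X q \<omega>) \<longlongrightarrow> l) (at_left s)" if "\<omega> \<in> space (P x)" "r < s" for s \<omega>
      using bspec[OF 3 that(1)] that(2) less_imp_le by blast
    show "AE \<omega> in P x. real_cond_exp (P x) (Fl s) (\<lambda>\<omega>'. f (X q \<omega>')) \<omega> = (\<integral>y. f y \<partial>Q s q (X s \<omega>))"
      if "r \<le> s" "s \<le> q" "f \<in> borel_measurable borel" "bounded (range f)" for s q and f :: "pt \<Rightarrow> real"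
      using 4 that by blast
  qed (use r_nonneg x in auto)
  have Z: "source_measure (\<zeta> i)" if "i \<in> {1,2}" for i
    using bspec[OF zeta that] by unfold_locales auto
  obtain \<mu> where hor: "tcbve_horizon c b m t \<mu>" using horizon_exists[OF t] by blast
  then interpret h: tcbve_horizon c b m t \<mu> .
  define A where "A = measure (\<zeta> 1) {0..t} + measure (\<zeta> 2) {0..t}"
  have src: "source_on t A (\<lambda>i s. measure (\<zeta> i) {s..t})"
    unfolding source_on_def
  proof (intro ballI conjI)
    fix i s assume i: "i \<in> {1::nat,2}" and s: "s \<in> {0..t}"
    have "measure (\<zeta> i) {s..t} \<le> measure (\<zeta> i) {0..t}"
      using source_measure.measure_Icc_mono[OF Z[OF i], of 0 s t] s by simp
    also have "\<dots> \<le> A" using i by (auto simp: A_def)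
    finally show "measure (\<zeta> i) {s..t} \<le> A" .
  qed (use source_measure.measure_Icc_mono[OF Z] in \<open>auto simp: monotone_on_def\<close>)
  have A0: "0 \<le> A" by (simp add: A_def)
  \<comment> \<open>\<open>w\<close> is fixed before any starting point is chosen, so the same
    function serves all \<open>x\<close>.\<close>
  obtain M w where w: "mild_solution c b m t M (\<lambda>i s. measure (\<zeta> i) {s..t}) w"
    using h.bounded_solution_exists[OF A0] src by blast
  have wsol: "cbve_sol c b m (\<lambda>i s. measure (\<zeta> i) {s..t}) t w"
    by (rule h.mild_solution_cbve_sol[OF w])
  note wR = mild_solution_Rplus2[OF w]
  have uniq: "w' s = w s"
    if "cbve_sol c b m (\<lambda>i s. measure (\<zeta> i) {s..t}) t w'" "\<forall>s\<in>{0..t}. w' s \<in> Rplus2" "s \<in> {0..t}" for w' s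
    by (rule h.nonneg_solution_unique[OF that(1) _ wsol wR source_onD(3)[OF src] that(3)]) (use that(2) in auto)
  show "\<exists>w. cbve_sol c b m (\<lambda>i s. measure (\<zeta> i) {s..t}) t w \<and> (\<forall>s\<in>{0..t}. w s \<in> Rplus2) \<and>
           (\<forall>w'. cbve_sol c b m (\<lambda>i s. measure (\<zeta> i) {s..t}) t w' \<and> (\<forall>s\<in>{0..t}. w' s \<in> Rplus2)
                  \<longrightarrow> (\<forall>s\<in>{0..t}. w' s = w s)) \<and>
           (\<forall>x\<in>Rplus2.
              (\<integral>\<omega>. exp (- (\<Sum>i\<in>{1::nat,2}. set_lebesgue_integral (\<zeta> i) {r..t} (\<lambda>s. comp i (X s \<omega>)))) \<partial>P x)
                = exp (- (x \<bullet> w r)))"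
  proof (intro exI[of _ w] conjI allI impI ballI)
    fix x assume "x \<in> Rplus2"
    from tcbve_started.laplace_functional[OF started[OF this] hor rt Z w src]
    show "(\<integral>\<omega>. exp (- (\<Sum>i\<in>{1::nat,2}. set_lebesgue_integral (\<zeta> i) {r..t} (\<lambda>s. comp i (X s \<omega>)))) \<partial>P x)
        = exp (- (x \<bullet> w r))" .
  qed (rule wsol, rule wR, erule conjE, rule uniq)
qed

end
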